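(* Let $p$ be an odd prime, $H=\langle x,y,z\mid\text{class }2,\ \text{exponent }p\rangle$ (the free group of class $2$ and exponent $p$ on $X=\{x,y,z\}$), $n\ge1$, and $P=H\circ\cdots\circ H$ ($2n$ factors). Fix $\alpha,\beta\in\mathbb{Z}_p$ with $\omega=\alpha^2+\beta^2$ a non-square in $\mathbb{Z}_p$. For $0\le m\le n$ let $\mathcal{H}_m=\{K_1,\dots,K_{2m},H_{2m+1},\dots,H_{2n}\}$, where $H_i=\langle g_i:g\in X\rangle$, $K_{2j-1}=\langle g_{2j-1}^{\alpha}g_{2j}^{\beta}:g\in X\rangle$ and $K_{2j}=\langle g_{2j-1}^{\beta}g_{2j}^{-\alpha}:g\in X\rangle$ for $1\le j\le m$. Then: (i) every member of $\mathcal{H}_m$ is isomorphic to $H$; (ii) $\mathcal{H}_m$ is a fully refined central decomposition of $P$; (iii) for every fully refined central decomposition $\mathcal{K}$ of $P$ there is a unique $m$ and some $\alpha'\in C_{\operatorname{Aut}P}(P')$ with $\mathcal{K}\alpha'=\mathcal{H}_m$, so $C_{\operatorname{Aut}P}(P')$ has exactly $1+n$ orbits on fully refined central decompositions; (iv) $\mathcal{H}_m$ and $\mathcal{H}_{m'}$ lie in the same $\operatorname{Aut}P$-orbit if and only if $m'=m$ or $m'=n-m$. Hence $\operatorname{Aut}P$ has exactly $1+\lfloor n/2\rfloor$ orbits on the set of fully refined central decompositions of $P$.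
   Context: $H\circ\cdots\circ H$ ($r$ factors) denotes $(H\times\cdots\times H)/N$ with $N$ generated by the elements having $z$ in coordinate $i$, $z^{-1}$ in coordinate $j$ and $1$ elsewhere, for $i<j$ and $z\in Z(H)$. For $g\in H$, $g_i$ denotes the image in $P$ of the element with $g$ in coordinate $i$ and $1$ elsewhere; exponents in $\mathbb{Z}_p$ are interpreted via integer representatives. A central decomposition of $P$ is a set of subgroups, pairwise commuting elementwise, generating $P$, with no proper subset generating $P$; it is fully refined if each member has no central decomposition other than itself. $\operatorname{Aut}P$ acts by $\mathcal{K}\alpha=\{K\alpha:K\in\mathcal{K}\}$. *)

theory Defs
  imports "HOL-Algebra.Algebra"
begin

definition grp_center :: "('a, 'b) monoid_scheme \<Rightarrow> 'a set" where
  "grp_center G = {c \<in> carrier G. \<forall>g\<in>carrier G. c \<otimes>\<^bsub>G\<^esub> g = g \<otimes>\<^bsub>G\<^esub> c}"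

definition grp_comm :: "('a, 'b) monoid_scheme \<Rightarrow> 'a \<Rightarrow> 'a \<Rightarrow> 'a" where
  "grp_comm G a b = inv\<^bsub>G\<^esub> a \<otimes>\<^bsub>G\<^esub> inv\<^bsub>G\<^esub> b \<otimes>\<^bsub>G\<^esub> a \<otimes>\<^bsub>G\<^esub> b"

definition class_le2 :: "('a, 'b) monoid_scheme \<Rightarrow> bool" where
  "class_le2 G \<longleftrightarrow> (\<forall>a\<in>carrier G. \<forall>b\<in>carrier G. grp_comm G a b \<in> grp_center G)"

definition exponent_p :: "('a, 'b) monoid_scheme \<Rightarrow> nat \<Rightarrow> bool" where
  "exponent_p G p \<longleftrightarrow> (\<forall>g\<in>carrier G. g [^]\<^bsub>G\<^esub> p = \<one>\<^bsub>G\<^esub>)"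

(* H is the free group of class 2 and exponent p on x, y, z, i.e. the relatively free
   group in the variety of groups of class <= 2 and exponent p (universal property).
   Test groups are taken on the countable type nat; this suffices since the image of
   a homomorphism from H is a 3-generated (hence finite) group. *)
definition free_cls2_expp :: "('a, 'b) monoid_scheme \<Rightarrow> nat \<Rightarrow> 'a \<Rightarrow> 'a \<Rightarrow> 'a \<Rightarrow> bool" where
  "free_cls2_expp H p x y z \<longleftrightarrow>
     group H \<and> x \<in> carrier H \<and> y \<in> carrier H \<and> z \<in> carrier H \<and>
     class_le2 H \<and> exponent_p H p \<and> generate H {x, y, z} = carrier H \<and>
     (\<forall>(G :: nat monoid) a b c.
        group G \<and> class_le2 G \<and> exponent_p G p \<and>
        a \<in> carrier G \<and> b \<in> carrier G \<and> c \<in> carrier G \<longrightarrow>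
        (\<exists>f \<in> hom H G. f x = a \<and> f y = b \<and> f z = c))"

definition cp_base :: "('a, 'b) monoid_scheme \<Rightarrow> nat \<Rightarrow> (nat \<Rightarrow> 'a) monoid" where
  "cp_base H r = product_group {1..r} (\<lambda>_. H)"

definition cp_embed :: "('a, 'b) monoid_scheme \<Rightarrow> nat \<Rightarrow> nat \<Rightarrow> 'a \<Rightarrow> (nat \<Rightarrow> 'a)" where
  "cp_embed H r i g = (\<lambda>j\<in>{1..r}. if j = i then g else \<one>\<^bsub>H\<^esub>)"

definition cp_N :: "('a, 'b) monoid_scheme \<Rightarrow> nat \<Rightarrow> (nat \<Rightarrow> 'a) set" where
  "cp_N H r = generate (cp_base H r)
     {(\<lambda>k\<in>{1..r}. if k = i then c else if k = j then inv\<^bsub>H\<^esub> c else \<one>\<^bsub>H\<^esub>) | i j c.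
        1 \<le> i \<and> i < j \<and> j \<le> r \<and> c \<in> grp_center H}"

definition cprod :: "('a, 'b) monoid_scheme \<Rightarrow> nat \<Rightarrow> (nat \<Rightarrow> 'a) set monoid" where
  "cprod H r = cp_base H r Mod cp_N H r"

definition cp_elt :: "('a, 'b) monoid_scheme \<Rightarrow> nat \<Rightarrow> nat \<Rightarrow> 'a \<Rightarrow> (nat \<Rightarrow> 'a) set" where
  "cp_elt H r i g = cp_N H r #>\<^bsub>cp_base H r\<^esub> cp_embed H r i g"

definition Hsub :: "('a, 'b) monoid_scheme \<Rightarrow> nat \<Rightarrow> 'a \<Rightarrow> 'a \<Rightarrow> 'a \<Rightarrow> nat \<Rightarrow> (nat \<Rightarrow> 'a) set set" where
  "Hsub H n x y z i = generate (cprod H (2*n)) {cp_elt H (2*n) i g | g. g \<in> {x, y, z}}"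

definition Ksub :: "('a, 'b) monoid_scheme \<Rightarrow> nat \<Rightarrow> 'a \<Rightarrow> 'a \<Rightarrow> 'a \<Rightarrow> int \<Rightarrow> int \<Rightarrow> nat
                    \<Rightarrow> (nat \<Rightarrow> 'a) set set" where
  "Ksub H n x y z \<alpha> \<beta> i =
     (let P = cprod H (2*n); e = cp_elt H (2*n) in
      if odd i then
        generate P {(e i g [^]\<^bsub>P\<^esub> \<alpha>) \<otimes>\<^bsub>P\<^esub> (e (i+1) g [^]\<^bsub>P\<^esub> \<beta>) | g. g \<in> {x, y, z}}
      else
        generate P {(e (i-1) g [^]\<^bsub>P\<^esub> \<beta>) \<otimes>\<^bsub>P\<^esub> (e i g [^]\<^bsub>P\<^esub> (-\<alpha>)) | g. g \<in> {x, y, z}})"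

definition Hdec :: "('a, 'b) monoid_scheme \<Rightarrow> nat \<Rightarrow> 'a \<Rightarrow> 'a \<Rightarrow> 'a \<Rightarrow> int \<Rightarrow> int \<Rightarrow> nat
                    \<Rightarrow> (nat \<Rightarrow> 'a) set set set" where
  "Hdec H n x y z \<alpha> \<beta> m =
     (\<lambda>i. if i \<le> 2*m then Ksub H n x y z \<alpha> \<beta> i else Hsub H n x y z i) ` {1..2*n}"

definition central_decomp :: "('a, 'b) monoid_scheme \<Rightarrow> 'a set set \<Rightarrow> bool" where
  "central_decomp G \<K> \<longleftrightarrow>
     (\<forall>K\<in>\<K>. subgroup K G) \<and>
     (\<forall>K\<in>\<K>. \<forall>L\<in>\<K>. K \<noteq> L \<longrightarrow> (\<forall>a\<in>K. \<forall>b\<in>L. a \<otimes>\<^bsub>G\<^esub> b = b \<otimes>\<^bsub>G\<^esub> a)) \<and>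
     generate G (\<Union>\<K>) = carrier G \<and>
     (\<forall>\<J>. \<J> \<subset> \<K> \<longrightarrow> generate G (\<Union>\<J>) \<noteq> carrier G)"

definition fully_refined :: "('a, 'b) monoid_scheme \<Rightarrow> 'a set set \<Rightarrow> bool" where
  "fully_refined G \<K> \<longleftrightarrow>
     central_decomp G \<K> \<and>
     (\<forall>K\<in>\<K>. \<forall>\<J>. central_decomp (G\<lparr>carrier := K\<rparr>) \<J> \<longrightarrow> \<J> = {K})"

definition dec_act :: "'a set set \<Rightarrow> ('a \<Rightarrow> 'a) \<Rightarrow> 'a set set" where
  "dec_act \<K> f = (\<lambda>K. f ` K) ` \<K>"

definition aut_centralizing_derived :: "('a, 'b) monoid_scheme \<Rightarrow> ('a \<Rightarrow> 'a) set" where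
  "aut_centralizing_derived G = {f \<in> auto G. \<forall>g\<in>derived G (carrier G). f g = g}"

definition dec_orbits :: "('a \<Rightarrow> 'a) set \<Rightarrow> 'a set set set \<Rightarrow> 'a set set set set" where
  "dec_orbits A S = (\<lambda>\<K>. (\<lambda>f. dec_act \<K> f) ` A) ` S"

end

theory Submission
  imports Defs "HOL-Library.Function_Algebras" "HOL-Number_Theory.Number_Theory"
    "Jordan_Normal_Form.Determinant"
begin

text \<open>Modulo its derived subgroup, \<open>P\<close> is \<open>V = V\<^sub>0 \<otimes> W\<close> with $V_0 = \mathbb{Z}_p^3$ and $W = \mathbb{Z}_p^{2n}$,
  and its commutator form is the tensor product of the cross product on \<open>V\<^sub>0\<close> with the dot product on \<open>W\<close>.
  Projections of \<open>V\<close> that are self-adjoint for this form have the shape \<open>1 \<otimes> f\<close>, so central decompositions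
  of \<open>P\<close> are orthogonal decompositions of \<open>W\<close>, and the fully refined ones are orthogonal frames of
  anisotropic lines. Up to isometry a frame is determined by the number of its vectors of non-square
  norm, which is even because the Gram determinant is a square; this gives the \<open>1 + n\<close> orbits of the
  centralizer of \<open>P'\<close>. An arbitrary automorphism multiplies all norms by a common factor modulo
  squares, so it can only exchange \<open>2m\<close> with \<open>2n - 2m\<close>, and a similitude with non-square factor does so.\<close>

section \<open>Vectors modulo a prime\<close>

text \<open>An automorphism acts on each line V_0 \<otimes> <u> through its own 3 by 3 matrix g;
  what the lines share is the induced map on P'. If u has norm c and its image line has norm d, that
  map is d/c times the cofactor matrix of g, with determinant (d/c)^3 det(g)^2. Since 3 is odd, this
  determinant equals d/c up to squares, and it is the same number for every line: this is why one
  factor \<kappa> controls all square classes at once. Conversely, a similitude S of W with factor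
  \<kappa> acts as 1 \<otimes> S on V and as the scalar \<kappa> on P', of determinant \<kappa>^3,
  again \<kappa> up to squares; \<kappa> = 1 gives elements of the centralizer of P'. Scalars and
  vectors stay integers and are compared modulo q (\<open>veq\<close> looks at the indices 1..r), so
  addition of vectors is literal addition of functions, and dimension arguments become counting of
  coefficient tuples.\<close>

definition veq :: "int \<Rightarrow> nat \<Rightarrow> (nat \<Rightarrow> int) \<Rightarrow> (nat \<Rightarrow> int) \<Rightarrow> bool" where
  "veq q r u v \<longleftrightarrow> (\<forall>i\<in>{1..r}. [u i = v i] (mod q))"

definition dot :: "nat \<Rightarrow> (nat \<Rightarrow> int) \<Rightarrow> (nat \<Rightarrow> int) \<Rightarrow> int" where
  "dot r u v = (\<Sum>i\<in>{1..r}. u i * v i)"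

definition scl :: "int \<Rightarrow> (nat \<Rightarrow> int) \<Rightarrow> nat \<Rightarrow> int" where
  "scl k u = (\<lambda>i. k * u i)"

definition unitv :: "nat \<Rightarrow> nat \<Rightarrow> int" where
  "unitv i = (\<lambda>j. if j = i then 1 else 0)"

lemma scl_apply: "scl k u i = k * u i"
  by (simp add: scl_def)

lemma veq_refl [simp]: "veq q r u u"
  by (simp add: veq_def)

lemma veq_sym: "veq q r u v \<Longrightarrow> veq q r v u"
  by (auto simp: veq_def cong_sym_eq)

lemma veq_trans [trans]: "veq q r u v \<Longrightarrow> veq q r v w \<Longrightarrow> veq q r u w"
  unfolding veq_def using cong_trans by blast

lemma veq_add: "veq q r u v \<Longrightarrow> veq q r u' v' \<Longrightarrow> veq q r (u + u') (v + v')"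
  by (auto simp: veq_def intro: cong_add)

lemma veq_diff: "veq q r u v \<Longrightarrow> veq q r u' v' \<Longrightarrow> veq q r (u - u') (v - v')"
  by (auto simp: veq_def intro: cong_diff)

lemma veq_scl_cong: "[k = l] (mod q) \<Longrightarrow> veq q r (scl k u) (scl l u)"
  by (auto simp: veq_def scl_apply intro: cong_mult)

lemma scl_simps: "scl k (u + v) = scl k u + scl k v" "scl k (u - v) = scl k u - scl k v"
  "scl k (- u) = - scl k u" "scl (k + l) u = scl k u + scl l u" "scl (k - l) u = scl k u - scl l u"
  "scl (- k) u = - scl k u"
  "scl k (scl l u) = scl (k * l) u" "scl k 0 = 0" "scl 0 u = 0" "scl 1 u = u"
  by (auto simp: scl_def fun_eq_iff algebra_simps)

lemma dot_commute: "dot r u v = dot r v u"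
  by (simp add: dot_def mult.commute)

lemma dot_simps [simp]:
  "dot r (u + v) w = dot r u w + dot r v w" "dot r w (u + v) = dot r w u + dot r w v"
  "dot r (u - v) w = dot r u w - dot r v w" "dot r w (u - v) = dot r w u - dot r w v"
  "dot r (- v) w = - dot r v w" "dot r w (- v) = - dot r w v"
  "dot r 0 w = 0" "dot r w 0 = 0"
  "dot r (scl k u) w = k * dot r u w" "dot r w (scl k u) = k * dot r w u"
  by (simp_all add: dot_def scl_apply algebra_simps sum.distrib sum_subtractf sum_negf sum_distrib_left)

lemma dot_cong: "veq q r u u' \<Longrightarrow> veq q r v v' \<Longrightarrow> [dot r u v = dot r u' v'] (mod q)"
  unfolding dot_def veq_def by (intro cong_sum cong_mult) auto

lemma dot_unitv [simp]:
  assumes "i \<in> {1..r}" shows "dot r u (unitv i) = u i" "dot r (unitv i) u = u i"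
  using assms by (auto simp: dot_def unitv_def if_distrib if_distribR sum.delta cong: if_cong)

lemma veq_0_iff_dot: "veq q r u 0 \<longleftrightarrow> (\<forall>v. [dot r u v = 0] (mod q))"
proof
  assume "veq q r u 0"
  then show "\<forall>v. [dot r u v = 0] (mod q)"
    using dot_cong[of q r u 0] dot_simps(7) veq_refl by metis
next
  assume "\<forall>v. [dot r u v = 0] (mod q)"
  then show "veq q r u 0" unfolding veq_def
    using dot_unitv by (metis zero_fun_apply)
qed

lemma veq_iff_dot: "veq q r u v \<longleftrightarrow> (\<forall>w. [dot r u w = dot r v w] (mod q))"
proof
  assume "veq q r u v"
  then show "\<forall>w. [dot r u w = dot r v w] (mod q)"
    using dot_cong veq_refl by metis
next
  assume "\<forall>w. [dot r u w = dot r v w] (mod q)"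
  then show "veq q r u v" unfolding veq_def
    using dot_unitv by metis
qed

text \<open>One component of the commutator form: a component of the cross product of triples whose
  entries are vectors, multiplied by \<open>dot\<close>.\<close>

definition wedge :: "nat \<Rightarrow> (nat \<Rightarrow> int) \<Rightarrow> (nat \<Rightarrow> int) \<Rightarrow> (nat \<Rightarrow> int) \<Rightarrow> (nat \<Rightarrow> int) \<Rightarrow> int" where
  "wedge r a b a' b' = dot r a b' - dot r b a'"

lemma wedge_scl_self [simp]: "wedge r (scl k a) (scl k b) a b = 0" "wedge r a b (scl k a) (scl k b) = 0"
  by (simp_all add: wedge_def dot_commute)

lemma wedge_swap: "wedge r a' b' a b = - wedge r a b a' b'"
  by (simp add: wedge_def dot_commute)

lemma wedge_zero [simp]: "wedge r 0 0 a b = 0" "wedge r a b 0 0 = 0"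
  by (simp_all add: wedge_def)

lemma cong_0_mult_iff:
  fixes q :: int assumes "Factorial_Ring.prime q"
  shows "[a * b = 0] (mod q) \<longleftrightarrow> [a = 0] (mod q) \<or> [b = 0] (mod q)"
  using assms by (simp add: cong_0_iff prime_dvd_mult_iff)

lemma cong_inverse:
  fixes q :: int assumes "Factorial_Ring.prime q" "\<not> [a = 0] (mod q)"
  obtains b where "[a * b = 1] (mod q)" "[b * a = 1] (mod q)" "\<not> [b = 0] (mod q)"
proof -
  have "coprime a q"
    using assms prime_imp_coprime[of q a] by (simp add: cong_0_iff coprime_commute)
  then obtain b where b: "[a * b = 1] (mod q)"
    using cong_solve_coprime_int by blast
  have "\<not> [b = 0] (mod q)"
  proof
    assume "[b = 0] (mod q)"
    then have "[a * b = a * 0] (mod q)" by (intro cong_mult) auto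
    with b have "[1 = 0] (mod q)" by (metis cong_sym cong_trans mult_zero_right)
    then show False using assms(1) not_prime_unit[of q] by (simp add: cong_0_iff)
  qed
  with b that show ?thesis by (metis mult.commute)
qed

section \<open>Heisenberg coordinates\<close>

text \<open>Coordinates of a group of Heisenberg type: the Baer correspondence lets one write the
  central product of \<open>r\<close> copies of the free group of class 2 and exponent \<open>q\<close> on three generators as
  $(\mathbb{Z}_q^3 \otimes \mathbb{Z}_q^r) \times \mathbb{Z}_q^3$, with multiplication twisted by
  the tensor product of the cross product and the dot product. Coordinates are integers, read modulo \<open>q\<close>.
  The commutator is twice the twist, which avoids dividing by 2.\<close>

locale heisenberg_coords = group G for G (structure) +
  fixes q :: int and r :: nat
    and E :: "(nat \<Rightarrow> int) \<Rightarrow> (nat \<Rightarrow> int) \<Rightarrow> (nat \<Rightarrow> int) \<Rightarrow> int \<Rightarrow> int \<Rightarrow> int \<Rightarrow> 'a"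
  assumes prime_q: "Factorial_Ring.prime q" and odd_q: "odd q" and r_pos: "r \<ge> 1"
    and E_closed [simp]: "E a b c s t w \<in> carrier G"
    and E_surj: "g \<in> carrier G \<Longrightarrow> \<exists>a b c s t w. g = E a b c s t w"
    and E_eq_iff: "E a b c s t w = E a' b' c' s' t' w' \<longleftrightarrow>
        veq q r a a' \<and> veq q r b b' \<and> veq q r c c' \<and>
        [s = s'] (mod q) \<and> [t = t'] (mod q) \<and> [w = w'] (mod q)"
    and E_mult: "E a b c s t w \<otimes> E a' b' c' s' t' w' =
        E (a + a') (b + b') (c + c')
          (s + s' + wedge r b c b' c') (t + t' + wedge r c a c' a') (w + w' + wedge r a b a' b')"
begin

lemma E_one: "E 0 0 0 0 0 0 = \<one>"
proof -
  have "E 0 0 0 0 0 0 \<otimes> E 0 0 0 0 0 0 = E 0 0 0 0 0 0" by (simp add: E_mult)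
  then show ?thesis by (simp only: r_cancel_one' l_cancel_one E_closed)
qed

lemma E_inv: "inv (E a b c s t w) = E (- a) (- b) (- c) (- s) (- t) (- w)"
  by (rule inv_equality) (simp_all add: E_mult E_one wedge_def dot_commute)

lemma E_nat_pow: "E a b c s t w [^] (k::nat) =
   E (scl (int k) a) (scl (int k) b) (scl (int k) c) (int k * s) (int k * t) (int k * w)"
proof (induction k)
  case 0
  have "E (scl 0 a) (scl 0 b) (scl 0 c) 0 0 0 = \<one>" by (simp add: scl_simps E_one)
  then show ?case by simp
next
  case (Suc k)
  have "E (scl (int k) a) (scl (int k) b) (scl (int k) c) (int k * s) (int k * t) (int k * w) \<otimes> E a b c s t w
    = E (scl (1 + int k) a) (scl (1 + int k) b) (scl (1 + int k) c)
        ((1 + int k) * s) ((1 + int k) * t) ((1 + int k) * w)"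
    by (simp add: E_mult scl_simps algebra_simps)
  with Suc show ?case by simp
qed

lemma E_int_pow: "E a b c s t w [^] (k::int) =
   E (scl k a) (scl k b) (scl k c) (k * s) (k * t) (k * w)"
proof (cases "k \<ge> 0")
  case True
  then obtain m where "k = int m" by (metis nat_eq_iff)
  then show ?thesis by (simp add: int_pow_int E_nat_pow)
next
  case False
  then obtain m where "k = - int m" by (metis int_cases2 of_nat_0_le_iff)
  then show ?thesis by (simp add: int_pow_neg_int E_nat_pow E_inv scl_simps)
qed

lemma cong_0_double: "[2 * x = 0] (mod q) \<longleftrightarrow> [x = 0] (mod q)"
proof -
  have "\<not> q dvd 2"
    using odd_q prime_q by (metis primes_dvd_imp_eq dvd_refl prime_int_numeral_eq two_is_prime_nat)
  then show ?thesis using cong_0_mult_iff[OF prime_q, of 2 x] by (simp add: cong_0_iff)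
qed

lemma not_cong_1_0: "\<not> [1 = 0] (mod q)"
  using not_prime_unit[of q] prime_q by (auto simp: cong_0_iff)

text \<open>Exchanging the factors negates the three twists, so commuting means that twice each
  twist vanishes, and 2 is a unit modulo q.\<close>

lemma E_commute_iff: "E a b c s t w \<otimes> E a' b' c' s' t' w' = E a' b' c' s' t' w' \<otimes> E a b c s t w \<longleftrightarrow>
   [wedge r b c b' c' = 0] (mod q) \<and> [wedge r c a c' a' = 0] (mod q) \<and> [wedge r a b a' b' = 0] (mod q)"
proof -
  have *: "[s + s' + W = s' + s + - W] (mod q) \<longleftrightarrow> [W = 0] (mod q)" for s s' W
  proof -
    have "[s + s' + W = s' + s + - W] (mod q) \<longleftrightarrow> [2 * W = 0] (mod q)"
      by (simp add: cong_iff_dvd_diff)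
    then show ?thesis by (simp add: cong_0_double)
  qed
  show ?thesis
    unfolding E_mult E_eq_iff wedge_swap[of r b' c' b c] wedge_swap[of r c' a' c a] wedge_swap[of r a' b' a b] *
    by (simp add: add.commute)
qed

text \<open>Both commutator conventions occur: \<open>grp_comm\<close> is the first,
  \<open>derived\<close> uses the second. In class 2 they agree.\<close>

lemma E_comm:
  "inv E a b c s t w \<otimes> inv E a' b' c' s' t' w' \<otimes> E a b c s t w \<otimes> E a' b' c' s' t' w' =
   E 0 0 0 (2 * wedge r b c b' c') (2 * wedge r c a c' a') (2 * wedge r a b a' b')"
  "E a b c s t w \<otimes> E a' b' c' s' t' w' \<otimes> inv E a b c s t w \<otimes> inv E a' b' c' s' t' w' =
   E 0 0 0 (2 * wedge r b c b' c') (2 * wedge r c a c' a') (2 * wedge r a b a' b')"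
  by (simp_all add: E_inv E_mult wedge_def dot_commute algebra_simps)

text \<open>Membership of the vector with blocks a, b, c in the image of \<open>K\<close> in V = V_0
  \<otimes> W.\<close>

definition coords_in :: "'a set \<Rightarrow> (nat \<Rightarrow> int) \<Rightarrow> (nat \<Rightarrow> int) \<Rightarrow> (nat \<Rightarrow> int) \<Rightarrow> bool" where
  "coords_in K a b c \<longleftrightarrow> (\<exists>s t w. E a b c s t w \<in> K)"

lemma coords_in_cong:
  assumes "veq q r a a'" "veq q r b b'" "veq q r c c'" "coords_in K a b c"
  shows "coords_in K a' b' c'"
proof -
  from assms(4) obtain s t w where "E a b c s t w \<in> K" by (auto simp: coords_in_def)
  moreover have "E a b c s t w = E a' b' c' s t w" using assms by (simp add: E_eq_iff)
  ultimately show ?thesis by (auto simp: coords_in_def)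
qed

lemma coords_in_add:
  assumes "subgroup K G" "coords_in K a b c" "coords_in K a' b' c'"
  shows "coords_in K (a + a') (b + b') (c + c')"
  using assms subgroup.m_closed[OF assms(1)] unfolding coords_in_def by (metis E_mult)

lemma coords_in_scl:
  assumes "subgroup K G" "coords_in K a b c"
  shows "coords_in K (scl k a) (scl k b) (scl k c)"
  using assms subgroup_int_pow_closed[OF assms(1)] unfolding coords_in_def by (metis E_int_pow)

lemma coords_in_diff:
  assumes "subgroup K G" "coords_in K a b c" "coords_in K a' b' c'"
  shows "coords_in K (a - a') (b - b') (c - c')"
  using coords_in_add[OF assms(1,2) coords_in_scl[OF assms(1,3), of "-1"]] by (simp add: scl_simps)

text \<open>The commutator of lifts of two basis vectors of V_0 tensored with \<open>u\<close> hits
  a single central coordinate, with value twice the norm of \<open>u\<close> up to sign. Anisotropy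
  makes this a unit, so powers reach every central element.\<close>

lemma center_subset:
  assumes K: "subgroup K G" and u: "coords_in K u 0 0" "coords_in K 0 u 0" "coords_in K 0 0 u"
    and "\<not> [dot r u u = 0] (mod q)"
  shows "E 0 0 0 s t w \<in> K"
proof -
  interpret K: subgroup K G by (rule K)
  let ?d = "2 * dot r u u"
  have "\<not> [?d = 0] (mod q)" using assms cong_0_double by blast
  then obtain e where e: "[?d * e = 1] (mod q)" by (rule cong_inverse[OF prime_q])
  have ex: "[k * e * ?d = k] (mod q)" for k
  proof -
    have "[?d * e * k = 1 * k] (mod q)" by (intro cong_mult e) auto
    then show ?thesis by (simp add: ac_simps)
  qed
  obtain s1 t1 w1 s2 t2 w2 s3 t3 w3 where
    g: "E u 0 0 s1 t1 w1 \<in> K" "E 0 u 0 s2 t2 w2 \<in> K" "E 0 0 u s3 t3 w3 \<in> K"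
    using u by (auto simp: coords_in_def)
  have comm: "inv g \<otimes> inv h \<otimes> g \<otimes> h \<in> K" if "g \<in> K" "h \<in> K" for g h
    using that by simp
  have "E 0 0 0 ?d 0 0 \<in> K" using comm[OF g(2,3)] unfolding E_comm by (simp add: wedge_def)
  then have "E 0 0 0 ?d 0 0 [^] (s * e) \<in> K" by (rule subgroup_int_pow_closed[OF K])
  moreover have "E 0 0 0 ?d 0 0 [^] (s * e) = E 0 0 0 s 0 0"
    unfolding E_int_pow E_eq_iff using ex by (simp add: scl_simps)
  ultimately have 1: "E 0 0 0 s 0 0 \<in> K" by simp
  have "E 0 0 0 0 ?d 0 \<in> K" using comm[OF g(3,1)] unfolding E_comm by (simp add: wedge_def)
  then have "E 0 0 0 0 ?d 0 [^] (t * e) \<in> K" by (rule subgroup_int_pow_closed[OF K])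
  moreover have "E 0 0 0 0 ?d 0 [^] (t * e) = E 0 0 0 0 t 0"
    unfolding E_int_pow E_eq_iff using ex by (simp add: scl_simps)
  ultimately have 2: "E 0 0 0 0 t 0 \<in> K" by simp
  have "E 0 0 0 0 0 ?d \<in> K" using comm[OF g(1,2)] unfolding E_comm by (simp add: wedge_def)
  then have "E 0 0 0 0 0 ?d [^] (w * e) \<in> K" by (rule subgroup_int_pow_closed[OF K])
  moreover have "E 0 0 0 0 0 ?d [^] (w * e) = E 0 0 0 0 0 w"
    unfolding E_int_pow E_eq_iff using ex by (simp add: scl_simps)
  ultimately have 3: "E 0 0 0 0 0 w \<in> K" by simp
  have "E 0 0 0 s 0 0 \<otimes> E 0 0 0 0 t 0 \<otimes> E 0 0 0 0 0 w \<in> K" using 1 2 3 by simp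
  then show ?thesis by (simp add: E_mult)
qed

lemma mem_if_center_subset:
  assumes "subgroup K G" "\<And>s t w. E 0 0 0 s t w \<in> K"
  shows "E a b c s t w \<in> K \<longleftrightarrow> coords_in K a b c"
proof
  assume "coords_in K a b c"
  then obtain s' t' w' where "E a b c s' t' w' \<in> K" by (auto simp: coords_in_def)
  then have "E a b c s' t' w' \<otimes> E 0 0 0 (s - s') (t - t') (w - w') \<in> K"
    using assms subgroup.m_closed by metis
  then show "E a b c s t w \<in> K" by (simp add: E_mult)
qed (auto simp: coords_in_def)

text \<open>The derived subgroup consists of non-generators.\<close>

lemma subgroup_eq_carrier:
  assumes "subgroup K G" "\<And>a b c. coords_in K a b c"
  shows "K = carrier G"
proof -
  \<comment> \<open>A vector of norm 1, to which \<open>center_subset\<close> applies.\<close>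
  have "dot r (unitv 1) (unitv 1) = 1" using r_pos by (subst dot_unitv) (auto simp: unitv_def)
  then have "E 0 0 0 s t w \<in> K" for s t w
    using center_subset[OF assms(1), of "unitv 1"] assms(2) not_cong_1_0 by auto
  then have "E a b c s t w \<in> K" for a b c s t w
    using mem_if_center_subset assms by blast
  then show ?thesis using E_surj subgroup.subset[OF assms(1)] by blast
qed

end

section \<open>Central decompositions\<close>

definition centralizer :: "('a, 'b) monoid_scheme \<Rightarrow> 'a set \<Rightarrow> 'a set" where
  "centralizer G K = {h \<in> carrier G. \<forall>k\<in>K. k \<otimes>\<^bsub>G\<^esub> h = h \<otimes>\<^bsub>G\<^esub> k}"

context group
begin

lemma subgroup_centralizer:
  assumes "K \<subseteq> carrier G"
  shows "subgroup (centralizer G K) G"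
proof (rule subgroupI)
  fix a b assume ab: "a \<in> centralizer G K" "b \<in> centralizer G K"
  then have [simp]: "a \<in> carrier G" "b \<in> carrier G" by (auto simp: centralizer_def)
  have "k \<otimes> (a \<otimes> b) = (a \<otimes> b) \<otimes> k" if "k \<in> K" for k
  proof -
    have [simp]: "k \<in> carrier G" using assms that by blast
    have "k \<otimes> (a \<otimes> b) = (k \<otimes> a) \<otimes> b" by (simp add: m_assoc)
    also have "\<dots> = a \<otimes> (k \<otimes> b)" using ab that by (simp add: centralizer_def m_assoc)
    also have "\<dots> = (a \<otimes> b) \<otimes> k" using ab that by (simp add: centralizer_def m_assoc)
    finally show ?thesis .
  qed
  then show "a \<otimes> b \<in> centralizer G K" by (simp add: centralizer_def)
next
  fix a assume a: "a \<in> centralizer G K"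
  then have [simp]: "a \<in> carrier G" by (auto simp: centralizer_def)
  have "k \<otimes> inv a = inv a \<otimes> k" if "k \<in> K" for k
  proof -
    have [simp]: "k \<in> carrier G" using assms that by blast
    have "inv a \<otimes> k = inv a \<otimes> (k \<otimes> a) \<otimes> inv a" by (simp add: m_assoc)
    also have "k \<otimes> a = a \<otimes> k" using a that by (simp add: centralizer_def)
    also have "inv a \<otimes> (a \<otimes> k) \<otimes> inv a = k \<otimes> inv a" by (simp add: m_assoc[symmetric])
    finally show ?thesis by simp
  qed
  then show "inv a \<in> centralizer G K" by (simp add: centralizer_def)
next
  have "\<one> \<in> centralizer G K" using assms by (auto simp: centralizer_def)
  then show "centralizer G K \<noteq> {}" by blast
qed (auto simp: centralizer_def)

lemma commuting_set_mult_subgroup: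
  assumes "subgroup K G"
  shows "subgroup (K <#> centralizer G K) G"
proof -
  interpret K: subgroup K G by (rule assms)
  interpret C: subgroup "centralizer G K" G by (rule subgroup_centralizer) auto
  have comm: "k \<otimes> h = h \<otimes> k" if "k \<in> K" "h \<in> centralizer G K" for k h
    using that unfolding centralizer_def by blast
  show ?thesis
  proof (rule subgroupI)
    show "K <#> centralizer G K \<subseteq> carrier G" by (auto simp: set_mult_def)
    show "K <#> centralizer G K \<noteq> {}"
      using K.one_closed C.one_closed unfolding set_mult_def by blast
    fix x y assume "x \<in> K <#> centralizer G K" "y \<in> K <#> centralizer G K"
    then obtain k h k' h' where *: "k \<in> K" "h \<in> centralizer G K" "x = k \<otimes> h"
      "k' \<in> K" "h' \<in> centralizer G K" "y = k' \<otimes> h'" by (auto simp: set_mult_def)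
    then have [simp]: "k \<in> carrier G" "h \<in> carrier G" "k' \<in> carrier G" "h' \<in> carrier G"
      using K.subset C.subset by blast+
    have "x \<otimes> y = k \<otimes> (h \<otimes> k') \<otimes> h'" unfolding *(3,6) by (simp add: m_assoc)
    also have "h \<otimes> k' = k' \<otimes> h" using * comm[of k' h] by simp
    also have "k \<otimes> (k' \<otimes> h) \<otimes> h' = (k \<otimes> k') \<otimes> (h \<otimes> h')" by (simp add: m_assoc)
    finally show "x \<otimes> y \<in> K <#> centralizer G K"
      using * K.m_closed C.m_closed by (auto simp: set_mult_def)
    have "inv x = inv k \<otimes> inv h"
      using * comm[of "inv k" "inv h"] by (simp add: inv_mult_group)
    then show "inv x \<in> K <#> centralizer G K"
      using * K.m_inv_closed C.m_inv_closed by (auto simp: set_mult_def)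
  qed
qed

text \<open>Every other member commutes with \<open>K\<close>, hence lies in its centralizer, so the
  product subgroup \<open>K <#> centralizer G K\<close> contains all generators.\<close>

lemma central_decomp_split:
  assumes dec: "central_decomp G \<K>" and "K \<in> \<K>" "g \<in> carrier G"
  obtains k h where "k \<in> K" "h \<in> centralizer G K" "g = k \<otimes> h"
proof -
  have K: "subgroup K G" using assms by (auto simp: central_decomp_def)
  interpret K: subgroup K G by (rule K)
  interpret C: subgroup "centralizer G K" G by (rule subgroup_centralizer) auto
  have "generate G (\<Union>\<K>) \<subseteq> K <#> centralizer G K"
  proof (rule generate_subgroup_incl[OF _ commuting_set_mult_subgroup[OF K]], rule Union_least)
    fix L assume L: "L \<in> \<K>"
    then have "L \<subseteq> carrier G" using dec subgroup.subset by (auto simp: central_decomp_def)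
    show "L \<subseteq> K <#> centralizer G K"
    proof (cases "L = K")
      case True
      have "k \<in> K <#> centralizer G K" if "k \<in> K" for k
        unfolding set_mult_def using C.one_closed that r_one[of k] by fastforce
      then show ?thesis using True by blast
    next
      case False
      then have "\<forall>a\<in>K. \<forall>b\<in>L. a \<otimes> b = b \<otimes> a"
        using dec \<open>K \<in> \<K>\<close> L unfolding central_decomp_def by blast
      then have *: "h \<in> centralizer G K" if "h \<in> L" for h
        using \<open>L \<subseteq> carrier G\<close> that unfolding centralizer_def by blast
      have "h \<in> K <#> centralizer G K" if "h \<in> L" for h
      proof -
        have "h = \<one> \<otimes> h" using that \<open>L \<subseteq> carrier G\<close> by auto
        then show ?thesis unfolding set_mult_def using K.one_closed *[OF that] by blast
      qed
      then show ?thesis by blast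
    qed
  qed
  moreover have "generate G (\<Union>\<K>) = carrier G" using dec by (simp add: central_decomp_def)
  ultimately have "g \<in> K <#> centralizer G K" using \<open>g \<in> carrier G\<close> by blast
  then show ?thesis using that by (auto simp: set_mult_def)
qed

end

section \<open>Self-adjoint projections for the commutator form\<close>

context heisenberg_coords
begin

text \<open>Commuting with x \<otimes> v for all v kills \<open>b\<close> and \<open>c\<close>;
  commuting with y \<otimes> v kills \<open>a\<close>.\<close>

lemma E_central:
  assumes "\<And>g. g \<in> carrier G \<Longrightarrow> E a b c s t w \<otimes> g = g \<otimes> E a b c s t w"
  shows "veq q r a 0" "veq q r b 0" "veq q r c 0"
proof -
  have "[wedge r b c 0 0 = 0] (mod q) \<and> [wedge r c a 0 v = 0] (mod q) \<and> [wedge r a b v 0 = 0] (mod q)" for v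
    using assms[of "E v 0 0 0 0 0"] unfolding E_commute_iff by simp
  then show "veq q r b 0" "veq q r c 0"
    unfolding veq_0_iff_dot by (auto simp: wedge_def cong_0_iff)
  have "[wedge r a b 0 v = 0] (mod q)" for v
    using assms[of "E 0 v 0 0 0 0"] unfolding E_commute_iff by simp
  then show "veq q r a 0"
    unfolding veq_0_iff_dot by (auto simp: wedge_def cong_0_iff)
qed

lemma centralizer_wedge:
  assumes "coords_in K a b c" "coords_in (centralizer G K) a' b' c'"
  shows "[wedge r b c b' c' = 0] (mod q) \<and> [wedge r c a c' a' = 0] (mod q) \<and> [wedge r a b a' b' = 0] (mod q)"
proof -
  obtain s t w s' t' w' where "E a b c s t w \<in> K" "E a' b' c' s' t' w' \<in> centralizer G K"
    using assms by (auto simp: coords_in_def)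
  then show ?thesis using E_commute_iff unfolding centralizer_def by blast
qed

text \<open>The self-adjoint projection onto \<open>K\<close> is \<open>1 \<otimes> f\<close>: an endomorphism self-adjoint for the cross
  product of a 3-dimensional space is scalar.\<close>

lemma selfadjoint_projection:
  assumes K: "subgroup K G"
    and split: "\<And>g. g \<in> carrier G \<Longrightarrow> \<exists>k\<in>K. \<exists>h\<in>centralizer G K. g = k \<otimes> h"
  obtains f where "\<And>u. coords_in K (f u) 0 0" "\<And>u. coords_in K 0 (f u) 0" "\<And>u. coords_in K 0 0 (f u)"
    "\<And>u. coords_in (centralizer G K) (u - f u) 0 0" "\<And>u. coords_in (centralizer G K) 0 (u - f u) 0"
    "\<And>u. coords_in (centralizer G K) 0 0 (u - f u)"
proof -
  have K': "K \<subseteq> carrier G" using K subgroup.subset by blast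
  have split': "\<exists>a b c. coords_in K a b c \<and> coords_in (centralizer G K) (a' - a) (b' - b) (c' - c)" for a' b' c'
  proof -
    obtain k h where kh: "k \<in> K" "h \<in> centralizer G K" "E a' b' c' 0 0 0 = k \<otimes> h"
      using split[of "E a' b' c' 0 0 0"] by auto
    obtain a b c s t w where k: "k = E a b c s t w" using E_surj kh(1) K' by blast
    obtain a1 b1 c1 s1 t1 w1 where h: "h = E a1 b1 c1 s1 t1 w1"
      using E_surj kh(2) unfolding centralizer_def by blast
    have "veq q r a' (a + a1)" "veq q r b' (b + b1)" "veq q r c' (c + c1)"
      using kh(3) unfolding k h E_mult E_eq_iff by auto
    then have "veq q r a1 (a' - a)" "veq q r b1 (b' - b)" "veq q r c1 (c' - c)"
      by (auto simp: veq_def cong_iff_dvd_diff algebra_simps dvd_diff_commute)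
    moreover have "coords_in (centralizer G K) a1 b1 c1"
      using kh(2) h by (auto simp: coords_in_def)
    ultimately have "coords_in (centralizer G K) (a' - a) (b' - b) (c' - c)"
      using coords_in_cong by blast
    moreover have "coords_in K a b c" using kh(1) k by (auto simp: coords_in_def)
    ultimately show ?thesis by blast
  qed
  note orth = centralizer_wedge[of K]
  \<comment> \<open>\<open>a1\<close>, \<open>b1\<close>, \<open>c1\<close> are the three blocks of
    the K-component of x \<otimes> u, chosen vector by vector; the next two choices treat y
    \<otimes> u and z \<otimes> u.\<close>
  obtain a1 b1 c1 where x: "\<And>u. coords_in K (a1 u) (b1 u) (c1 u)"
    "\<And>u. coords_in (centralizer G K) (u - a1 u) (0 - b1 u) (0 - c1 u)"
    using split'[of _ 0 0] by metis
  obtain a2 b2 c2 where y: "\<And>u. coords_in K (a2 u) (b2 u) (c2 u)"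
    "\<And>u. coords_in (centralizer G K) (0 - a2 u) (u - b2 u) (0 - c2 u)"
    using split'[of 0 _ 0] by metis
  obtain a3 b3 c3 where z: "\<And>u. coords_in K (a3 u) (b3 u) (c3 u)"
    "\<And>u. coords_in (centralizer G K) (0 - a3 u) (0 - b3 u) (u - c3 u)"
    using split'[of 0 0] by metis
  have sum0: "[m = 0] (mod q)" if "[l = 0] (mod q)" "[l' = 0] (mod q)" "l + l' = m" for l l' m :: int
    using cong_add[OF that(1,2)] that(3) by simp
  \<comment> \<open>Write B for the form and \<pi> for the projection. Adding B(\<pi> g, h - \<pi>
    h) = 0 and B(\<pi> h, g - \<pi> g) = 0 cancels the two terms in \<pi> g and \<pi> h, as B is
    alternating, and leaves B(\<pi> g, h) = B(g, \<pi> h). The three components of this are read off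
    for each pair of basis vectors of V_0.\<close>
  have xy: "[- dot r (c1 u) v = 0] (mod q)" "[dot r (c2 v) u = 0] (mod q)"
    "[dot r (a1 u) v - dot r (b2 v) u = 0] (mod q)" for u v
  proof -
    note 1 = orth[OF x(1)[of u] y(2)[of v]] and 2 = orth[OF y(1)[of v] x(2)[of u]]
    show "[- dot r (c1 u) v = 0] (mod q)"
      by (rule sum0[OF 1[THEN conjunct1] 2[THEN conjunct1]]) (simp add: wedge_def dot_commute)
    show "[dot r (c2 v) u = 0] (mod q)"
      by (rule sum0[OF 1[THEN conjunct2, THEN conjunct1] 2[THEN conjunct2, THEN conjunct1]])
        (simp add: wedge_def dot_commute)
    show "[dot r (a1 u) v - dot r (b2 v) u = 0] (mod q)"
      by (rule sum0[OF 1[THEN conjunct2, THEN conjunct2] 2[THEN conjunct2, THEN conjunct2]])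
        (simp add: wedge_def dot_commute)
  qed
  have xz: "[dot r (b1 u) v = 0] (mod q)" "[- dot r (b3 v) u = 0] (mod q)"
    "[dot r (c3 v) u - dot r (a1 u) v = 0] (mod q)" for u v
  proof -
    note 1 = orth[OF x(1)[of u] z(2)[of v]] and 2 = orth[OF z(1)[of v] x(2)[of u]]
    show "[dot r (b1 u) v = 0] (mod q)"
      by (rule sum0[OF 1[THEN conjunct1] 2[THEN conjunct1]]) (simp add: wedge_def dot_commute)
    show "[dot r (c3 v) u - dot r (a1 u) v = 0] (mod q)"
      by (rule sum0[OF 1[THEN conjunct2, THEN conjunct1] 2[THEN conjunct2, THEN conjunct1]])
        (simp add: wedge_def dot_commute)
    show "[- dot r (b3 v) u = 0] (mod q)"
      by (rule sum0[OF 1[THEN conjunct2, THEN conjunct2] 2[THEN conjunct2, THEN conjunct2]])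
        (simp add: wedge_def dot_commute)
  qed
  have yz: "[dot r (b2 u) v - dot r (c3 v) u = 0] (mod q)" "[- dot r (a2 u) v = 0] (mod q)"
    "[dot r (a3 v) u = 0] (mod q)" for u v
  proof -
    note 1 = orth[OF y(1)[of u] z(2)[of v]] and 2 = orth[OF z(1)[of v] y(2)[of u]]
    show "[dot r (b2 u) v - dot r (c3 v) u = 0] (mod q)"
      by (rule sum0[OF 1[THEN conjunct1] 2[THEN conjunct1]]) (simp add: wedge_def dot_commute)
    show "[- dot r (a2 u) v = 0] (mod q)"
      by (rule sum0[OF 1[THEN conjunct2, THEN conjunct1] 2[THEN conjunct2, THEN conjunct1]])
        (simp add: wedge_def dot_commute)
    show "[dot r (a3 v) u = 0] (mod q)"
      by (rule sum0[OF 1[THEN conjunct2, THEN conjunct2] 2[THEN conjunct2, THEN conjunct2]])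
        (simp add: wedge_def dot_commute)
  qed
  have zero: "veq q r (b1 u) 0" "veq q r (c1 u) 0" "veq q r (a2 u) 0" "veq q r (c2 u) 0"
    "veq q r (a3 u) 0" "veq q r (b3 u) 0" for u
    unfolding veq_0_iff_dot using xy(1,2) xz(1,2) yz(2,3) by (simp_all add: cong_0_iff)
  \<comment> \<open>Any two of the three diagonal blocks are adjoint to each other; going through
    the third one shows that all coincide.\<close>
  have sym: "[dot r (b2 u) v = dot r (c3 v) u] (mod q)" "[dot r (c3 v) u = dot r (a1 u) v] (mod q)"
    "[dot r (a1 u) v = dot r (b2 v) u] (mod q)" for u v
    using yz(1) xz(3) xy(3) by (simp_all add: cong_diff_iff_cong_0)
  have b2: "veq q r (b2 u) (a1 u)" for u
    unfolding veq_iff_dot by (intro allI cong_trans[OF sym(1) sym(2)])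
  have "veq q r (c3 u) (b2 u)" for u
    unfolding veq_iff_dot by (intro allI cong_trans[OF sym(2) sym(3)])
  with b2 have c3: "veq q r (c3 u) (a1 u)" for u
    using veq_trans by blast
  have neg0: "veq q r (0 - v) 0" if "veq q r v 0" for v
    using veq_diff[OF veq_refl that, of 0] by simp
  show ?thesis
  proof (rule that[of a1])
    fix u
    show "coords_in K (a1 u) 0 0" by (rule coords_in_cong[OF _ _ _ x(1)[of u]]) (simp_all add: zero)
    show "coords_in K 0 (a1 u) 0" by (rule coords_in_cong[OF _ _ _ y(1)[of u]]) (simp_all add: zero b2)
    show "coords_in K 0 0 (a1 u)" by (rule coords_in_cong[OF _ _ _ z(1)[of u]]) (simp_all add: zero c3)
    show "coords_in (centralizer G K) (u - a1 u) 0 0"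
      by (rule coords_in_cong[OF _ _ _ x(2)[of u]]) (simp_all only: zero neg0 veq_refl)
    show "coords_in (centralizer G K) 0 (u - a1 u) 0"
      by (rule coords_in_cong[OF _ _ _ y(2)[of u]]) (simp_all only: zero neg0 veq_diff b2 veq_refl)
    show "coords_in (centralizer G K) 0 0 (u - a1 u)"
      by (rule coords_in_cong[OF _ _ _ z(2)[of u]]) (simp_all only: zero neg0 veq_diff c3 veq_refl)
  qed
qed

end

lemma veq_diff_0_iff: "veq q r (u - v) 0 \<longleftrightarrow> veq q r u v"
  by (simp add: veq_def cong_diff_iff_cong_0)

section \<open>Members of a central decomposition as nondegenerate subspaces of W\<close>

context heisenberg_coords
begin

lemma subgroup_coords_in:
  assumes "subgroup K G"
  shows "subgroup {E a b c s t w | a b c s t w. coords_in K a b c} G"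
proof (rule subgroupI)
  have "coords_in K 0 0 0"
    using subgroup.one_closed[OF assms] E_one unfolding coords_in_def by metis
  then show "{E a b c s t w | a b c s t w. coords_in K a b c} \<noteq> {}" by blast
next
  fix g assume "g \<in> {E a b c s t w | a b c s t w. coords_in K a b c}"
  then obtain a b c s t w where g: "g = E a b c s t w" "coords_in K a b c" by blast
  have "coords_in K (- a) (- b) (- c)" using coords_in_scl[OF assms g(2), of "-1"] by (simp add: scl_simps)
  then show "inv g \<in> {E a b c s t w | a b c s t w. coords_in K a b c}"
    unfolding g(1) E_inv by blast
next
  fix g h assume "g \<in> {E a b c s t w | a b c s t w. coords_in K a b c}"
    "h \<in> {E a b c s t w | a b c s t w. coords_in K a b c}"
  then obtain a b c s t w a' b' c' s' t' w' where g: "g = E a b c s t w" "coords_in K a b c"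
    "h = E a' b' c' s' t' w'" "coords_in K a' b' c'" by blast
  show "g \<otimes> h \<in> {E a b c s t w | a b c s t w. coords_in K a b c}"
    unfolding g(1,3) E_mult using coords_in_add[OF assms g(2,4)] by blast
qed auto

text \<open>If \<open>K\<close> had trivial image in V, the other members would generate G modulo
  its derived subgroup, hence G itself by \<open>subgroup_eq_carrier\<close>, against
  minimality.\<close>

lemma component_not_central:
  assumes dec: "central_decomp G \<K>" and "K \<in> \<K>"
  obtains a b c where "coords_in K a b c" "\<not> (veq q r a 0 \<and> veq q r b 0 \<and> veq q r c 0)"
proof (rule ccontr)
  assume not: "\<not> thesis"
  note concl = that
  then have central: "veq q r a 0 \<and> veq q r b 0 \<and> veq q r c 0" if "coords_in K a b c" for a b c
    using that concl not by blast
  let ?Q = "generate G (\<Union>(\<K> - {K}))"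
  let ?S = "{E a b c s t w | a b c s t w. coords_in ?Q a b c}"
  have sub: "\<And>L. L \<in> \<K> \<Longrightarrow> L \<subseteq> carrier G"
    using dec subgroup.subset by (auto simp: central_decomp_def)
  then have Q: "subgroup ?Q G" by (intro generate_is_subgroup) auto
  then have "coords_in ?Q 0 0 0"
    using subgroup.one_closed E_one unfolding coords_in_def by metis
  have "carrier G = generate G (\<Union>\<K>)" using dec by (simp add: central_decomp_def)
  also have "\<dots> \<subseteq> ?S"
  proof (rule generate_subgroup_incl[OF _ subgroup_coords_in[OF Q]], rule Union_least, rule subsetI)
    fix L g assume L: "L \<in> \<K>" "g \<in> L"
    then obtain a b c s t w where g: "g = E a b c s t w" using sub E_surj by blast
    have "coords_in ?Q a b c"
    proof (cases "L = K")
      case True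
      then have "coords_in K a b c" using L g by (auto simp: coords_in_def)
      then have "veq q r 0 a \<and> veq q r 0 b \<and> veq q r 0 c" using central veq_sym by blast
      then show ?thesis using coords_in_cong \<open>coords_in ?Q 0 0 0\<close> by blast
    next
      case False
      then have "g \<in> ?Q" using L by (intro generate.incl) blast
      then show ?thesis using g by (auto simp: coords_in_def)
    qed
    then show "g \<in> ?S" using g by blast
  qed
  finally have carr: "carrier G \<subseteq> ?S" .
  have "coords_in ?Q a b c" for a b c
  proof -
    have "E a b c 0 0 0 \<in> ?S" using carr E_closed by blast
    then obtain a' b' c' s' t' w' where "E a b c 0 0 0 = E a' b' c' s' t' w'" "coords_in ?Q a' b' c'"
      by blast
    then show ?thesis using coords_in_cong veq_sym unfolding E_eq_iff by blast
  qed
  then have "?Q = carrier G" using subgroup_eq_carrier[OF Q] by blast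
  moreover have "\<K> - {K} \<subset> \<K>" using \<open>K \<in> \<K>\<close> by blast
  ultimately show False using dec by (auto simp: central_decomp_def)
qed

text \<open>\<open>K\<close> is the full preimage of V_0 \<otimes> U. The sixth clause says W = U +
  U^perp, so that U is nondegenerate; the last one provides a vector of U that can be split
  off.\<close>

lemma component_structure:
  assumes dec: "central_decomp G \<K>" and "K \<in> \<K>"
  obtains U where "\<And>a b c s t w. E a b c s t w \<in> K \<longleftrightarrow> a \<in> U \<and> b \<in> U \<and> c \<in> U"
    "\<And>u v. u \<in> U \<Longrightarrow> v \<in> U \<Longrightarrow> u + v \<in> U" "\<And>k u. u \<in> U \<Longrightarrow> scl k u \<in> U"
    "\<And>u v. u \<in> U \<Longrightarrow> veq q r u v \<Longrightarrow> v \<in> U" "0 \<in> U"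
    "\<And>v. \<exists>u\<in>U. \<forall>u'\<in>U. [dot r (v - u) u' = 0] (mod q)"
    "\<exists>u\<in>U. \<not> [dot r u u = 0] (mod q)"
proof -
  have K: "subgroup K G" using assms by (auto simp: central_decomp_def)
  have K': "K \<subseteq> carrier G" using K subgroup.subset by blast
  have C: "subgroup (centralizer G K) G" using subgroup_centralizer[OF K'] .
  have split: "\<exists>k\<in>K. \<exists>h\<in>centralizer G K. g = k \<otimes> h" if "g \<in> carrier G" for g
    using central_decomp_split[OF assms that] by metis
  obtain f where f: "\<And>u. coords_in K (f u) 0 0" "\<And>u. coords_in K 0 (f u) 0" "\<And>u. coords_in K 0 0 (f u)"
    "\<And>u. coords_in (centralizer G K) (u - f u) 0 0" "\<And>u. coords_in (centralizer G K) 0 (u - f u) 0"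
    "\<And>u. coords_in (centralizer G K) 0 0 (u - f u)"
    by (rule selfadjoint_projection[OF K split]) (assumption | rule that)+
  note orth = centralizer_wedge[of K]
  \<comment> \<open>A vector in the images of both \<open>K\<close> and its centralizer is
    orthogonal to both images, hence to all of V, because every element is a product k h.\<close>
  have radical: "veq q r a 0 \<and> veq q r b 0 \<and> veq q r c 0"
    if KC: "coords_in K a b c" "coords_in (centralizer G K) a b c" for a b c
  proof -
    have "E a b c 0 0 0 \<otimes> g = g \<otimes> E a b c 0 0 0" if "g \<in> carrier G" for g
    proof -
      obtain k h where kh: "k \<in> K" "h \<in> centralizer G K" "g = k \<otimes> h" using split \<open>g \<in> carrier G\<close> by blast
      then have [simp]: "k \<in> carrier G" "h \<in> carrier G" using K' by (auto simp: centralizer_def)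
      have "E a b c 0 0 0 \<otimes> k = k \<otimes> E a b c 0 0 0"
      proof -
        obtain a' b' c' s' t' w' where k: "k = E a' b' c' s' t' w'" using E_surj[of k] by auto
        then have "coords_in K a' b' c'" using kh(1) by (auto simp: coords_in_def)
        from orth[OF this KC(2)] have "k \<otimes> E a b c 0 0 0 = E a b c 0 0 0 \<otimes> k"
          unfolding k E_commute_iff .
        then show ?thesis by (rule sym)
      qed
      moreover have "E a b c 0 0 0 \<otimes> h = h \<otimes> E a b c 0 0 0"
      proof -
        obtain a' b' c' s' t' w' where h: "h = E a' b' c' s' t' w'" using E_surj[of h] by auto
        then have "coords_in (centralizer G K) a' b' c'" using kh(2) by (auto simp: coords_in_def)
        from orth[OF KC(1) this] show ?thesis unfolding h E_commute_iff .
      qed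
      ultimately show ?thesis unfolding kh(3)
        by (metis E_closed \<open>h \<in> carrier G\<close> \<open>k \<in> carrier G\<close> m_assoc)
    qed
    from E_central[OF this] show ?thesis by blast
  qed
  define U where "U = {u. coords_in K u 0 0}"
  \<comment> \<open>The difference v - f v lies in both images, so it vanishes modulo q. As
    \<open>f\<close> serves all three coordinates alike, this makes the three conditions on v
    equivalent.\<close>
  have fU: "veq q r v (f v) \<and> f v \<in> U" if "coords_in K v 0 0 \<or> coords_in K 0 v 0 \<or> coords_in K 0 0 v" for v
  proof -
    have "veq q r (v - f v) 0"
      using that radical[OF _ f(4)[of v]] radical[OF _ f(5)[of v]] radical[OF _ f(6)[of v]]
        coords_in_diff[OF K _ f(1)[of v], of v 0 0] coords_in_diff[OF K _ f(2)[of v], of 0 v 0]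
        coords_in_diff[OF K _ f(3)[of v], of 0 0 v] by auto
    then have "veq q r v (f v)" by (simp add: veq_diff_0_iff)
    then show ?thesis using f(1) by (simp add: U_def)
  qed
  have U: "coords_in K u 0 0" "coords_in K 0 u 0" "coords_in K 0 0 u" if "u \<in> U" for u
  proof -
    have "veq q r (f u) u" using fU[of u] that veq_sym by (auto simp: U_def)
    then show "coords_in K u 0 0" "coords_in K 0 u 0" "coords_in K 0 0 u"
      using coords_in_cong[OF _ _ _ f(1)] coords_in_cong[OF _ _ _ f(2)] coords_in_cong[OF _ _ _ f(3)]
      by auto
  qed
  have coords: "coords_in K a b c \<longleftrightarrow> a \<in> U \<and> b \<in> U \<and> c \<in> U" for a b c
  proof
    assume "a \<in> U \<and> b \<in> U \<and> c \<in> U"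
    then show "coords_in K a b c"
      using coords_in_add[OF K coords_in_add[OF K U(1)[of a] U(2)[of b]] U(3)[of c]] by simp
  next
    assume abc: "coords_in K a b c"
    have "coords_in K (f a) (f b) (f c)"
      using coords_in_add[OF K coords_in_add[OF K f(1)[of a] f(2)[of b]] f(3)[of c]] by simp
    then have "coords_in K (a - f a) (b - f b) (c - f c)" by (rule coords_in_diff[OF K abc])
    moreover have "coords_in (centralizer G K) (a - f a) (b - f b) (c - f c)"
      using coords_in_add[OF C coords_in_add[OF C f(4)[of a] f(5)[of b]] f(6)[of c]] by simp
    ultimately have "veq q r a (f a) \<and> veq q r b (f b) \<and> veq q r c (f c)"
      using radical[of "a - f a" "b - f b" "c - f c"] by (simp add: veq_diff_0_iff)
    then have "veq q r (f a) a" "veq q r (f b) b" "veq q r (f c) c" using veq_sym by blast+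
    then show "a \<in> U \<and> b \<in> U \<and> c \<in> U"
      unfolding U_def mem_Collect_eq using coords_in_cong[OF _ _ _ f(1)] by auto
  qed
  have cong: "v \<in> U" if "u \<in> U" "veq q r u v" for u v
    using that coords_in_cong[of u v 0 0 0 0 K] unfolding U_def by simp
  have add: "u + v \<in> U" if "u \<in> U" "v \<in> U" for u v
    using coords_in_add[OF K, of u 0 0 v 0 0] that unfolding U_def by simp
  have scl: "scl k u \<in> U" if "u \<in> U" for k u
    using coords_in_scl[OF K, of u 0 0 k] that unfolding U_def by (simp add: scl_simps)
  have proj: "\<exists>u\<in>U. \<forall>u'\<in>U. [dot r (v - u) u' = 0] (mod q)" for v
  proof (intro bexI[of _ "f v"] ballI)
    fix u' assume "u' \<in> U"
    from orth[OF U(2)[OF this] f(4)[of v]]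
    have "[dot r u' (v - f v) = 0] (mod q)" by (simp add: wedge_def cong_0_iff dvd_diff_commute)
    then show "[dot r (v - f v) u' = 0] (mod q)" by (simp only: dot_commute)
  qed (use f(1) in \<open>simp add: U_def\<close>)
  \<comment> \<open>Polarization: if all norms on U vanish, so do all dot products, as 2 is a unit.
    With W = U + U^perp this puts U into the radical of \<open>dot\<close>, so U = 0 and
    \<open>K\<close> would have trivial image in V.\<close>
  have anis: "\<exists>u\<in>U. \<not> [dot r u u = 0] (mod q)"
  proof (rule ccontr)
    assume "\<not> ?thesis"
    then have iso: "[dot r u u = 0] (mod q)" if "u \<in> U" for u using that by blast
    have orthU: "[dot r u v = 0] (mod q)" if "u \<in> U" "v \<in> U" for u v
    proof -
      have "[dot r (u + v) (u + v) - dot r u u - dot r v v = 0 - 0 - 0] (mod q)"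
        by (intro cong_diff iso add that)
      moreover have "dot r (u + v) (u + v) - dot r u u - dot r v v = 2 * dot r u v"
        by (simp add: dot_commute)
      ultimately have "[2 * dot r u v = 0] (mod q)" by simp
      then show ?thesis by (simp only: cong_0_double)
    qed
    have "veq q r u 0" if "u \<in> U" for u
      unfolding veq_0_iff_dot
    proof
      fix v
      from proj[of v] obtain u' where u': "u' \<in> U" "\<forall>u''\<in>U. [dot r (v - u') u'' = 0] (mod q)" ..
      have "[dot r (v - u') u + dot r u' u = 0 + 0] (mod q)"
        by (rule cong_add[OF bspec[OF u'(2) that] orthU[OF u'(1) that]])
      then show "[dot r u v = 0] (mod q)" by (simp add: dot_commute)
    qed
    moreover obtain a b c where "coords_in K a b c" "\<not> (veq q r a 0 \<and> veq q r b 0 \<and> veq q r c 0)"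
      by (rule component_not_central[OF assms])
    ultimately show False using coords by blast
  qed
  then obtain u where u: "u \<in> U" "\<not> [dot r u u = 0] (mod q)" by blast
  have mem: "E a b c s t w \<in> K \<longleftrightarrow> a \<in> U \<and> b \<in> U \<and> c \<in> U" for a b c s t w
    using mem_if_center_subset[OF K center_subset[OF K U[OF u(1)] u(2)]] coords by blast
  have "0 \<in> U" using scl[OF u(1), of 0] by (simp add: scl_simps)
  from that[OF mem add scl cong this proj anis] show ?thesis .
qed

end

section \<open>Frames\<close>

lemma cong_mult_cancel:
  fixes q :: int assumes "Factorial_Ring.prime q" "\<not> [d = 0] (mod q)"
  shows "[d * s = d * s'] (mod q) \<longleftrightarrow> [s = s'] (mod q)" "[s * d = s' * d] (mod q) \<longleftrightarrow> [s = s'] (mod q)"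
proof -
  have "[d * s = d * s'] (mod q) \<longleftrightarrow> [d * (s - s') = 0] (mod q)"
    by (simp add: cong_diff_iff_cong_0 right_diff_distrib)
  also have "\<dots> \<longleftrightarrow> [s = s'] (mod q)"
    using assms by (simp add: cong_0_mult_iff cong_diff_iff_cong_0)
  finally show "[d * s = d * s'] (mod q) \<longleftrightarrow> [s = s'] (mod q)" .
  then show "[s * d = s' * d] (mod q) \<longleftrightarrow> [s = s'] (mod q)" by (simp add: mult.commute)
qed

lemma veq_scl_iff:
  assumes "Factorial_Ring.prime q" "\<not> [dot r u u = 0] (mod q)"
  shows "veq q r (scl k u) (scl l u) \<longleftrightarrow> [k = l] (mod q)"
proof
  assume "veq q r (scl k u) (scl l u)"
  from dot_cong[OF this veq_refl[of q r u]] have "[k * dot r u u = l * dot r u u] (mod q)" by simp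
  then show "[k = l] (mod q)" using cong_mult_cancel(2)[OF assms] by simp
qed (rule veq_scl_cong)

definition lincomb :: "'i set \<Rightarrow> ('i \<Rightarrow> int) \<Rightarrow> ('i \<Rightarrow> nat \<Rightarrow> int) \<Rightarrow> nat \<Rightarrow> int" where
  "lincomb I k u = (\<lambda>j. \<Sum>i\<in>I. k i * u i j)"

lemma dot_lincomb: "dot r (lincomb I k u) v = (\<Sum>i\<in>I. k i * dot r (u i) v)"
  unfolding dot_def lincomb_def sum_distrib_right sum_distrib_left
  by (subst sum.swap) (simp add: ac_simps)

lemma lincomb_add: "lincomb I k u + lincomb I l u = lincomb I (\<lambda>i. k i + l i) u"
  by (simp add: lincomb_def fun_eq_iff distrib_right sum.distrib)

lemma lincomb_uminus: "- lincomb I k u = lincomb I (\<lambda>i. - k i) u"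
  by (simp add: lincomb_def fun_eq_iff sum_negf)

lemma lincomb_insert: "finite I \<Longrightarrow> i \<notin> I \<Longrightarrow> lincomb (insert i I) k u = scl (k i) (u i) + lincomb I k u"
  by (simp add: lincomb_def fun_eq_iff scl_apply)

lemma lincomb_empty: "lincomb {} k u = 0"
  by (simp add: lincomb_def fun_eq_iff)

lemma lincomb_single: "finite I \<Longrightarrow> i \<in> I \<Longrightarrow> lincomb I (\<lambda>j. if j = i then k else 0) u = scl k (u i)"
  by (simp add: lincomb_def fun_eq_iff scl_apply if_distrib if_distribR sum.delta cong: if_cong)

definition orth_family :: "int \<Rightarrow> nat \<Rightarrow> 'i set \<Rightarrow> ('i \<Rightarrow> nat \<Rightarrow> int) \<Rightarrow> bool" where
  "orth_family q r I u \<longleftrightarrow> (\<forall>i\<in>I. \<forall>j\<in>I. i \<noteq> j \<longrightarrow> [dot r (u i) (u j) = 0] (mod q)) \<and>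
     (\<forall>i\<in>I. \<not> [dot r (u i) (u i) = 0] (mod q))"

lemma dot_lincomb_orth:
  assumes "orth_family q r I u" "finite I" "i \<in> I"
  shows "[dot r (lincomb I k u) (u i) = k i * dot r (u i) (u i)] (mod q)"
proof -
  have "[(\<Sum>j\<in>I. k j * dot r (u j) (u i)) = (\<Sum>j\<in>I. if j = i then k i * dot r (u i) (u i) else 0)] (mod q)"
    using assms unfolding orth_family_def by (intro cong_sum) (auto simp: cong_0_iff)
  then show ?thesis using assms by (simp add: dot_lincomb)
qed

text \<open>Dot products with the members recover the coefficients, so coefficient tuples inject
  into vectors. All three claims come from comparing q^|I| with q^r: a bound, surjectivity at equal
  size, and equal size from surjectivity.\<close>

lemma orth_family_counting:
  fixes u :: "'i \<Rightarrow> nat \<Rightarrow> int"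
  assumes q: "Factorial_Ring.prime q" and fin: "finite I" and orth: "orth_family q r I u"
  shows "card I \<le> r" "card I = r \<Longrightarrow> \<exists>k. veq q r v (lincomb I k u)"
    "(\<And>v. \<exists>k. veq q r v (lincomb I k u)) \<Longrightarrow> card I = r"
proof -
  have q1: "q > 1" using q prime_gt_1_int by blast
  define A where "A = (I \<rightarrow>\<^sub>E {0..<q})"
  define B where "B = ({1..r} \<rightarrow>\<^sub>E {0..<q})"
  define \<phi> where "\<phi> k = (\<lambda>j\<in>{1..r}. lincomb I k u j mod q)" for k
  have card: "card A = nat q ^ card I" "card B = nat q ^ r"
    using fin q1 by (simp_all add: A_def B_def card_PiE)
  have fin': "finite A" "finite B"
    using fin by (auto simp: A_def B_def intro!: finite_PiE)
  have \<phi>B: "\<phi> k \<in> B" for k using q1 by (auto simp: \<phi>_def B_def)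
  have inj: "inj_on \<phi> A"
  proof (rule inj_onI)
    fix k l assume kl: "k \<in> A" "l \<in> A" "\<phi> k = \<phi> l"
    have "lincomb I k u j mod q = lincomb I l u j mod q" if "j \<in> {1..r}" for j
      using fun_cong[OF kl(3), of j] that by (simp add: \<phi>_def)
    then have *: "veq q r (lincomb I k u) (lincomb I l u)" by (simp add: veq_def cong_def)
    have "k i = l i" if "i \<in> I" for i
    proof -
      have "[k i * dot r (u i) (u i) = l i * dot r (u i) (u i)] (mod q)"
        using dot_cong[OF * veq_refl[of q r "u i"]] dot_lincomb_orth[OF orth fin that]
        by (meson cong_sym cong_trans)
      then have "[k i = l i] (mod q)"
        using orth that by (subst (asm) cong_mult_cancel[OF q]) (auto simp: orth_family_def)
      moreover have "k i \<in> {0..<q}" "l i \<in> {0..<q}" using kl that by (auto simp: A_def)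
      ultimately show ?thesis by (simp add: cong_def)
    qed
    then show "k = l" using kl(1,2) unfolding A_def by (intro PiE_ext)
  qed
  have sub: "\<phi> ` A \<subseteq> B" using \<phi>B by blast
  have "card A \<le> card B" using card_mono[OF fin'(2) sub] by (simp add: card_image inj)
  then show "card I \<le> r" using q1 by (simp add: card)
  show "\<exists>k. veq q r v (lincomb I k u)" if "card I = r"
  proof -
    have "\<phi> ` A = B" using that by (intro card_subset_eq[OF fin'(2) sub]) (simp add: card_image inj card)
    moreover have "(\<lambda>j\<in>{1..r}. v j mod q) \<in> B" using q1 by (auto simp: B_def)
    ultimately obtain k where k: "(\<lambda>j\<in>{1..r}. v j mod q) = \<phi> k" by auto
    have "v j mod q = lincomb I k u j mod q" if "j \<in> {1..r}" for j
      using fun_cong[OF k, of j] that by (simp add: \<phi>_def)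
    then show ?thesis by (auto simp: veq_def cong_def)
  qed
  show "card I = r" if span: "\<And>v. \<exists>k. veq q r v (lincomb I k u)"
  proof -
    have "B \<subseteq> \<phi> ` A"
    proof
      fix f assume f: "f \<in> B"
      obtain k where k: "veq q r f (lincomb I k u)" using span by blast
      \<comment> \<open>The coefficients are reduced because elements of \<open>A\<close> take
        values in 0..<q and are extensional.\<close>
      let ?k = "\<lambda>i\<in>I. k i mod q"
      have "?k \<in> A" using q1 by (auto simp: A_def)
      moreover have "f = \<phi> ?k"
      proof (rule extensionalityI[of _ "{1..r}"])
        fix j assume j: "j \<in> {1..r}"
        have "[lincomb I k u j = lincomb I ?k u j] (mod q)"
          unfolding lincomb_def by (intro cong_sum cong_mult) auto
        moreover have "[f j = lincomb I k u j] (mod q)" using k j by (auto simp: veq_def)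
        ultimately have "f j mod q = lincomb I ?k u j mod q" by (metis cong_def)
        moreover have "f j mod q = f j" using f j by (auto simp: B_def PiE_iff)
        ultimately show "f j = \<phi> ?k j" using j by (simp add: \<phi>_def)
      qed (use f in \<open>auto simp: B_def \<phi>_def PiE_iff\<close>)
      ultimately show "f \<in> \<phi> ` A" by blast
    qed
    then have "card B \<le> card A" using surj_card_le[OF fin'(1)] by blast
    then have "r \<le> card I" using q1 by (simp add: card)
    with \<open>card I \<le> r\<close> show ?thesis by simp
  qed
qed

section \<open>Lines and groups of rank one\<close>

context heisenberg_coords
begin

text \<open>The full preimage of V_0 \<otimes> <u>, with all central coordinates.\<close>

definition line :: "(nat \<Rightarrow> int) \<Rightarrow> 'a set" where
  "line u = {E (scl i u) (scl j u) (scl k u) s t w | i j k s t w. True}"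

lemma line_in_carrier: "line u \<subseteq> carrier G"
  by (auto simp: line_def)

lemma E_in_line: "E (scl i u) (scl j u) (scl k u) s t w \<in> line u"
  unfolding line_def by blast

lemma E_in_line_iff: "E a b c s t w \<in> line u \<longleftrightarrow>
    (\<exists>i. veq q r a (scl i u)) \<and> (\<exists>i. veq q r b (scl i u)) \<and> (\<exists>i. veq q r c (scl i u))"
proof
  assume "E a b c s t w \<in> line u"
  then show "(\<exists>i. veq q r a (scl i u)) \<and> (\<exists>i. veq q r b (scl i u)) \<and> (\<exists>i. veq q r c (scl i u))"
    unfolding line_def mem_Collect_eq E_eq_iff by blast
next
  assume "(\<exists>i. veq q r a (scl i u)) \<and> (\<exists>i. veq q r b (scl i u)) \<and> (\<exists>i. veq q r c (scl i u))"
  then obtain i j k where "E a b c s t w = E (scl i u) (scl j u) (scl k u) s t w"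
    unfolding E_eq_iff by auto
  then show "E a b c s t w \<in> line u" using E_in_line by metis
qed

lemma subgroup_line: "subgroup (line u) G"
proof (rule subgroupI)
  show "line u \<noteq> {}" using E_in_line by blast
next
  fix g assume "g \<in> line u"
  then obtain i j k s t w where "g = E (scl i u) (scl j u) (scl k u) s t w" by (auto simp: line_def)
  then have "inv g = E (scl (-i) u) (scl (-j) u) (scl (-k) u) (-s) (-t) (-w)"
    by (simp add: E_inv scl_simps)
  then show "inv g \<in> line u" using E_in_line by metis
next
  fix g h assume "g \<in> line u" "h \<in> line u"
  then obtain i j k s t w i' j' k' s' t' w' where
    "g = E (scl i u) (scl j u) (scl k u) s t w" "h = E (scl i' u) (scl j' u) (scl k' u) s' t' w'"
    by (auto simp: line_def)
  then show "g \<otimes> h \<in> line u" using E_in_line by (simp add: E_mult scl_simps(4)[symmetric])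
qed (rule line_in_carrier)

text \<open>On V_0 \<otimes> <u> the twist is the standard one times the norm of \<open>u\<close>.
  Rescaling the central coordinates by that norm absorbs the factor, so all anisotropic lines look
  alike, whatever their square class.\<close>

lemma line_coords:
  assumes "\<not> [dot r u u = 0] (mod q)"
  shows "heisenberg_coords (G\<lparr>carrier := line u\<rparr>) q 1
    (\<lambda>a b c s t w. E (scl (a 1) u) (scl (b 1) u) (scl (c 1) u)
      (dot r u u * s) (dot r u u * t) (dot r u u * w))"
proof -
  let ?d = "dot r u u"
  interpret L: group "G\<lparr>carrier := line u\<rparr>" by (rule subgroup_imp_group[OF subgroup_line])
  have wedge: "wedge r (scl i u) (scl j u) (scl i' u) (scl j' u) = ?d * (i * j' - j * i')" for i j i' j'
    by (simp add: wedge_def algebra_simps)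
  have wedge1: "wedge 1 a b a' b' = a 1 * b' 1 - b 1 * a' 1" for a b a' b'
    by (simp add: wedge_def dot_def)
  have veq1: "veq q 1 a a' \<longleftrightarrow> [a 1 = a' 1] (mod q)" for a a' by (simp add: veq_def)
  show ?thesis
  proof unfold_locales
    fix g assume "g \<in> carrier (G\<lparr>carrier := line u\<rparr>)"
    then obtain i j k s t w where g: "g = E (scl i u) (scl j u) (scl k u) s t w" by (auto simp: line_def)
    obtain e where e: "[?d * e = 1] (mod q)" using cong_inverse[OF prime_q assms] by blast
    have "[?d * (e * s) = s] (mod q)" for s
      using cong_mult[OF e cong_refl[of s q]] by (simp add: ac_simps)
    then have "g = E (scl i u) (scl j u) (scl k u) (?d * (e * s)) (?d * (e * t)) (?d * (e * w))"
      unfolding g E_eq_iff using cong_sym by auto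
    then show "\<exists>a b c s t w. g = E (scl (a 1) u) (scl (b 1) u) (scl (c 1) u) (?d * s) (?d * t) (?d * w)"
      by (intro exI[of _ "\<lambda>_. i"] exI[of _ "\<lambda>_. j"] exI[of _ "\<lambda>_. k"] exI)
  qed (simp_all add: prime_q odd_q E_in_line E_eq_iff veq1[simplified] veq_scl_iff[OF prime_q assms] cong_mult_cancel[OF prime_q assms]
      E_mult wedge wedge1[simplified] scl_simps distrib_left)
qed

text \<open>In rank 1 a subspace with an anisotropic vector is everything, so a line cannot be
  refined. The empty decomposition is excluded because the group is nontrivial.\<close>

lemma central_decomp_rank_1:
  assumes "r = 1" "central_decomp G \<K>"
  shows "\<K> = {carrier G}"
proof -
  have "K = carrier G" if K: "K \<in> \<K>" for K
  proof -
    obtain U where U: "\<And>a b c s t w. E a b c s t w \<in> K \<longleftrightarrow> a \<in> U \<and> b \<in> U \<and> c \<in> U"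
      "\<And>u v. u \<in> U \<Longrightarrow> v \<in> U \<Longrightarrow> u + v \<in> U" "\<And>k u. u \<in> U \<Longrightarrow> scl k u \<in> U"
      "\<And>u v. u \<in> U \<Longrightarrow> veq q r u v \<Longrightarrow> v \<in> U" "0 \<in> U"
      "\<And>v. \<exists>u\<in>U. \<forall>u'\<in>U. [dot r (v - u) u' = 0] (mod q)"
      "\<exists>u\<in>U. \<not> [dot r u u = 0] (mod q)"
      by (rule component_structure[OF assms(2) K]) (assumption | rule that)+
    from U(7) obtain u where u: "u \<in> U" "\<not> [u 1 = 0] (mod q)"
      using \<open>r = 1\<close> by (auto simp: dot_def cong_0_mult_iff[OF prime_q])
    obtain e where e: "[e * u 1 = 1] (mod q)" using cong_inverse[OF prime_q u(2)] by blast
    have UNIV: "v \<in> U" for v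
    proof (rule U(4)[OF U(3)[OF u(1)]])
      have "[v 1 * (e * u 1) = v 1 * 1] (mod q)" by (intro cong_mult e) auto
      then show "veq q r (scl (v 1 * e) u) v" using \<open>r = 1\<close> by (simp add: veq_def scl_apply ac_simps)
    qed
    have "carrier G \<subseteq> K"
    proof
      fix g assume "g \<in> carrier G"
      then obtain a b c s t w where "g = E a b c s t w" using E_surj by blast
      then show "g \<in> K" using U(1) UNIV by simp
    qed
    moreover have "K \<subseteq> carrier G"
      using assms(2) K by (simp add: central_decomp_def subgroup.subset)
    ultimately show ?thesis by blast
  qed
  moreover have "\<K> \<noteq> {}"
  proof
    assume "\<K> = {}"
    then have "carrier G = {\<one>}" using assms(2) by (simp add: central_decomp_def generate_empty)
    then have "E 0 0 0 0 0 1 = E 0 0 0 0 0 0"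
      using E_closed[of 0 0 0 0 0 1] E_closed[of 0 0 0 0 0 0] by simp
    then show False using not_cong_1_0 by (simp add: E_eq_iff)
  qed
  ultimately show ?thesis by blast
qed

end

abbreviation orth_frame :: "int \<Rightarrow> nat \<Rightarrow> (nat \<Rightarrow> nat \<Rightarrow> int) \<Rightarrow> bool" where
  "orth_frame q r u \<equiv> orth_family q r {1..r} u"

lemma orth_frame_spanning:
  "Factorial_Ring.prime q \<Longrightarrow> orth_frame q r u \<Longrightarrow> \<exists>k. veq q r v (lincomb {1..r} k u)"
  by (rule orth_family_counting(2)) auto

section \<open>Fully refined decompositions and orthogonal frames\<close>

context heisenberg_coords
begin

definition frame_dec :: "(nat \<Rightarrow> nat \<Rightarrow> int) \<Rightarrow> 'a set set" where
  "frame_dec u = (\<lambda>i. line (u i)) ` {1..r}"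

lemma subgroup_of_subspace:
  assumes add: "\<And>u v. u \<in> U \<Longrightarrow> v \<in> U \<Longrightarrow> u + v \<in> U" and neg: "\<And>u. u \<in> U \<Longrightarrow> - u \<in> U" and "0 \<in> U"
  shows "subgroup {E a b c s t w | a b c s t w. a \<in> U \<and> b \<in> U \<and> c \<in> U} G" (is "subgroup ?S G")
proof (rule subgroupI)
  show "?S \<noteq> {}" using \<open>0 \<in> U\<close> by blast
next
  fix g assume "g \<in> ?S"
  then obtain a b c s t w where g: "g = E a b c s t w" "a \<in> U" "b \<in> U" "c \<in> U" by blast
  show "inv g \<in> ?S" unfolding g(1) E_inv using neg[OF g(2)] neg[OF g(3)] neg[OF g(4)] by blast
next
  fix g h assume "g \<in> ?S" "h \<in> ?S"
  then obtain a b c s t w a' b' c' s' t' w' where g: "g = E a b c s t w" "a \<in> U" "b \<in> U" "c \<in> U"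
    "h = E a' b' c' s' t' w'" "a' \<in> U" "b' \<in> U" "c' \<in> U" by blast
  then show "g \<otimes> h \<in> ?S" unfolding g(1,5) E_mult
    using add[OF g(2,6)] add[OF g(3,7)] add[OF g(4,8)] by blast
qed auto

lemma lines_commute:
  assumes orth: "[dot r u v = 0] (mod q)" and g: "g \<in> line u" "h \<in> line v"
  shows "g \<otimes> h = h \<otimes> g"
proof -
  obtain i j k s t w where g': "g = E (scl i u) (scl j u) (scl k u) s t w" using g by (auto simp: line_def)
  obtain i' j' k' s' t' w' where h': "h = E (scl i' v) (scl j' v) (scl k' v) s' t' w'"
    using g by (auto simp: line_def)
  have "[wedge r (scl i u) (scl j u) (scl i' v) (scl j' v) = 0] (mod q)" for i j i' j'
    using orth by (auto simp: wedge_def cong_0_iff)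
  then show ?thesis unfolding g' h' E_commute_iff by blast
qed

lemma orth_of_commute:
  assumes "\<And>g h. g \<in> line u \<Longrightarrow> h \<in> line v \<Longrightarrow> g \<otimes> h = h \<otimes> g"
  shows "[dot r u v = 0] (mod q)"
proof -
  have "E u 0 0 0 0 0 \<otimes> E 0 v 0 0 0 0 = E 0 v 0 0 0 0 \<otimes> E u 0 0 0 0 0"
    using assms[OF E_in_line[of 1 u 0 0 0 0 0] E_in_line[of 0 v 1 0 0 0 0]] by (simp add: scl_simps)
  then show ?thesis unfolding E_commute_iff by (simp add: wedge_def)
qed

lemma coords_in_lincomb:
  assumes Q: "subgroup Q G" and "finite I"
    and "\<And>i k. i \<in> I \<Longrightarrow> coords_in Q (scl k (u i)) 0 0"
    and "\<And>i k. i \<in> I \<Longrightarrow> coords_in Q 0 (scl k (u i)) 0"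
    and "\<And>i k. i \<in> I \<Longrightarrow> coords_in Q 0 0 (scl k (u i))"
  shows "coords_in Q (lincomb I k u) (lincomb I k' u) (lincomb I k'' u)"
  using assms(2-)
proof (induction I rule: finite_induct)
  case empty
  have "E 0 0 0 0 0 0 \<in> Q" using subgroup.one_closed[OF Q] E_one by simp
  then show ?case unfolding lincomb_empty coords_in_def by blast
next
  case (insert i F)
  have IH: "coords_in Q (lincomb F k u) (lincomb F k' u) (lincomb F k'' u)"
    using insert by blast
  have "coords_in Q (scl (k i) (u i)) (scl (k' i) (u i)) (scl (k'' i) (u i))"
    using coords_in_add[OF Q coords_in_add[OF Q insert.prems(1)[of i "k i"] insert.prems(2)[of i "k' i"]]
        insert.prems(3)[of i "k'' i"]] by (simp only: insertI1 simp_thms add_0_left add_0_right)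
  from coords_in_add[OF Q this IH] show ?case
    by (simp only: lincomb_insert[OF insert.hyps(1,2)])
qed

lemma generate_lines:
  assumes "finite I" "\<And>v. \<exists>k. veq q r v (lincomb I k u)"
  shows "generate G (\<Union>i\<in>I. line (u i)) = carrier G"
proof (rule subgroup_eq_carrier)
  let ?Q = "generate G (\<Union>i\<in>I. line (u i))"
  show Q: "subgroup ?Q G" using line_in_carrier by (intro generate_is_subgroup) blast
  fix a b c
  obtain k k' k'' where k: "veq q r (lincomb I k u) a" "veq q r (lincomb I k' u) b" "veq q r (lincomb I k'' u) c"
    using assms(2) veq_sym by metis
  have line: "coords_in ?Q (scl i1 (u i)) (scl i2 (u i)) (scl i3 (u i))" if "i \<in> I" for i i1 i2 i3
  proof -
    have "E (scl i1 (u i)) (scl i2 (u i)) (scl i3 (u i)) 0 0 0 \<in> ?Q"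
      by (intro generate.incl UN_I[OF that] E_in_line)
    then show ?thesis unfolding coords_in_def by blast
  qed
  have "coords_in ?Q (lincomb I k u) (lincomb I k' u) (lincomb I k'' u)"
  proof (rule coords_in_lincomb[OF Q assms(1)])
    fix i l assume i: "i \<in> I"
    show "coords_in ?Q (scl l (u i)) 0 0" using line[OF i, of l 0 0] by (simp add: scl_simps)
    show "coords_in ?Q 0 (scl l (u i)) 0" using line[OF i, of 0 l 0] by (simp add: scl_simps)
    show "coords_in ?Q 0 0 (scl l (u i))" using line[OF i, of 0 0 l] by (simp add: scl_simps)
  qed
  then show "coords_in ?Q a b c" using coords_in_cong[OF k] by blast
qed

lemma central_decomp_frame:
  assumes fr: "orth_frame q r u"
  shows "central_decomp G (frame_dec u)"
  unfolding central_decomp_def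
proof (intro conjI ballI allI impI)
  show "subgroup K G" if "K \<in> frame_dec u" for K using that subgroup_line by (auto simp: frame_dec_def)
next
  fix K L g h assume KL: "K \<in> frame_dec u" "L \<in> frame_dec u" "K \<noteq> L" and gh: "g \<in> K" "h \<in> L"
  then obtain i j where ij: "i \<in> {1..r}" "j \<in> {1..r}" "K = line (u i)" "L = line (u j)" "i \<noteq> j"
    unfolding frame_dec_def by blast
  then have "[dot r (u i) (u j) = 0] (mod q)" using fr by (auto simp: orth_family_def)
  then show "g \<otimes> h = h \<otimes> g" using lines_commute gh ij by blast
next
  show "generate G (\<Union>(frame_dec u)) = carrier G"
    using generate_lines[of "{1..r}" u] orth_frame_spanning[OF prime_q fr] by (simp add: frame_dec_def)
next
  fix J assume J: "J \<subset> frame_dec u"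
  \<comment> \<open>The line of some u_k is missing. The remaining members lie over the hyperplane
    orthogonal to u_k, which omits u_k because u_k is anisotropic.\<close>
  then obtain k where k: "k \<in> {1..r}" "line (u k) \<notin> J" unfolding frame_dec_def by blast
  define U where "U = {v. [dot r v (u k) = 0] (mod q)}"
  let ?S = "{E a b c s t w | a b c s t w. a \<in> U \<and> b \<in> U \<and> c \<in> U}"
  have S: "subgroup ?S G"
    by (rule subgroup_of_subspace) (auto simp: U_def cong_0_iff)
  have "\<Union>J \<subseteq> ?S"
  proof (rule Union_least, rule subsetI)
    fix L g assume L: "L \<in> J" "g \<in> L"
    then obtain i where i: "i \<in> {1..r}" "L = line (u i)" using J unfolding frame_dec_def by blast
    then have "i \<noteq> k" using k L by blast
    then have orth: "[dot r (u i) (u k) = 0] (mod q)" using fr i k by (auto simp: orth_family_def)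
    then have "scl l (u i) \<in> U" for l by (auto simp: U_def cong_0_iff)
    then show "g \<in> ?S" using L(2) unfolding i(2) line_def by blast
  qed
  then have sub: "generate G (\<Union>J) \<subseteq> ?S" by (rule generate_subgroup_incl[OF _ S])
  have "E (u k) 0 0 0 0 0 \<notin> ?S"
  proof
    assume "E (u k) 0 0 0 0 0 \<in> ?S"
    then obtain a where a: "veq q r (u k) a" "a \<in> U" using E_eq_iff by blast
    have "[dot r (u k) (u k) = dot r a (u k)] (mod q)" by (rule dot_cong[OF a(1) veq_refl])
    with a(2) have "[dot r (u k) (u k) = 0] (mod q)" unfolding U_def using cong_trans by blast
    then show False using fr k by (auto simp: orth_family_def)
  qed
  then show "generate G (\<Union>J) \<noteq> carrier G" using sub E_closed by blast
qed

lemma fully_refined_frame: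
  assumes "orth_frame q r u"
  shows "fully_refined G (frame_dec u)"
  unfolding fully_refined_def
proof (intro conjI ballI allI impI)
  fix K J assume K: "K \<in> frame_dec u" and J: "central_decomp (G\<lparr>carrier := K\<rparr>) J"
  obtain i where i: "i \<in> {1..r}" "K = line (u i)" using K by (auto simp: frame_dec_def)
  then have "\<not> [dot r (u i) (u i) = 0] (mod q)" using assms by (auto simp: orth_family_def)
  \<comment> \<open>Rank-one coordinates on the member reduce its indecomposability to
    \<open>central_decomp_rank_1\<close>.\<close>
  then interpret K: heisenberg_coords "G\<lparr>carrier := K\<rparr>" q 1 "\<lambda>a b c s t w.
      E (scl (a 1) (u i)) (scl (b 1) (u i)) (scl (c 1) (u i))
      (dot r (u i) (u i) * s) (dot r (u i) (u i) * t) (dot r (u i) (u i) * w)"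
    unfolding i(2) by (rule line_coords)
  show "J = {K}" using K.central_decomp_rank_1[OF _ J] by simp
qed (rule central_decomp_frame[OF assms])

text \<open>An anisotropic \<open>u\<close> in U splits \<open>K\<close> into the line of
  \<open>u\<close> and the part over the orthogonal complement of \<open>u\<close> in U. If that
  complement were nonzero, this would be a proper refinement.\<close>

lemma refined_component_line:
  assumes ref: "fully_refined G \<K>" and K: "K \<in> \<K>"
  obtains u where "\<not> [dot r u u = 0] (mod q)" "K = line u"
proof -
  have dec: "central_decomp G \<K>" using ref by (simp add: fully_refined_def)
  have sub: "subgroup K G" using dec K by (auto simp: central_decomp_def)
  have K_sub: "K \<subseteq> carrier G" using sub subgroup.subset by blast
  obtain U where U: "\<And>a b c s t w. E a b c s t w \<in> K \<longleftrightarrow> a \<in> U \<and> b \<in> U \<and> c \<in> U"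
    "\<And>u v. u \<in> U \<Longrightarrow> v \<in> U \<Longrightarrow> u + v \<in> U" "\<And>k u. u \<in> U \<Longrightarrow> scl k u \<in> U"
    "\<And>u v. u \<in> U \<Longrightarrow> veq q r u v \<Longrightarrow> v \<in> U" "0 \<in> U"
    "\<And>v. \<exists>u\<in>U. \<forall>u'\<in>U. [dot r (v - u) u' = 0] (mod q)"
    "\<exists>u\<in>U. \<not> [dot r u u = 0] (mod q)"
    by (rule component_structure[OF dec K]) (assumption | rule that)+
  from U(7) obtain u where u: "u \<in> U" "\<not> [dot r u u = 0] (mod q)" ..
  obtain e where e: "[e * dot r u u = 1] (mod q)" using cong_inverse[OF prime_q u(2)] by blast
  define W where "W = {v \<in> U. [dot r v u = 0] (mod q)}"
  have W: "subgroup {E a b c s t w | a b c s t w. a \<in> W \<and> b \<in> W \<and> c \<in> W} G" (is "subgroup ?B G")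
  proof (rule subgroup_of_subspace)
    show "a + b \<in> W" if "a \<in> W" "b \<in> W" for a b
      using that U(2) unfolding W_def by (auto simp: cong_0_iff)
    show "- a \<in> W" if "a \<in> W" for a
      using that U(3)[of a "-1"] unfolding W_def by (auto simp: cong_0_iff scl_simps)
    show "0 \<in> W" using U(5) by (simp add: W_def)
  qed
  \<comment> \<open>Orthogonal projection along \<open>u\<close>; the scalar \<open>e\<close>
    inverts the norm of \<open>u\<close>.\<close>
  have proj: "v - scl (dot r v u * e) u \<in> W" if "v \<in> U" for v
  proof -
    have "v - scl (dot r v u * e) u = v + scl (- (dot r v u * e)) u" by (simp add: scl_simps)
    then have 1: "v - scl (dot r v u * e) u \<in> U" using U(2)[OF that U(3)[OF u(1)]] by metis
    have "[dot r v u - dot r v u * (e * dot r u u) = dot r v u - dot r v u * 1] (mod q)"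
      by (intro cong_diff cong_mult e) auto
    then have "[dot r (v - scl (dot r v u * e) u) u = 0] (mod q)" by (simp add: mult.assoc)
    with 1 show ?thesis by (simp add: W_def)
  qed
  have line_sub: "line u \<subseteq> K" using U(1,3) u(1) by (auto simp: line_def)
  have B_sub: "?B \<subseteq> K" using U(1) by (auto simp: W_def)
  have W0: "veq q r v 0" if v: "v \<in> W" for v
  proof (rule ccontr)
    assume v0: "\<not> veq q r v 0"
    have vU: "v \<in> U" "[dot r v u = 0] (mod q)" using v by (auto simp: W_def)
    have line_ne: "line u \<noteq> K"
    proof
      assume "line u = K"
      moreover have "E v 0 0 0 0 0 \<in> K" using U(1) vU U(5) by blast
      ultimately obtain i where i: "veq q r v (scl i u)" unfolding E_in_line_iff[symmetric]
        using E_in_line_iff by blast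
      have "[dot r v u = i * dot r u u] (mod q)" using dot_cong[OF i veq_refl[of q r u]] by simp
      then have "[i * dot r u u = 0] (mod q)" using vU(2) cong_sym cong_trans by blast
      then have "[i = 0] (mod q)" using u(2) by (simp add: cong_0_mult_iff[OF prime_q])
      then have "veq q r (scl i u) 0" using veq_scl_cong[of i 0 q r u] by (simp add: scl_simps)
      then show False using v0 i veq_trans by blast
    qed
    have B_ne: "?B \<noteq> K"
    proof
      assume "?B = K"
      moreover have "E u 0 0 0 0 0 \<in> K" using U(1) u U(5) by blast
      ultimately obtain a where a: "a \<in> W" "veq q r u a" using E_eq_iff by blast
      have "[dot r u u = dot r a u] (mod q)" by (rule dot_cong[OF a(2) veq_refl])
      with a(1) have "[dot r u u = 0] (mod q)" unfolding W_def using cong_trans by blast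
      then show False using u by blast
    qed
    have gen: "generate (G\<lparr>carrier := K\<rparr>) S = generate G S" if "S \<subseteq> K" for S
      by (rule generate_consistent[OF that sub])
    have refined: "central_decomp (G\<lparr>carrier := K\<rparr>) {line u, ?B}"
      unfolding central_decomp_def
    proof (intro conjI ballI allI impI)
      fix L assume "L \<in> {line u, ?B}"
      then show "subgroup L (G\<lparr>carrier := K\<rparr>)"
        using subgroup_incl[OF subgroup_line sub line_sub] subgroup_incl[OF W sub B_sub] by blast
    next
      fix L M g h assume LM: "L \<in> {line u, ?B}" "M \<in> {line u, ?B}" "L \<noteq> M" "g \<in> L" "h \<in> M"
      have comm: "g \<otimes> h = h \<otimes> g" if gh: "g \<in> line u" "h \<in> ?B" for g h
      proof -
        obtain i j k s t w where g': "g = E (scl i u) (scl j u) (scl k u) s t w"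
          using gh(1) unfolding line_def by blast
        obtain a b c s' t' w' where h': "h = E a b c s' t' w'" "a \<in> W" "b \<in> W" "c \<in> W"
          using gh(2) by blast
        have "[wedge r (scl i u) (scl j u) a b = 0] (mod q)" if "a \<in> W" "b \<in> W" for i j a b
          using that by (auto simp: wedge_def cong_0_iff W_def dot_commute)
        then show ?thesis unfolding g' h'(1) E_commute_iff using h' by blast
      qed
      from LM(1-3) have "L = line u \<and> M = ?B \<or> L = ?B \<and> M = line u" by blast
      then have "g \<otimes> h = h \<otimes> g"
      proof (elim disjE conjE)
        assume "L = line u" "M = ?B"
        then show ?thesis using comm[of g h] LM(4,5) by (simp only:)
      next
        assume "L = ?B" "M = line u"
        then show ?thesis using comm[of h g] LM(4,5) by (simp only:)
      qed
      then show "g \<otimes>\<^bsub>G\<lparr>carrier := K\<rparr>\<^esub> h = h \<otimes>\<^bsub>G\<lparr>carrier := K\<rparr>\<^esub> g" by simp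
    next
      have "K \<subseteq> generate G (line u \<union> ?B)"
      proof
        fix g assume g: "g \<in> K"
        then obtain a b c s t w where g': "g = E a b c s t w" using E_surj K_sub by blast
        then have abc: "a \<in> U" "b \<in> U" "c \<in> U" using g U(1) by auto
        define l where "l v = scl (dot r v u * e) u" for v
        have "E (l a) (l b) (l c) 0 0 0 \<in> line u" unfolding l_def by (rule E_in_line)
        moreover have "E (a - l a) (b - l b) (c - l c) s' t' w' \<in> ?B" for s' t' w'
          using proj abc unfolding l_def by blast
        ultimately have "E (l a) (l b) (l c) 0 0 0 \<otimes> E (a - l a) (b - l b) (c - l c) s' t' w'
            \<in> generate G (line u \<union> ?B)" for s' t' w'
          by (intro generate.eng generate.incl) blast+
        \<comment> \<open>These central coordinates compensate the twist that arises in the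
          product.\<close>
        from this[of "s - wedge r (l b) (l c) (b - l b) (c - l c)" "t - wedge r (l c) (l a) (c - l c) (a - l a)"
            "w - wedge r (l a) (l b) (a - l a) (b - l b)"]
        show "g \<in> generate G (line u \<union> ?B)" by (simp add: E_mult g')
      qed
      moreover have "generate G (line u \<union> ?B) \<subseteq> K"
        using line_sub B_sub by (intro generate_subgroup_incl[OF _ sub]) blast
      ultimately show "generate (G\<lparr>carrier := K\<rparr>) (\<Union>{line u, ?B}) = carrier (G\<lparr>carrier := K\<rparr>)"
        using gen[of "line u \<union> ?B"] line_sub B_sub by simp
    next
      fix J assume "J \<subset> {line u, ?B}"
      then have "\<Union>J \<subseteq> line u \<or> \<Union>J \<subseteq> ?B" by blast
      then have "generate G (\<Union>J) \<subseteq> line u \<or> generate G (\<Union>J) \<subseteq> ?B"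
        using generate_subgroup_incl[OF _ subgroup_line] generate_subgroup_incl[OF _ W] by blast
      then have "generate G (\<Union>J) \<noteq> K" using line_ne B_ne line_sub B_sub by blast
      moreover have "\<Union>J \<subseteq> K" using \<open>\<Union>J \<subseteq> line u \<or> \<Union>J \<subseteq> ?B\<close> line_sub B_sub by blast
      ultimately show "generate (G\<lparr>carrier := K\<rparr>) (\<Union>J) \<noteq> carrier (G\<lparr>carrier := K\<rparr>)"
        using gen by simp
    qed
    have "\<forall>\<J>. central_decomp (G\<lparr>carrier := K\<rparr>) \<J> \<longrightarrow> \<J> = {K}"
      by (rule bspec[OF conjunct2[OF ref[unfolded fully_refined_def]] K])
    from mp[OF spec[OF this] refined] have "{line u, ?B} = {K}" .
    then have "line u \<in> {K}" by (rule subst) (rule insertI1)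
    then show False using line_ne by (simp only: singleton_iff)
  qed
  have "K \<subseteq> line u"
  proof
    fix g assume g: "g \<in> K"
    then obtain a b c s t w where g': "g = E a b c s t w" using E_surj K_sub by blast
    then have abc: "a \<in> U" "b \<in> U" "c \<in> U" using g U(1) by auto
    have "\<exists>i. veq q r v (scl i u)" if "v \<in> U" for v
      using W0[OF proj[OF that]] unfolding veq_diff_0_iff by blast
    then show "g \<in> line u" unfolding g' E_in_line_iff using abc by blast
  qed
  then show ?thesis using that u(2) line_sub by blast
qed

lemma fully_refined_imp_frame:
  assumes ref: "fully_refined G \<K>"
  obtains u where "orth_frame q r u" "\<K> = frame_dec u"
proof -
  have dec: "central_decomp G \<K>" using ref by (simp add: fully_refined_def)
  have "\<forall>K\<in>\<K>. \<exists>u. \<not> [dot r u u = 0] (mod q) \<and> K = line u"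
    using refined_component_line[OF ref] by metis
  then obtain u where u: "\<And>K. K \<in> \<K> \<Longrightarrow> \<not> [dot r (u K) (u K) = 0] (mod q)" "\<And>K. K \<in> \<K> \<Longrightarrow> K = line (u K)"
    by metis
  \<comment> \<open>The vectors are indexed by the decomposition itself; the numbering by 1..r comes
    after its size is known.\<close>
  have orth: "orth_family q r \<K> u"
    unfolding orth_family_def
  proof (intro conjI ballI impI)
    fix K L assume KL: "K \<in> \<K>" "L \<in> \<K>" "K \<noteq> L"
    have "g \<otimes> h = h \<otimes> g" if "g \<in> line (u K)" "h \<in> line (u L)" for g h
    proof -
      have "\<forall>a\<in>K. \<forall>b\<in>L. a \<otimes> b = b \<otimes> a" using dec KL unfolding central_decomp_def by blast
      moreover have "g \<in> K" by (subst u(2)[OF KL(1)]) (rule that(1))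
      moreover have "h \<in> L" by (subst u(2)[OF KL(2)]) (rule that(2))
      ultimately show ?thesis by blast
    qed
    then show "[dot r (u K) (u L) = 0] (mod q)" by (rule orth_of_commute)
  qed (rule u(1))
  \<comment> \<open>Every finite part of the decomposition carries an orthogonal family, so it has
    at most r members; hence the decomposition is finite.\<close>
  have "finite \<J> \<Longrightarrow> card \<J> \<le> r" if "\<J> \<subseteq> \<K>" for \<J>
    using that orth unfolding orth_family_def
    by (intro orth_family_counting(1)[OF prime_q, of \<J> r u]) (unfold orth_family_def, blast+)
  then have fin: "finite \<K>" using finite_if_finite_subsets_card_bdd by blast
  \<comment> \<open>The span of the chosen vectors. The subgroup over it contains every member,
    hence is all of G, so the vectors span and \<open>orth_family_counting\<close> yields exactly r
    of them.\<close>
  define U where "U = {v. \<exists>k. veq q r v (lincomb \<K> k u)}"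
  let ?S = "{E a b c s t w | a b c s t w. a \<in> U \<and> b \<in> U \<and> c \<in> U}"
  have S: "subgroup ?S G"
  proof (rule subgroup_of_subspace)
    show "a + b \<in> U" if "a \<in> U" "b \<in> U" for a b
      using that veq_add lincomb_add unfolding U_def mem_Collect_eq by metis
    show "- a \<in> U" if a: "a \<in> U" for a
    proof -
      obtain k where "veq q r a (lincomb \<K> k u)" using a unfolding U_def by blast
      from veq_diff[OF veq_refl[of q r 0] this] show ?thesis
        unfolding U_def mem_Collect_eq using lincomb_uminus[of \<K> k u] by (metis diff_0)
    qed
    have "lincomb \<K> (\<lambda>_. 0) u = 0" by (simp add: lincomb_def fun_eq_iff)
    then show "0 \<in> U" unfolding U_def mem_Collect_eq using veq_refl by metis
  qed
  have "carrier G = generate G (\<Union>\<K>)" using dec by (simp add: central_decomp_def)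
  also have "\<dots> \<subseteq> ?S"
  proof (rule generate_subgroup_incl[OF _ S], rule Union_least, rule subsetI)
    fix K g assume K: "K \<in> \<K>" "g \<in> K"
    have "scl i (u K) \<in> U" for i
      unfolding U_def mem_Collect_eq using lincomb_single[OF fin K(1), of i u] veq_refl by metis
    then show "g \<in> ?S" using K u(2)[OF K(1)] unfolding line_def by blast
  qed
  finally have carr: "carrier G \<subseteq> ?S" .
  have span: "\<exists>k. veq q r v (lincomb \<K> k u)" for v
  proof -
    have "E v 0 0 0 0 0 \<in> ?S" using carr E_closed by blast
    then obtain a where "veq q r v a" "a \<in> U" using E_eq_iff by blast
    then show ?thesis unfolding U_def using veq_trans by blast
  qed
  have "card \<K> = r" by (rule orth_family_counting(3)[OF prime_q fin orth span])
  then obtain h where h: "bij_betw h {1..r} \<K>" using ex_bij_betw_nat_finite_1[OF fin] by auto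
  have "orth_frame q r (\<lambda>i. u (h i))"
    unfolding orth_family_def
  proof (intro conjI ballI impI)
    fix i j assume ij: "i \<in> {1..r}" "j \<in> {1..r}" "i \<noteq> j"
    then have "h i \<in> \<K>" "h j \<in> \<K>" "h i \<noteq> h j"
      using h by (auto simp: bij_betw_def inj_on_eq_iff)
    then show "[dot r (u (h i)) (u (h j)) = 0] (mod q)" using orth unfolding orth_family_def by blast
  next
    fix i assume "i \<in> {1..r}"
    then have "h i \<in> \<K>" using h by (auto simp: bij_betw_def)
    then show "\<not> [dot r (u (h i)) (u (h i)) = 0] (mod q)" using u(1) by blast
  qed
  moreover have "frame_dec (\<lambda>i. u (h i)) = \<K>"
  proof -
    have "frame_dec (\<lambda>i. u (h i)) = (\<lambda>K. line (u K)) ` h ` {1..r}" by (auto simp: frame_dec_def)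
    also have "h ` {1..r} = \<K>" using h by (simp add: bij_betw_def)
    also have "(\<lambda>K. line (u K)) ` \<K> = id ` \<K>" by (intro image_cong refl) (simp add: u(2)[symmetric])
    also have "id ` \<K> = \<K>" by simp
    finally show ?thesis .
  qed
  ultimately show ?thesis using that by blast
qed

end

section \<open>Square classes\<close>

text \<open>By Euler's criterion c^((p-1)/2) is 1 for a nonzero square and -1 for a non-square, and
  this power is multiplicative.\<close>

lemma QuadRes_mult_iff:
  assumes q: "Factorial_Ring.prime q" "odd q" and ab: "\<not> [a = 0] (mod q)" "\<not> [b = 0] (mod q)"
  shows "QuadRes q (a * b) \<longleftrightarrow> (QuadRes q a \<longleftrightarrow> QuadRes q b)"
proof -
  obtain p where p: "q = int p" "Factorial_Ring.prime p"
    using q(1) by (metis prime_ge_0_int prime_int_nat_transfer int_nat_eq)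
  have "p \<noteq> 2" using q p by auto
  then have "2 < p" using prime_ge_2_nat[OF p(2)] by simp
  have euler: "QuadRes q c \<longleftrightarrow> [c ^ ((p - 1) div 2) = 1] (mod q)" if "\<not> [c = 0] (mod q)" for c
  proof -
    have *: "[Legendre c q = c ^ ((p - 1) div 2)] (mod q)"
      using euler_criterion[OF p(2) \<open>2 < p\<close>] p by simp
    have "\<not> [-1 = 1] (mod q)"
    proof
      assume "[-1 = 1] (mod q)"
      then have "q dvd 2" by (simp add: cong_iff_dvd_diff)
      then show False using \<open>2 < p\<close> p zdvd_imp_le[of q 2] by simp
    qed
    then show ?thesis using * that unfolding Legendre_def by (auto split: if_splits) (metis cong_sym cong_trans)+
  qed
  let ?e = "(p - 1) div 2"
  have pm: "[c ^ ?e = 1] (mod q) \<or> [c ^ ?e = -1] (mod q)" if "\<not> [c = 0] (mod q)" for c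
    using euler_criterion[OF p(2) \<open>2 < p\<close>, of c] that unfolding p(1)[symmetric] Legendre_def
    by (auto split: if_splits intro: cong_sym)
  have ab': "\<not> [a * b = 0] (mod q)" using ab by (simp add: cong_0_mult_iff[OF q(1)])
  have m1: "\<not> [-1 = 1] (mod q)"
  proof
    assume "[-1 = 1] (mod q)"
    then have "q dvd 2" by (simp add: cong_iff_dvd_diff)
    then show False using \<open>2 < p\<close> p zdvd_imp_le[of q 2] by simp
  qed
  consider "[a ^ ?e = 1] (mod q)" "[b ^ ?e = 1] (mod q)" | "[a ^ ?e = 1] (mod q)" "[b ^ ?e = -1] (mod q)"
    | "[a ^ ?e = -1] (mod q)" "[b ^ ?e = 1] (mod q)" | "[a ^ ?e = -1] (mod q)" "[b ^ ?e = -1] (mod q)"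
    using pm ab by blast
  then show ?thesis
  proof cases
    case 1
    then show ?thesis using cong_mult[OF 1] by (simp add: euler ab ab' power_mult_distrib)
  next
    case 2
    have "\<not> [b ^ ?e = 1] (mod q)" using 2(2) m1 cong_sym cong_trans by blast
    moreover have "\<not> [(a * b) ^ ?e = 1] (mod q)"
      using cong_mult[OF 2] m1 cong_sym cong_trans unfolding power_mult_distrib by (metis mult_1)
    ultimately show ?thesis using 2 by (simp add: euler ab ab')
  next
    case 3
    have "\<not> [a ^ ?e = 1] (mod q)" using 3(1) m1 cong_sym cong_trans by blast
    moreover have "\<not> [(a * b) ^ ?e = 1] (mod q)"
      using cong_mult[OF 3] m1 cong_sym cong_trans unfolding power_mult_distrib by (metis mult_1_right)
    ultimately show ?thesis using 3 by (simp add: euler ab ab')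
  next
    case 4
    have "\<not> [a ^ ?e = 1] (mod q)" "\<not> [b ^ ?e = 1] (mod q)" using 4 m1 cong_sym cong_trans by blast+
    then show ?thesis using cong_mult[OF 4] by (simp add: euler ab ab' power_mult_distrib)
  qed
qed

lemma QuadRes_cong: "[a = b] (mod q) \<Longrightarrow> QuadRes q a \<longleftrightarrow> QuadRes q b"
  unfolding QuadRes_def using cong_sym cong_trans by metis

lemma QuadRes_square: "QuadRes q (t\<^sup>2)"
  unfolding QuadRes_def by (rule exI[of _ t]) (rule cong_refl)

text \<open>With a b = y^2 the quotient is a / b = (y / b)^2.\<close>

lemma QuadRes_quotient:
  assumes q: "Factorial_Ring.prime q" "odd q" and ab: "\<not> [a = 0] (mod q)" "\<not> [b = 0] (mod q)"
    and same: "QuadRes q a \<longleftrightarrow> QuadRes q b"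
  obtains t where "[t\<^sup>2 * b = a] (mod q)"
proof -
  have "QuadRes q (a * b)" using same QuadRes_mult_iff[OF q ab] by blast
  then obtain y where y: "[y\<^sup>2 = a * b] (mod q)" by (auto simp: QuadRes_def)
  obtain e where e: "[b * e = 1] (mod q)" using cong_inverse[OF q(1) ab(2)] by blast
  have "[(y * e)\<^sup>2 * b = (a * b) * (e\<^sup>2 * b)] (mod q)"
    using cong_mult[OF y cong_refl[of "e\<^sup>2 * b"]] by (simp add: power_mult_distrib ac_simps)
  also have "(a * b) * (e\<^sup>2 * b) = a * ((b * e) * (b * e))" by (simp add: power2_eq_square)
  also have "[a * ((b * e) * (b * e)) = a * (1 * 1)] (mod q)" by (intro cong_mult e cong_refl)
  finally show ?thesis using that[of "y * e"] by simp
qed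

lemma QuadRes_prod:
  assumes q: "Factorial_Ring.prime q" "odd q" and "finite I" "\<And>i. i \<in> I \<Longrightarrow> \<not> [c i = 0] (mod q)"
  shows "\<not> [prod c I = 0] (mod q) \<and> (QuadRes q (prod c I) \<longleftrightarrow> even (card {i \<in> I. \<not> QuadRes q (c i)}))"
  using assms(3,4)
proof (induction I rule: finite_induct)
  case empty
  have "\<not> [1 = 0] (mod q)" using not_prime_unit[of q] q(1) by (auto simp: cong_0_iff)
  then show ?case using QuadRes_square[of q 1] by simp
next
  case (insert i F)
  have IH: "\<not> [prod c F = 0] (mod q)" "QuadRes q (prod c F) \<longleftrightarrow> even (card {i \<in> F. \<not> QuadRes q (c i)})"
    using insert by auto
  have ci: "\<not> [c i = 0] (mod q)" using insert by blast
  have "QuadRes q (prod c (insert i F)) \<longleftrightarrow> (QuadRes q (c i) \<longleftrightarrow> QuadRes q (prod c F))"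
    using QuadRes_mult_iff[OF q ci IH(1)] insert.hyps by simp
  moreover have "{j \<in> insert i F. \<not> QuadRes q (c j)} =
      (if QuadRes q (c i) then {j \<in> F. \<not> QuadRes q (c j)} else insert i {j \<in> F. \<not> QuadRes q (c j)})"
    by auto
  moreover have "\<not> [prod c (insert i F) = 0] (mod q)"
    using insert.hyps ci IH(1) by (simp add: cong_0_mult_iff[OF q(1)])
  ultimately show ?case using IH(2) insert.hyps by simp
qed

text \<open>The Leibniz formula is an integer polynomial in the entries, so identities between
  integer determinants may be read modulo q.\<close>

lemma det_cong:
  fixes A B :: "int mat"
  assumes AB: "A \<in> carrier_mat n n" "B \<in> carrier_mat n n"
    and cong: "\<And>i j. i < n \<Longrightarrow> j < n \<Longrightarrow> [A $$ (i, j) = B $$ (i, j)] (mod q)"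
  shows "[det A = det B] (mod q)"
  unfolding det_def'[OF AB(1)] det_def'[OF AB(2)]
proof (intro cong_sum cong_mult cong_refl cong_prod)
  fix \<pi> i assume "\<pi> \<in> {\<pi>. \<pi> permutes {0..<n}}" "i \<in> {0..<n}"
  then have "i < n" "\<pi> i < n" using permutes_in_image by fastforce+
  then show "[A $$ (i, \<pi> i) = B $$ (i, \<pi> i)] (mod q)" by (rule cong)
qed

definition nonsq :: "int \<Rightarrow> nat \<Rightarrow> (nat \<Rightarrow> nat \<Rightarrow> int) \<Rightarrow> nat set" where
  "nonsq q r u = {i \<in> {1..r}. \<not> QuadRes q (dot r (u i) (u i))}"

text \<open>The Gram matrix of a frame has determinant the square of the determinant of the frame.\<close>

lemma even_card_nonsq:
  assumes q: "Factorial_Ring.prime q" "odd q" and fr: "orth_frame q r u"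
  shows "even (card (nonsq q r u))"
proof -
  \<comment> \<open>Frames are indexed from 1 and matrices from 0, hence the shifts by
    \<open>Suc\<close>.\<close>
  define A where "A = mat r r (\<lambda>(i, j). u (Suc i) (Suc j))"
  define c where "c i = dot r (u i) (u i)" for i
  define D where "D = mat r r (\<lambda>(i, j). if i = j then c (Suc i) else 0)"
  have A: "A \<in> carrier_mat r r" and D: "D \<in> carrier_mat r r" by (auto simp: A_def D_def)
  have entry: "(A * A\<^sup>T) $$ (i, j) = dot r (u (Suc i)) (u (Suc j))" if "i < r" "j < r" for i j
  proof -
    have "(A * A\<^sup>T) $$ (i, j) = (\<Sum>k\<in>{0..<r}. u (Suc i) (Suc k) * u (Suc j) (Suc k))"
      using that by (simp add: A_def scalar_prod_def)
    also have "\<dots> = (\<Sum>k\<in>{Suc 0..<Suc r}. u (Suc i) k * u (Suc j) k)"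
      by (rule sum.shift_bounds_Suc_ivl[symmetric])
    finally show ?thesis by (simp add: dot_def atLeastLessThanSuc_atLeastAtMost)
  qed
  have "[det (A * A\<^sup>T) = det D] (mod q)"
  proof (rule det_cong)
    show "A * A\<^sup>T \<in> carrier_mat r r" using A by simp
    show "[(A * A\<^sup>T) $$ (i, j) = D $$ (i, j)] (mod q)" if "i < r" "j < r" for i j
      using fr that by (auto simp: entry D_def c_def orth_family_def)
  qed (rule D)
  also have "det D = prod_list (diag_mat D)"
    by (rule det_upper_triangular[OF _ D]) (auto simp: D_def)
  also have "\<dots> = (\<Prod>i\<in>{0..<r}. D $$ (i, i))"
    using D by (simp add: diag_mat_def prod.distinct_set_conv_list[symmetric])
  also have "\<dots> = (\<Prod>i\<in>{0..<r}. c (Suc i))"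
    by (intro prod.cong refl) (simp add: D_def)
  also have "\<dots> = prod c {1..r}"
    using prod.shift_bounds_Suc_ivl[of c 0 r] by (simp add: atLeastLessThanSuc_atLeastAtMost)
  finally have "[det (A * A\<^sup>T) = prod c {1..r}] (mod q)" .
  moreover have "det (A * A\<^sup>T) = (det A)\<^sup>2"
    using A by (simp add: det_mult det_transpose power2_eq_square)
  ultimately have "QuadRes q (prod c {1..r})" using QuadRes_square QuadRes_cong by metis
  then show ?thesis
    using QuadRes_prod[OF q, of "{1..r}" c] fr by (simp add: nonsq_def c_def orth_family_def)
qed

section \<open>Automorphisms\<close>

lemma orth_frame_expansion:
  assumes q: "Factorial_Ring.prime q" and fr: "orth_frame q r u"
    and e: "\<And>i. i \<in> {1..r} \<Longrightarrow> [e i * dot r (u i) (u i) = 1] (mod q)"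
  shows "veq q r v (lincomb {1..r} (\<lambda>i. dot r v (u i) * e i) u)"
proof -
  obtain k where k: "veq q r v (lincomb {1..r} k u)" using orth_frame_spanning[OF q fr] by blast
  have "[k i = dot r v (u i) * e i] (mod q)" if i: "i \<in> {1..r}" for i
  proof -
    have "[dot r v (u i) = dot r (lincomb {1..r} k u) (u i)] (mod q)" by (rule dot_cong[OF k veq_refl])
    also have "[dot r (lincomb {1..r} k u) (u i) = k i * dot r (u i) (u i)] (mod q)"
      using dot_lincomb_orth[OF fr _ i] by simp
    finally have "[dot r v (u i) * e i = k i * dot r (u i) (u i) * e i] (mod q)" by (intro cong_mult cong_refl)
    also have "k i * dot r (u i) (u i) * e i = k i * (e i * dot r (u i) (u i))" by simp
    also have "[k i * (e i * dot r (u i) (u i)) = k i * 1] (mod q)" by (intro cong_mult cong_refl e i)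
    finally show ?thesis by (simp add: cong_sym)
  qed
  then have "veq q r (lincomb {1..r} k u) (lincomb {1..r} (\<lambda>i. dot r v (u i) * e i) u)"
    unfolding veq_def lincomb_def by (intro ballI cong_sum cong_mult cong_refl)
  with k show ?thesis using veq_trans by blast
qed

text \<open>\<open>S\<close> is the linear map taking u_i to t_i u'_(\<sigma> i). The hypothesis on
  \<open>t\<close> says that it multiplies the norms of the frame by \<kappa>, and orthogonality of
  both frames extends this to all dot products.\<close>

lemma frame_similitude:
  assumes q: "Factorial_Ring.prime q" and fr: "orth_frame q r u" and fr': "orth_frame q r u'"
    and \<sigma>: "bij_betw \<sigma> {1..r} {1..r}" and \<kappa>: "\<not> [\<kappa> = 0] (mod q)"
    and t: "\<And>i. i \<in> {1..r} \<Longrightarrow> [(t i)\<^sup>2 * dot r (u' (\<sigma> i)) (u' (\<sigma> i)) = \<kappa> * dot r (u i) (u i)] (mod q)"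
  obtains S \<tau> where "\<And>v w. S (v + w) = S v + S w" "S 0 = 0" "\<And>v w. S (v - w) = S v - S w"
    "\<And>v w. veq q r v w \<longleftrightarrow> veq q r (S v) (S w)" "\<And>v w. [dot r (S v) (S w) = \<kappa> * dot r v w] (mod q)"
    "\<And>v'. \<exists>v. veq q r v' (S v)"
    "\<And>i k. i \<in> {1..r} \<Longrightarrow> veq q r (S (scl k (u i))) (scl (k * t i) (u' (\<sigma> i)))"
    "\<And>i k. i \<in> {1..r} \<Longrightarrow> [\<tau> i * t i = 1] (mod q)"
proof -
  define I where "I = {1..r}"
  have fin: "finite I" by (simp add: I_def)
  have c0: "\<not> [dot r (u i) (u i) = 0] (mod q)" if "i \<in> I" for i
    using fr that by (auto simp: orth_family_def I_def)
  then have "\<forall>i\<in>I. \<exists>e. [e * dot r (u i) (u i) = 1] (mod q)" using cong_inverse[OF q] by metis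
  then obtain e where e: "\<And>i. i \<in> I \<Longrightarrow> [e i * dot r (u i) (u i) = 1] (mod q)" by metis
  have "\<not> [t i = 0] (mod q)" if i: "i \<in> I" for i
  proof
    assume "[t i = 0] (mod q)"
    then have "[(t i)\<^sup>2 * dot r (u' (\<sigma> i)) (u' (\<sigma> i)) = 0] (mod q)"
      by (simp add: cong_0_mult_iff[OF q] power2_eq_square)
    with t[of i] i have "[\<kappa> * dot r (u i) (u i) = 0] (mod q)" using cong_sym cong_trans unfolding I_def by blast
    then show False using \<kappa> c0[OF i] by (simp add: cong_0_mult_iff[OF q])
  qed
  then have "\<forall>i\<in>I. \<exists>\<tau>. [\<tau> * t i = 1] (mod q)" using cong_inverse[OF q] by metis
  then obtain \<tau> where \<tau>: "\<And>i. i \<in> I \<Longrightarrow> [\<tau> i * t i = 1] (mod q)" by metis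
  define u'' where "u'' = (\<lambda>i. u' (\<sigma> i))"
  have fr'': "orth_family q r I u''"
    unfolding orth_family_def
  proof (intro conjI ballI impI)
    fix i j assume ij: "i \<in> I" "j \<in> I" "i \<noteq> j"
    then have "\<sigma> i \<in> {1..r}" "\<sigma> j \<in> {1..r}" "\<sigma> i \<noteq> \<sigma> j"
      using \<sigma> by (auto simp: bij_betw_def inj_on_eq_iff I_def)
    then show "[dot r (u'' i) (u'' j) = 0] (mod q)" using fr' unfolding orth_family_def u''_def by blast
  next
    fix i assume "i \<in> I"
    then have "\<sigma> i \<in> {1..r}" using \<sigma> by (auto simp: bij_betw_def I_def)
    then show "\<not> [dot r (u'' i) (u'' i) = 0] (mod q)" using fr' unfolding orth_family_def u''_def by blast
  qed
  have fr_I: "orth_family q r I u" using fr by (simp add: I_def)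
  \<comment> \<open>The coefficients are those of \<open>orth_frame_expansion\<close>. This formula
    makes \<open>S\<close> additive as a map of functions, while its values on the frame hold modulo
    q.\<close>
  define S where "S v = lincomb I (\<lambda>i. dot r v (u i) * e i * t i) u''" for v
  have add: "S (v + w) = S v + S w" for v w
    unfolding S_def lincomb_add by (simp add: distrib_right)
  have zero: "S 0 = 0" unfolding S_def by (simp add: lincomb_def fun_eq_iff)
  have diff: "S (v - w) = S v - S w" for v w
    using add[of "v - w" w] by (simp add: algebra_simps)
  have S_cong: "veq q r (S v) (S w)" if "veq q r v w" for v w
    unfolding S_def lincomb_def veq_def
    by (intro ballI cong_sum cong_mult cong_refl dot_cong that veq_refl)
  have sim: "[dot r (S v) (S w) = \<kappa> * dot r v w] (mod q)" for v w
  proof -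
    have "dot r (S v) (S w) = (\<Sum>i\<in>I. dot r v (u i) * e i * t i * dot r (S w) (u'' i))"
      unfolding S_def[of v] dot_lincomb by (simp add: dot_commute)
    \<comment> \<open>The hypothesis on \<open>t\<close> turns t_i^2 times the norm of
      \<open>u'' i\<close> into \<kappa> times the norm of \<open>u i\<close>, which cancels one
      factor \<open>e i\<close>.\<close>
    also have "[\<dots> = (\<Sum>i\<in>I. \<kappa> * (dot r v (u i) * e i * dot r (u i) w))] (mod q)"
    proof (rule cong_sum)
      fix i assume i: "i \<in> I"
      have "[dot r v (u i) * e i * t i * dot r (S w) (u'' i) =
             dot r v (u i) * e i * t i * (dot r w (u i) * e i * t i * dot r (u'' i) (u'' i))] (mod q)"
        unfolding S_def by (intro cong_mult cong_refl dot_lincomb_orth[OF fr'' fin i])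
      also have "dot r v (u i) * e i * t i * (dot r w (u i) * e i * t i * dot r (u'' i) (u'' i))
          = dot r v (u i) * e i * dot r w (u i) * e i * ((t i)\<^sup>2 * dot r (u'' i) (u'' i))"
        by (simp add: power2_eq_square)
      also have "[\<dots> = dot r v (u i) * e i * dot r w (u i) * e i * (\<kappa> * dot r (u i) (u i))] (mod q)"
        using t[of i] i unfolding u''_def I_def by (intro cong_mult[OF cong_refl]) simp
      also have "dot r v (u i) * e i * dot r w (u i) * e i * (\<kappa> * dot r (u i) (u i))
          = \<kappa> * (dot r v (u i) * e i * dot r (u i) w) * (e i * dot r (u i) (u i))"
        by (simp add: dot_commute)
      also have "[\<dots> = \<kappa> * (dot r v (u i) * e i * dot r (u i) w) * 1] (mod q)"
        by (intro cong_mult cong_refl e i)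
      finally show "[dot r v (u i) * e i * t i * dot r (S w) (u'' i) =
          \<kappa> * (dot r v (u i) * e i * dot r (u i) w)] (mod q)" by simp
    qed
    also have "(\<Sum>i\<in>I. \<kappa> * (dot r v (u i) * e i * dot r (u i) w))
        = \<kappa> * dot r (lincomb I (\<lambda>i. dot r v (u i) * e i) u) w"
      by (simp add: dot_lincomb sum_distrib_left)
    also have "[\<dots> = \<kappa> * dot r v w] (mod q)"
      using orth_frame_expansion[OF q fr, of e v] e unfolding I_def
      by (intro cong_mult cong_refl dot_cong veq_refl) (auto intro: veq_sym)
    finally show ?thesis .
  qed
  \<comment> \<open>A similitude with unit factor is injective because \<open>dot\<close> is
    nondegenerate.\<close>
  have inj: "veq q r v w" if "veq q r (S v) (S w)" for v w
  proof -
    have "veq q r (v - w) 0"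
      unfolding veq_0_iff_dot
    proof
      fix z
      have "[dot r (S (v - w)) (S z) = dot r 0 (S z)] (mod q)"
        using that by (intro dot_cong veq_refl) (simp add: diff veq_diff_0_iff)
      then have "[\<kappa> * dot r (v - w) z = 0] (mod q)" using sim cong_sym cong_trans by (metis dot_simps(7))
      then show "[dot r (v - w) z = 0] (mod q)" using \<kappa> cong_0_mult_iff[OF q] by blast
    qed
    then show ?thesis by (simp add: veq_diff_0_iff)
  qed
  have image: "veq q r (S (lincomb I k u)) (lincomb I (\<lambda>i. k i * t i) u'')" for k
    unfolding S_def lincomb_def[of I _ u''] veq_def
  proof (intro ballI cong_sum cong_mult cong_refl)
    fix i assume i: "i \<in> I"
    have "[dot r (lincomb I k u) (u i) * e i = k i * dot r (u i) (u i) * e i] (mod q)"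
      by (intro cong_mult cong_refl dot_lincomb_orth[OF fr_I fin i])
    also have "k i * dot r (u i) (u i) * e i = k i * (e i * dot r (u i) (u i))" by simp
    also have "[k i * (e i * dot r (u i) (u i)) = k i * 1] (mod q)" by (intro cong_mult cong_refl e i)
    finally show "[dot r (lincomb I k u) (u i) * e i = k i] (mod q)" by simp
  qed
  have surj: "\<exists>v. veq q r v' (S v)" for v'
  proof -
    have "\<exists>k. veq q r v' (lincomb I k u'')"
      by (rule orth_family_counting(2)[OF q fin fr'']) (simp add: I_def)
    then obtain k where k: "veq q r v' (lincomb I k u'')" ..
    have "[k i * (\<tau> i * t i) = k i * 1] (mod q)" if "i \<in> I" for i
      by (intro cong_mult cong_refl \<tau> that)
    then have "[k i = k i * \<tau> i * t i] (mod q)" if "i \<in> I" for i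
      using that by (simp add: cong_sym mult.assoc)
    then have "veq q r (lincomb I k u'') (lincomb I (\<lambda>i. k i * \<tau> i * t i) u'')"
      unfolding lincomb_def veq_def by (intro ballI cong_sum cong_mult cong_refl)
    then show ?thesis using k image[of "\<lambda>i. k i * \<tau> i"] veq_trans veq_sym by blast
  qed
  have single: "veq q r (S (scl k (u i))) (scl (k * t i) (u' (\<sigma> i)))" if i: "i \<in> {1..r}" for i k
  proof -
    have i': "i \<in> I" using i by (simp add: I_def)
    have "(\<lambda>j. (if j = i then k else 0) * t j) = (\<lambda>j. if j = i then k * t i else 0)" by auto
    then show ?thesis
      using image[of "\<lambda>j. if j = i then k else 0"] lincomb_single[OF fin i', of k u]
        lincomb_single[OF fin i', of "k * t i" u''] by (simp add: u''_def)
  qed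
  show ?thesis
  proof (rule that[of S \<tau>])
    show "veq q r v w \<longleftrightarrow> veq q r (S v) (S w)" for v w using S_cong inj by blast
    show "[\<tau> i * t i = 1] (mod q)" if "i \<in> {1..r}" for i using \<tau> that by (simp add: I_def)
  qed (fact add zero diff sim surj single)+
qed

text \<open>Applying \<open>S\<close> to the vector coordinates scales the twists by \<kappa>, so
  scaling the central coordinates by \<kappa> as well gives a homomorphism. Allowing two groups
  covers both automorphisms of P and isomorphisms of lines with H.\<close>

lemma similitude_iso:
  assumes "heisenberg_coords G q r E" "heisenberg_coords G' q r E'"
    and add: "\<And>v w. S (v + w) = S v + S w" and \<kappa>: "\<not> [\<kappa> = 0] (mod q)"
    and iff: "\<And>v w. veq q r v w \<longleftrightarrow> veq q r (S v) (S w)"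
    and sim: "\<And>v w. [dot r (S v) (S w) = \<kappa> * dot r v w] (mod q)"
    and surj: "\<And>v'. \<exists>v. veq q r v' (S v)"
  obtains f where "f \<in> extensional (carrier G)" "f \<in> iso G G'"
    "\<And>a b c s t w. f (E a b c s t w) = E' (S a) (S b) (S c) (\<kappa> * s) (\<kappa> * t) (\<kappa> * w)"
proof -
  interpret G: heisenberg_coords G q r E by (rule assms(1))
  interpret G': heisenberg_coords G' q r E' by (rule assms(2))
  \<comment> \<open>The integer coordinates of an element are not unique, so \<open>f\<close> is
    given by a description; \<open>eq\<close> shows that the value does not depend on the
    coordinates.\<close>
  define f where "f = (\<lambda>g\<in>carrier G. THE h. \<exists>a b c s t w. g = E a b c s t w \<and>
    h = E' (S a) (S b) (S c) (\<kappa> * s) (\<kappa> * t) (\<kappa> * w))"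
  have eq: "E' (S a) (S b) (S c) (\<kappa> * s) (\<kappa> * t) (\<kappa> * w) = E' (S a') (S b') (S c') (\<kappa> * s') (\<kappa> * t') (\<kappa> * w')
    \<longleftrightarrow> E a b c s t w = E a' b' c' s' t' w'" for a b c s t w a' b' c' s' t' w'
    unfolding G.E_eq_iff G'.E_eq_iff iff[symmetric] by (simp add: cong_mult_cancel[OF G.prime_q \<kappa>])
  have f: "f (E a b c s t w) = E' (S a) (S b) (S c) (\<kappa> * s) (\<kappa> * t) (\<kappa> * w)" for a b c s t w
  proof -
    have "(THE h. \<exists>a' b' c' s' t' w'. E a b c s t w = E a' b' c' s' t' w' \<and>
      h = E' (S a') (S b') (S c') (\<kappa> * s') (\<kappa> * t') (\<kappa> * w')) = E' (S a) (S b) (S c) (\<kappa> * s) (\<kappa> * t) (\<kappa> * w)"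
    proof (rule the_equality)
      fix h assume "\<exists>a' b' c' s' t' w'. E a b c s t w = E a' b' c' s' t' w' \<and>
        h = E' (S a') (S b') (S c') (\<kappa> * s') (\<kappa> * t') (\<kappa> * w')"
      then obtain a' b' c' s' t' w' where 1: "E a b c s t w = E a' b' c' s' t' w'"
        "h = E' (S a') (S b') (S c') (\<kappa> * s') (\<kappa> * t') (\<kappa> * w')" by blast
      show "h = E' (S a) (S b) (S c) (\<kappa> * s) (\<kappa> * t) (\<kappa> * w)"
        unfolding 1(2) eq by (rule 1(1)[symmetric])
    qed blast
    then show ?thesis by (simp add: f_def)
  qed
  have wedge: "[wedge r (S a) (S b) (S a') (S b') = \<kappa> * wedge r a b a' b'] (mod q)" for a b a' b'
    unfolding wedge_def right_diff_distrib by (intro cong_diff sim)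
  have "f \<in> iso G G'"
    unfolding iso_def hom_def bij_betw_def
  proof (intro CollectI conjI ballI)
    show "f \<in> carrier G \<rightarrow> carrier G'"
    proof
      fix g assume "g \<in> carrier G"
      then obtain a b c s t w where "g = E a b c s t w" using G.E_surj by blast
      then show "f g \<in> carrier G'" by (simp add: f)
    qed
    fix g h assume "g \<in> carrier G" "h \<in> carrier G"
    then obtain a b c s t w a' b' c' s' t' w' where gh: "g = E a b c s t w" "h = E a' b' c' s' t' w'"
      using G.E_surj by meson
    show "f (g \<otimes>\<^bsub>G\<^esub> h) = f g \<otimes>\<^bsub>G'\<^esub> f h"
      unfolding gh f G.E_mult G'.E_mult G'.E_eq_iff add distrib_left
      by (intro conjI veq_refl cong_add cong_refl cong_sym[OF wedge])
  next
    show "inj_on f (carrier G)"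
    proof (rule inj_onI)
      fix g h assume gh: "g \<in> carrier G" "h \<in> carrier G" "f g = f h"
      then obtain a b c s t w a' b' c' s' t' w' where gh': "g = E a b c s t w" "h = E a' b' c' s' t' w'"
        using G.E_surj by meson
      from gh(3) show "g = h" unfolding gh' f eq .
    qed
    show "f ` carrier G = carrier G'"
    proof
      show "f ` carrier G \<subseteq> carrier G'"
      proof
        fix h assume "h \<in> f ` carrier G"
        then obtain g where g: "g \<in> carrier G" "h = f g" by blast
        then obtain a b c s t w where "g = E a b c s t w" using G.E_surj by blast
        then show "h \<in> carrier G'" by (simp add: f g(2))
      qed
      show "carrier G' \<subseteq> f ` carrier G"
      proof
        fix g assume "g \<in> carrier G'"
        then obtain a b c s t w where g: "g = E' a b c s t w" using G'.E_surj by blast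
        obtain a' b' c' where abc: "veq q r a (S a')" "veq q r b (S b')" "veq q r c (S c')"
          using surj by metis
        obtain e where e: "[\<kappa> * e = 1] (mod q)" using cong_inverse[OF G.prime_q \<kappa>] by blast
        have "[s = \<kappa> * (e * s)] (mod q)" for s
          using cong_mult[OF e cong_refl[of s]] by (simp add: cong_sym mult.assoc)
        then have "g = f (E a' b' c' (e * s) (e * t) (e * w))" unfolding g f G'.E_eq_iff using abc by blast
        then show "g \<in> f ` carrier G" using G.E_closed by blast
      qed
    qed
  qed
  moreover have "f \<in> extensional (carrier G)" by (simp add: f_def)
  ultimately show ?thesis using that f by blast
qed

context heisenberg_coords
begin

text \<open>The automorphism is 1 \<otimes> S for the similitude S of the two frames. Its scalar
  action on central coordinates is recorded because \<kappa> = 1 then centralizes the derived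
  subgroup.\<close>

lemma automorphism_of_square_classes:
  assumes fr: "orth_frame q r u" and fr': "orth_frame q r u'"
    and \<sigma>: "bij_betw \<sigma> {1..r} {1..r}" and \<kappa>: "\<not> [\<kappa> = 0] (mod q)"
    and t: "\<And>i. i \<in> {1..r} \<Longrightarrow> [(t i)\<^sup>2 * dot r (u' (\<sigma> i)) (u' (\<sigma> i)) = \<kappa> * dot r (u i) (u i)] (mod q)"
  obtains f where "f \<in> auto G" "dec_act (frame_dec u) f = frame_dec u'"
    "\<And>s t w. f (E 0 0 0 s t w) = E 0 0 0 (\<kappa> * s) (\<kappa> * t) (\<kappa> * w)"
proof -
  obtain S \<tau> where S: "\<And>v w. S (v + w) = S v + S w" "S 0 = 0" "\<And>v w. S (v - w) = S v - S w"
    "\<And>v w. veq q r v w \<longleftrightarrow> veq q r (S v) (S w)" "\<And>v w. [dot r (S v) (S w) = \<kappa> * dot r v w] (mod q)"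
    "\<And>v'. \<exists>v. veq q r v' (S v)"
    "\<And>i k. i \<in> {1..r} \<Longrightarrow> veq q r (S (scl k (u i))) (scl (k * t i) (u' (\<sigma> i)))"
    "\<And>i k. i \<in> {1..r} \<Longrightarrow> [\<tau> i * t i = 1] (mod q)"
    by (rule frame_similitude[OF prime_q fr fr' \<sigma> \<kappa> t]) (assumption | rule that)+
  obtain f where f: "f \<in> auto G"
    "\<And>a b c s t w. f (E a b c s t w) = E (S a) (S b) (S c) (\<kappa> * s) (\<kappa> * t) (\<kappa> * w)"
  proof (rule similitude_iso[OF heisenberg_coords_axioms heisenberg_coords_axioms S(1) \<kappa> S(4,5,6)])
    fix f assume f: "f \<in> extensional (carrier G)" "f \<in> iso G G"
      "\<And>a b c s t w. f (E a b c s t w) = E (S a) (S b) (S c) (\<kappa> * s) (\<kappa> * t) (\<kappa> * w)"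
    have "f \<in> auto G" using f(1,2) by (simp add: auto_def Bij_def iso_def)
    then show thesis using f(3) by (rule that)
  qed
  have line: "f ` line (u i) = line (u' (\<sigma> i))" if i: "i \<in> {1..r}" for i
  proof
    show "f ` line (u i) \<subseteq> line (u' (\<sigma> i))"
    proof
      fix h assume "h \<in> f ` line (u i)"
      then obtain j k l s t w where "h = f (E (scl j (u i)) (scl k (u i)) (scl l (u i)) s t w)"
        unfolding line_def by blast
      then show "h \<in> line (u' (\<sigma> i))" unfolding f(2) using E_in_line_iff S(7)[OF i] by blast
    qed
    show "line (u' (\<sigma> i)) \<subseteq> f ` line (u i)"
    proof
      fix h assume "h \<in> line (u' (\<sigma> i))"
      then obtain j k l s t' w where h: "h = E (scl j (u' (\<sigma> i))) (scl k (u' (\<sigma> i))) (scl l (u' (\<sigma> i))) s t' w"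
        unfolding line_def by blast
      \<comment> \<open>\<open>\<tau>\<close> undoes the scaling by \<open>t\<close>, which provides
        preimages.\<close>
      have *: "veq q r (scl j (u' (\<sigma> i))) (S (scl (j * \<tau> i) (u i)))" for j
      proof -
        have "[j * (\<tau> i * t i) = j * 1] (mod q)" by (intro cong_mult cong_refl S(8) i)
        then have "veq q r (scl (j * \<tau> i * t i) (u' (\<sigma> i))) (scl j (u' (\<sigma> i)))"
          by (intro veq_scl_cong) (simp add: mult.assoc)
        then show ?thesis using S(7)[OF i, of "j * \<tau> i"] veq_sym veq_trans by blast
      qed
      obtain e where e: "[\<kappa> * e = 1] (mod q)" using cong_inverse[OF prime_q \<kappa>] by blast
      have "[s = \<kappa> * (e * s)] (mod q)" for s
        using cong_mult[OF e cong_refl[of s]] by (simp add: cong_sym mult.assoc)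
      then have "h = f (E (scl (j * \<tau> i) (u i)) (scl (k * \<tau> i) (u i)) (scl (l * \<tau> i) (u i)) (e * s) (e * t') (e * w))"
        unfolding h f(2) E_eq_iff using * by blast
      then show "h \<in> f ` line (u i)" using E_in_line by blast
    qed
  qed
  have "dec_act (frame_dec u) f = (\<lambda>i. line (u' (\<sigma> i))) ` {1..r}"
    unfolding dec_act_def frame_dec_def image_image by (intro image_cong refl line)
  also have "\<dots> = (\<lambda>i. line (u' i)) ` (\<sigma> ` {1..r})" by (simp only: image_image)
  also have "\<sigma> ` {1..r} = {1..r}" using \<sigma> by (simp add: bij_betw_def)
  finally have "dec_act (frame_dec u) f = frame_dec u'" by (simp add: frame_dec_def)
  then show ?thesis using that[OF f(1)] f(2) S(2) by simp
qed

lemma derived_subset: "derived G (carrier G) \<subseteq> {E 0 0 0 s t w | s t w. True}"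
  unfolding derived_def
proof (rule generate_subgroup_incl)
  show "subgroup {E 0 0 0 s t w | s t w. True} G"
    using subgroup_of_subspace[of "{0}"] by simp
  show "(\<Union>h1\<in>carrier G. \<Union>h2\<in>carrier G. {h1 \<otimes> h2 \<otimes> inv h1 \<otimes> inv h2}) \<subseteq> {E 0 0 0 s t w | s t w. True}"
  proof
    fix g assume "g \<in> (\<Union>h1\<in>carrier G. \<Union>h2\<in>carrier G. {h1 \<otimes> h2 \<otimes> inv h1 \<otimes> inv h2})"
    then obtain h1 h2 where h: "h1 \<in> carrier G" "h2 \<in> carrier G" "g = h1 \<otimes> h2 \<otimes> inv h1 \<otimes> inv h2" by blast
    then obtain a b c s t w a' b' c' s' t' w' where "h1 = E a b c s t w" "h2 = E a' b' c' s' t' w'"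
      using E_surj by meson
    then show "g \<in> {E 0 0 0 s t w | s t w. True}" unfolding h(3) using E_comm(2) by blast
  qed
qed

text \<open>The doubled coordinates are what commutators produce; as 2 is a unit, these are all
  elements with zero vector coordinates.\<close>

lemma central_in_derived: "E 0 0 0 (2 * s) (2 * t) (2 * w) \<in> derived G (carrier G)"
proof -
  let ?D = "derived G (carrier G)"
  have D: "subgroup ?D G" by (rule derived_is_subgroup) simp
  have comm: "h1 \<otimes> h2 \<otimes> inv h1 \<otimes> inv h2 \<in> ?D" if "h1 \<in> carrier G" "h2 \<in> carrier G" for h1 h2
    unfolding derived_def using that by (intro generate.incl) blast
  have d: "dot r (scl k (unitv 1)) (unitv 1) = k" for k
    using r_pos by (subst dot_unitv(1)) (auto simp: scl_apply unitv_def)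
  have 1: "E 0 0 0 (2 * s) 0 0 \<in> ?D"
    using comm[OF E_closed E_closed, of 0 "scl s (unitv 1)" 0 0 0 0 0 0 "unitv 1" 0 0 0]
    unfolding E_comm(2) wedge_def d by simp
  have 2: "E 0 0 0 0 (2 * t) 0 \<in> ?D"
    using comm[OF E_closed E_closed, of 0 0 "scl t (unitv 1)" 0 0 0 "unitv 1" 0 0 0 0 0]
    unfolding E_comm(2) wedge_def d by simp
  have 3: "E 0 0 0 0 0 (2 * w) \<in> ?D"
    using comm[OF E_closed E_closed, of "scl w (unitv 1)" 0 0 0 0 0 0 "unitv 1" 0 0 0 0]
    unfolding E_comm(2) wedge_def d by simp
  have "E 0 0 0 (2 * s) 0 0 \<otimes> E 0 0 0 0 (2 * t) 0 \<otimes> E 0 0 0 0 0 (2 * w) \<in> ?D"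
    using 1 2 3 by (intro subgroup.m_closed[OF D])
  then show ?thesis by (simp add: E_mult)
qed

end

section \<open>Determinants of 3 by 3 integer matrices\<close>

definition det3 :: "int \<Rightarrow> int \<Rightarrow> int \<Rightarrow> int \<Rightarrow> int \<Rightarrow> int \<Rightarrow> int \<Rightarrow> int \<Rightarrow> int \<Rightarrow> int" where
  "det3 a1 a2 a3 b1 b2 b3 c1 c2 c3 =
     a1 * (b2 * c3 - b3 * c2) + a2 * (b3 * c1 - b1 * c3) + a3 * (b1 * c2 - b2 * c1)"

text \<open>For a matrix with rows a, b, c the rows here are the cross products of b and c, c and a,
  a and b: the cofactor matrix, whose determinant is the square of the original one.\<close>

lemma det3_cofactor:
  "det3 (b2 * c3 - b3 * c2) (b3 * c1 - b1 * c3) (b1 * c2 - b2 * c1)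
        (c2 * a3 - c3 * a2) (c3 * a1 - c1 * a3) (c1 * a2 - c2 * a1)
        (a2 * b3 - a3 * b2) (a3 * b1 - a1 * b3) (a1 * b2 - a2 * b1)
   = (det3 a1 a2 a3 b1 b2 b3 c1 c2 c3)\<^sup>2"
  by (simp add: det3_def algebra_simps power2_eq_square power3_eq_cube)

lemma det3_mult:
  "det3 (a1 * x1 + a2 * y1 + a3 * z1) (a1 * x2 + a2 * y2 + a3 * z2) (a1 * x3 + a2 * y3 + a3 * z3)
        (b1 * x1 + b2 * y1 + b3 * z1) (b1 * x2 + b2 * y2 + b3 * z2) (b1 * x3 + b2 * y3 + b3 * z3)
        (c1 * x1 + c2 * y1 + c3 * z1) (c1 * x2 + c2 * y2 + c3 * z2) (c1 * x3 + c2 * y3 + c3 * z3)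
   = det3 a1 a2 a3 b1 b2 b3 c1 c2 c3 * det3 x1 x2 x3 y1 y2 y3 z1 z2 z3"
  by (simp add: det3_def algebra_simps power2_eq_square power3_eq_cube)

lemma det3_scale:
  "det3 (k * a1) (k * a2) (k * a3) (k * b1) (k * b2) (k * b3) (k * c1) (k * c2) (k * c3)
   = k ^ 3 * det3 a1 a2 a3 b1 b2 b3 c1 c2 c3"
  by (simp add: det3_def algebra_simps power2_eq_square power3_eq_cube)

lemma det3_cong:
  assumes "[a1 = x1] (mod q)" "[a2 = x2] (mod q)" "[a3 = x3] (mod q)"
    "[b1 = y1] (mod q)" "[b2 = y2] (mod q)" "[b3 = y3] (mod q)"
    "[c1 = z1] (mod q)" "[c2 = z2] (mod q)" "[c3 = z3] (mod q)"
  shows "[det3 a1 a2 a3 b1 b2 b3 c1 c2 c3 = det3 x1 x2 x3 y1 y2 y3 z1 z2 z3] (mod q)"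
  unfolding det3_def by (intro cong_add cong_diff cong_mult assms)

section \<open>Square classes of norms under an automorphism\<close>

context heisenberg_coords
begin

lemma cong_double: "[2 * x = 2 * y] (mod q) \<longleftrightarrow> [x = y] (mod q)"
  using cong_0_double[of "x - y"] by (simp add: cong_diff_iff_cong_0 right_diff_distrib)

lemma automorphism_hom:
  assumes "f \<in> auto G"
  shows "group_hom G G f" "bij_betw f (carrier G) (carrier G)"
  using assms by (auto simp: auto_def Bij_def group_hom_def group_hom_axioms_def is_group)

lemma line_eq_imp_eq:
  assumes fr: "orth_frame q r u" and ij: "i \<in> {1..r}" "j \<in> {1..r}" "line (u i) = line (u j)"
  shows "i = j"
proof (rule ccontr)
  assume "i \<noteq> j"
  have "E (scl 1 (u i)) (scl 0 (u i)) (scl 0 (u i)) 0 0 0 \<in> line (u j)"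
    using E_in_line ij(3) by metis
  then obtain k where k: "veq q r (u i) (scl k (u j))" unfolding E_in_line_iff by (auto simp: scl_simps)
  have "[dot r (u i) (u i) = k * dot r (u i) (u j)] (mod q)"
    using dot_cong[OF veq_refl[of q r "u i"] k] by simp
  also have "[k * dot r (u i) (u j) = k * 0] (mod q)"
    using fr ij \<open>i \<noteq> j\<close> by (intro cong_mult cong_refl) (auto simp: orth_family_def)
  finally show False using fr ij by (auto simp: orth_family_def)
qed

text \<open>The multiplier \<open>\<kappa>\<close> is the determinant of the action on the derived subgroup. On each line \<open>f\<close> acts
  through some $g \in GL_3$, and the induced action on the derived subgroup is a multiple of the cofactor
  matrix of \<open>g\<close>, whose determinant is a square.\<close>

lemma automorphism_square_classes:
  assumes f: "f \<in> auto G" and fr: "orth_frame q r u" and fr': "orth_frame q r u'"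
    and dec: "dec_act (frame_dec u) f = frame_dec u'"
  obtains \<sigma> \<kappa> t where "bij_betw \<sigma> {1..r} {1..r}" "\<not> [\<kappa> = 0] (mod q)"
    "\<And>i. i \<in> {1..r} \<Longrightarrow> [(t i)\<^sup>2 * dot r (u' (\<sigma> i)) (u' (\<sigma> i)) = \<kappa> * dot r (u i) (u i)] (mod q)"
    "(\<forall>g\<in>derived G (carrier G). f g = g) \<longrightarrow> [\<kappa> = 1] (mod q)"
proof -
  interpret f: group_hom G G f using automorphism_hom(1)[OF f] .
  have inj: "inj_on f (carrier G)" and surj: "f ` carrier G = carrier G"
    using automorphism_hom(2)[OF f] by (auto simp: bij_betw_def)
  have "\<forall>i\<in>{1..r}. \<exists>j\<in>{1..r}. f ` line (u i) = line (u' j)"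
  proof
    fix i assume "i \<in> {1..r}"
    then have "f ` line (u i) \<in> dec_act (frame_dec u) f" unfolding dec_act_def frame_dec_def by blast
    then have "f ` line (u i) \<in> frame_dec u'" unfolding dec .
    then show "\<exists>j\<in>{1..r}. f ` line (u i) = line (u' j)" unfolding frame_dec_def by blast
  qed
  then obtain \<sigma> where \<sigma>: "\<And>i. i \<in> {1..r} \<Longrightarrow> \<sigma> i \<in> {1..r}" "\<And>i. i \<in> {1..r} \<Longrightarrow> f ` line (u i) = line (u' (\<sigma> i))"
    by metis
  have "inj_on \<sigma> {1..r}"
  proof (rule inj_onI)
    fix i j assume ij: "i \<in> {1..r}" "j \<in> {1..r}" "\<sigma> i = \<sigma> j"
    then have "f ` line (u i) = f ` line (u j)" using \<sigma>(2) by simp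
    then have "line (u i) = line (u j)" using inj_on_image_eq_iff[OF inj] line_in_carrier by blast
    then show "i = j" using line_eq_imp_eq[OF fr] ij by blast
  qed
  moreover have "\<sigma> ` {1..r} \<subseteq> {1..r}" using \<sigma>(1) by blast
  ultimately have bij: "bij_betw \<sigma> {1..r} {1..r}"
    by (simp add: bij_betw_def endo_inj_surj)
  have E_f: "\<exists>a b c s t w. f (E a' b' c' s' t' w') = E a b c s t w" for a' b' c' s' t' w'
    by (intro E_surj f.hom_closed E_closed)
  \<comment> \<open>The nine central coordinates of these three images form the matrix of
    \<open>f\<close> on the derived subgroup.\<close>
  obtain a1 b1 c1 x1 x2 x3 where X: "f (E 0 0 0 1 0 0) = E a1 b1 c1 x1 x2 x3" using E_f by blast
  obtain a2 b2 c2 y1 y2 y3 where Y: "f (E 0 0 0 0 1 0) = E a2 b2 c2 y1 y2 y3" using E_f by blast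
  obtain a3 b3 c3 z1 z2 z3 where Z: "f (E 0 0 0 0 0 1) = E a3 b3 c3 z1 z2 z3" using E_f by blast
  define \<kappa> where "\<kappa> = det3 x1 x2 x3 y1 y2 y3 z1 z2 z3"
  have pow: "f (E 0 0 0 k 0 0) = E (scl k a1) (scl k b1) (scl k c1) (k * x1) (k * x2) (k * x3)"
    "f (E 0 0 0 0 k 0) = E (scl k a2) (scl k b2) (scl k c2) (k * y1) (k * y2) (k * y3)"
    "f (E 0 0 0 0 0 k) = E (scl k a3) (scl k b3) (scl k c3) (k * z1) (k * z2) (k * z3)" for k
    using f.hom_int_pow[OF E_closed, of 0 0 0 1 0 0 k] f.hom_int_pow[OF E_closed, of 0 0 0 0 1 0 k]
      f.hom_int_pow[OF E_closed, of 0 0 0 0 0 1 k]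
    unfolding X Y Z E_int_pow by (simp_all add: scl_simps)
  \<comment> \<open>\<open>f\<close> is injective and so reflects commuting: an element with central
    image is central.\<close>
  have central: "\<exists>s t w. h = E 0 0 0 s t w" if h: "h \<in> carrier G" "f h = E 0 0 0 s' t' w'" for h s' t' w'
  proof -
    obtain a b c s t w where E: "h = E a b c s t w" using E_surj h by blast
    have "h \<otimes> g = g \<otimes> h" if g: "g \<in> carrier G" for g
    proof -
      obtain a' b' c' s'' t'' w'' where g': "f g = E a' b' c' s'' t'' w''" using E_surj f.hom_closed[OF g] by blast
      have "f h \<otimes> f g = f g \<otimes> f h" unfolding h(2) g' E_commute_iff by simp
      then have "f (h \<otimes> g) = f (g \<otimes> h)" using h g by simp
      then show ?thesis by (rule inj_onD[OF inj]) (simp_all add: h g)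
    qed
    from E_central[OF this[unfolded E]] have "h = E 0 0 0 s t w" unfolding E E_eq_iff by simp
    then show ?thesis by blast
  qed
  \<comment> \<open>Together with \<open>central\<close>, surjectivity of \<open>f\<close> says that
    its matrix acts surjectively on row vectors.\<close>
  have inv_ex: "\<exists>s t w. [s * x1 + t * y1 + w * z1 = s'] (mod q) \<and> [s * x2 + t * y2 + w * z2 = t'] (mod q) \<and>
      [s * x3 + t * y3 + w * z3 = w'] (mod q)" for s' t' w'
  proof -
    obtain h where h: "h \<in> carrier G" "f h = E 0 0 0 s' t' w'" using surj E_closed[of 0 0 0 s' t' w'] by (metis imageE)
    then obtain s t w where "h = E 0 0 0 s t w" using central by blast
    then have "h = E 0 0 0 s 0 0 \<otimes> E 0 0 0 0 t 0 \<otimes> E 0 0 0 0 0 w" by (simp add: E_mult)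
    then have fh: "E 0 0 0 s' t' w' = f (E 0 0 0 s 0 0) \<otimes> f (E 0 0 0 0 t 0) \<otimes> f (E 0 0 0 0 0 w)"
      using h by simp
    have centr: "veq q r (scl k a1) 0 \<and> veq q r (scl k b1) 0 \<and> veq q r (scl k c1) 0"
      "veq q r (scl k a2) 0 \<and> veq q r (scl k b2) 0 \<and> veq q r (scl k c2) 0" for k
    proof -
      have *: "f (E 0 0 0 k l 0) \<otimes> g = g \<otimes> f (E 0 0 0 k l 0)" if "g \<in> carrier G" for k l g
      proof -
        have "g \<in> f ` carrier G" unfolding surj by (rule that)
        then obtain g' where g': "g' \<in> carrier G" "g = f g'" by (auto elim: imageE)
        obtain a b c s t w where "g' = E a b c s t w" using E_surj g' by blast
        then have "E 0 0 0 k l 0 \<otimes> g' = g' \<otimes> E 0 0 0 k l 0" by (simp add: E_commute_iff)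
        then have "f (E 0 0 0 k l 0 \<otimes> g') = f (g' \<otimes> E 0 0 0 k l 0)" by (rule arg_cong)
        then show ?thesis unfolding g'(2) f.hom_mult[OF E_closed g'(1)] f.hom_mult[OF g'(1) E_closed] .
      qed
      show "veq q r (scl k a1) 0 \<and> veq q r (scl k b1) 0 \<and> veq q r (scl k c1) 0"
        using E_central[OF *[of _ k 0, unfolded pow(1)]] by blast
      show "veq q r (scl k a2) 0 \<and> veq q r (scl k b2) 0 \<and> veq q r (scl k c2) 0"
        using E_central[OF *[of _ 0 k, unfolded pow(2)]] by blast
    qed
    have p1: "f (E 0 0 0 s 0 0) = E 0 0 0 (s * x1) (s * x2) (s * x3)"
      unfolding pow E_eq_iff using centr(1)[of s] by simp
    have p2: "f (E 0 0 0 0 t 0) = E 0 0 0 (t * y1) (t * y2) (t * y3)"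
      unfolding pow E_eq_iff using centr(2)[of t] by simp
    show ?thesis
      using fh unfolding p1 p2 pow(3) E_mult E_eq_iff by (intro exI[of _ s] exI[of _ t] exI[of _ w]) (simp add: cong_sym)
  qed
  \<comment> \<open>Solving \<open>inv_ex\<close> for the three unit vectors gives the rows of a
    left inverse, so the determinant is a unit.\<close>
  have \<kappa>0: "\<not> [\<kappa> = 0] (mod q)"
  proof
    assume 0: "[\<kappa> = 0] (mod q)"
    obtain s1 t1 w1 where 1: "[s1 * x1 + t1 * y1 + w1 * z1 = 1] (mod q)" "[s1 * x2 + t1 * y2 + w1 * z2 = 0] (mod q)"
      "[s1 * x3 + t1 * y3 + w1 * z3 = 0] (mod q)" using inv_ex by blast
    obtain s2 t2 w2 where 2: "[s2 * x1 + t2 * y1 + w2 * z1 = 0] (mod q)" "[s2 * x2 + t2 * y2 + w2 * z2 = 1] (mod q)"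
      "[s2 * x3 + t2 * y3 + w2 * z3 = 0] (mod q)" using inv_ex by blast
    obtain s3 t3 w3 where 3: "[s3 * x1 + t3 * y1 + w3 * z1 = 0] (mod q)" "[s3 * x2 + t3 * y2 + w3 * z2 = 0] (mod q)"
      "[s3 * x3 + t3 * y3 + w3 * z3 = 1] (mod q)" using inv_ex by blast
    have "[det3 s1 t1 w1 s2 t2 w2 s3 t3 w3 * \<kappa> = det3 1 0 0 0 1 0 0 0 1] (mod q)"
      unfolding \<kappa>_def det3_mult[symmetric] by (rule det3_cong[OF 1 2 3])
    then have "[1 = det3 s1 t1 w1 s2 t2 w2 s3 t3 w3 * \<kappa>] (mod q)" by (simp add: det3_def cong_sym)
    also have "[det3 s1 t1 w1 s2 t2 w2 s3 t3 w3 * \<kappa> = det3 s1 t1 w1 s2 t2 w2 s3 t3 w3 * 0] (mod q)"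
      by (intro cong_mult cong_refl 0)
    finally show False using not_cong_1_0 by simp
  qed
  have "\<forall>i\<in>{1..r}. \<exists>t. [t\<^sup>2 * dot r (u' (\<sigma> i)) (u' (\<sigma> i)) = \<kappa> * dot r (u i) (u i)] (mod q)"
  proof
    fix i assume i: "i \<in> {1..r}"
    let ?u = "u i" and ?v = "u' (\<sigma> i)"
    define c where "c = dot r ?u ?u"
    define d where "d = dot r ?v ?v"
    have c0: "\<not> [c = 0] (mod q)" using fr i unfolding c_def orth_family_def by blast
    have img: "\<exists>g1 g2 g3 s t w. f (E (scl k1 ?u) (scl k2 ?u) (scl k3 ?u) 0 0 0) = E (scl g1 ?v) (scl g2 ?v) (scl g3 ?v) s t w"
      for k1 k2 k3
    proof -
      have "f (E (scl k1 ?u) (scl k2 ?u) (scl k3 ?u) 0 0 0) \<in> line ?v"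
        using \<sigma>(2)[OF i] E_in_line by blast
      then show ?thesis unfolding line_def by blast
    qed
    \<comment> \<open>The rows p, l, m form the matrix g through which \<open>f\<close> acts on V_0
      between the two lines.\<close>
    obtain p1 p2 p3 s1 t1 w1 where p: "f (E ?u 0 0 0 0 0) = E (scl p1 ?v) (scl p2 ?v) (scl p3 ?v) s1 t1 w1"
      using img[of 1 0 0] by (auto simp: scl_simps)
    obtain l1 l2 l3 s2 t2 w2 where l: "f (E 0 ?u 0 0 0 0) = E (scl l1 ?v) (scl l2 ?v) (scl l3 ?v) s2 t2 w2"
      using img[of 0 1 0] by (auto simp: scl_simps)
    obtain m1 m2 m3 s3 t3 w3 where m: "f (E 0 0 ?u 0 0 0) = E (scl m1 ?v) (scl m2 ?v) (scl m3 ?v) s3 t3 w3"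
      using img[of 0 0 1] by (auto simp: scl_simps)
    have comm: "f (inv g \<otimes> inv h \<otimes> g \<otimes> h) = inv f g \<otimes> inv f h \<otimes> f g \<otimes> f h"
      if "g \<in> carrier G" "h \<in> carrier G" for g h using that by simp
    have wedge_v: "wedge r (scl i1 ?v) (scl i2 ?v) (scl j1 ?v) (scl j2 ?v) = d * (i1 * j2 - i2 * j1)" for i1 i2 j1 j2
      by (simp add: wedge_def d_def algebra_simps)
    \<comment> \<open>The commutator of y \<otimes> u_i and z \<otimes> u_i is 2c times the first
      central basis element; its image under \<open>f\<close> is 2d times the cross product of the
      rows l and m.\<close>
    have 1: "[c * x1 = d * (l2 * m3 - l3 * m2)] (mod q)" "[c * x2 = d * (l3 * m1 - l1 * m3)] (mod q)"
      "[c * x3 = d * (l1 * m2 - l2 * m1)] (mod q)"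
    proof -
      have "f (E 0 0 0 (2 * c) 0 0) = E 0 0 0 (2 * (d * (l2 * m3 - l3 * m2))) (2 * (d * (l3 * m1 - l1 * m3)))
          (2 * (d * (l1 * m2 - l2 * m1)))"
        using comm[of "E 0 ?u 0 0 0 0" "E 0 0 ?u 0 0 0"]
        unfolding l m E_comm(1) wedge_v by (simp add: wedge_def c_def)
      then show "[c * x1 = d * (l2 * m3 - l3 * m2)] (mod q)" "[c * x2 = d * (l3 * m1 - l1 * m3)] (mod q)"
        "[c * x3 = d * (l1 * m2 - l2 * m1)] (mod q)"
        unfolding pow E_eq_iff mult.assoc cong_double by blast+
    qed
    have 2: "[c * y1 = d * (m2 * p3 - m3 * p2)] (mod q)" "[c * y2 = d * (m3 * p1 - m1 * p3)] (mod q)"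
      "[c * y3 = d * (m1 * p2 - m2 * p1)] (mod q)"
    proof -
      have "f (E 0 0 0 0 (2 * c) 0) = E 0 0 0 (2 * (d * (m2 * p3 - m3 * p2))) (2 * (d * (m3 * p1 - m1 * p3)))
          (2 * (d * (m1 * p2 - m2 * p1)))"
        using comm[of "E 0 0 ?u 0 0 0" "E ?u 0 0 0 0 0"]
        unfolding p m E_comm(1) wedge_v by (simp add: wedge_def c_def)
      then show "[c * y1 = d * (m2 * p3 - m3 * p2)] (mod q)" "[c * y2 = d * (m3 * p1 - m1 * p3)] (mod q)"
        "[c * y3 = d * (m1 * p2 - m2 * p1)] (mod q)"
        unfolding pow E_eq_iff mult.assoc cong_double by blast+
    qed
    have 3: "[c * z1 = d * (p2 * l3 - p3 * l2)] (mod q)" "[c * z2 = d * (p3 * l1 - p1 * l3)] (mod q)"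
      "[c * z3 = d * (p1 * l2 - p2 * l1)] (mod q)"
    proof -
      have "f (E 0 0 0 0 0 (2 * c)) = E 0 0 0 (2 * (d * (p2 * l3 - p3 * l2))) (2 * (d * (p3 * l1 - p1 * l3)))
          (2 * (d * (p1 * l2 - p2 * l1)))"
        using comm[of "E ?u 0 0 0 0 0" "E 0 ?u 0 0 0 0"]
        unfolding p l E_comm(1) wedge_v by (simp add: wedge_def c_def)
      then show "[c * z1 = d * (p2 * l3 - p3 * l2)] (mod q)" "[c * z2 = d * (p3 * l1 - p1 * l3)] (mod q)"
        "[c * z3 = d * (p1 * l2 - p2 * l1)] (mod q)"
        unfolding pow E_eq_iff mult.assoc cong_double by blast+
    qed
    define D where "D = det3 p1 p2 p3 l1 l2 l3 m1 m2 m3"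
    \<comment> \<open>Together, c times the matrix of \<open>f\<close> on the derived subgroup is d
      times the cofactor matrix of g. Dividing the determinants by c^2 gives \<kappa> c = (d D /
      c)^2 d, so the witness is e d D with \<open>e\<close> the inverse of \<open>c\<close>.\<close>
    have "[c ^ 3 * \<kappa> = d ^ 3 * D\<^sup>2] (mod q)"
      using det3_cong[OF 1 2 3] unfolding det3_scale det3_cofactor \<kappa>_def D_def .
    moreover obtain e where e: "[e * c = 1] (mod q)" using cong_inverse[OF prime_q c0] by blast
    ultimately have "[e\<^sup>2 * (d ^ 3 * D\<^sup>2) = e\<^sup>2 * (c ^ 3 * \<kappa>)] (mod q)"
      by (intro cong_mult[OF cong_refl]) (rule cong_sym)
    also have "e\<^sup>2 * (c ^ 3 * \<kappa>) = (e * c)\<^sup>2 * (\<kappa> * c)" by (simp add: power2_eq_square power3_eq_cube)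
    also have "[(e * c)\<^sup>2 * (\<kappa> * c) = 1\<^sup>2 * (\<kappa> * c)] (mod q)" by (intro cong_mult cong_refl cong_pow e)
    also have "e\<^sup>2 * (d ^ 3 * D\<^sup>2) = (e * d * D)\<^sup>2 * d" by (simp add: power2_eq_square power3_eq_cube)
    finally show "\<exists>t. [t\<^sup>2 * dot r ?v ?v = \<kappa> * dot r ?u ?u] (mod q)" unfolding c_def d_def by auto
  qed
  then obtain t where t: "\<And>i. i \<in> {1..r} \<Longrightarrow> [(t i)\<^sup>2 * dot r (u' (\<sigma> i)) (u' (\<sigma> i)) = \<kappa> * dot r (u i) (u i)] (mod q)"
    by metis
  show ?thesis
  proof (rule that[OF bij \<kappa>0 t], assumption, rule impI)
    assume fix_D: "\<forall>g\<in>derived G (carrier G). f g = g"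
    have "f (E 0 0 0 (2 * 1) 0 0) = E 0 0 0 (2 * 1) (2 * 0) (2 * 0)"
      using fix_D[rule_format, OF central_in_derived[of 1 0 0]] by simp
    then have 1: "[x1 = 1] (mod q)" "[x2 = 0] (mod q)" "[x3 = 0] (mod q)"
      unfolding pow E_eq_iff mult.assoc cong_double by simp_all
    have "f (E 0 0 0 0 (2 * 1) 0) = E 0 0 0 (2 * 0) (2 * 1) (2 * 0)"
      using fix_D[rule_format, OF central_in_derived[of 0 1 0]] by simp
    then have 2: "[y1 = 0] (mod q)" "[y2 = 1] (mod q)" "[y3 = 0] (mod q)"
      unfolding pow E_eq_iff mult.assoc cong_double by simp_all
    have "f (E 0 0 0 0 0 (2 * 1)) = E 0 0 0 (2 * 0) (2 * 0) (2 * 1)"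
      using fix_D[rule_format, OF central_in_derived[of 0 0 1]] by simp
    then have 3: "[z1 = 0] (mod q)" "[z2 = 0] (mod q)" "[z3 = 1] (mod q)"
      unfolding pow E_eq_iff mult.assoc cong_double by simp_all
    show "[\<kappa> = 1] (mod q)" using det3_cong[OF 1 2 3] unfolding \<kappa>_def by (simp add: det3_def)
  qed
qed

end

lemma bij_betw_matching:
  assumes "finite I" "A \<subseteq> I" "A' \<subseteq> I" "card A = card A'"
  obtains \<sigma> where "bij_betw \<sigma> I I" "\<And>i. i \<in> I \<Longrightarrow> i \<in> A \<longleftrightarrow> \<sigma> i \<in> A'"
proof -
  have fin: "finite A" "finite A'" using assms finite_subset by blast+
  obtain g where g: "bij_betw g A A'" using finite_same_card_bij[OF fin assms(4)] by blast
  have "card (I - A) = card (I - A')" using assms fin by (simp add: card_Diff_subset)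
  then obtain h where h: "bij_betw h (I - A) (I - A')"
    using finite_same_card_bij assms(1) by (metis finite_Diff)
  define \<sigma> where "\<sigma> i = (if i \<in> A then g i else h i)" for i
  have 1: "bij_betw \<sigma> A A'" using g by (simp add: \<sigma>_def cong: bij_betw_cong)
  have 2: "bij_betw \<sigma> (I - A) (I - A')"
    using h by (subst bij_betw_cong[of _ \<sigma> h]) (simp_all add: \<sigma>_def)
  have "bij_betw \<sigma> (A \<union> (I - A)) (A' \<union> (I - A'))" by (rule bij_betw_combine[OF 1 2]) blast
  then have "bij_betw \<sigma> I I" using assms(2,3) by (simp add: Un_absorb1)
  moreover have "i \<in> A \<longleftrightarrow> \<sigma> i \<in> A'" if "i \<in> I" for i
    using that 1 2 bij_betwE by blast
  ultimately show ?thesis using that by blast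
qed

section \<open>Orbits of frames and the number of non-square norms\<close>

context heisenberg_coords
begin

lemma nonsq_bound: "nonsq q r u \<subseteq> {1..r}" "card (nonsq q r u) \<le> r"
proof -
  show "nonsq q r u \<subseteq> {1..r}" by (auto simp: nonsq_def)
  from card_mono[OF _ this] show "card (nonsq q r u) \<le> r" by simp
qed

lemma QuadRes_1: "QuadRes q 1"
  using QuadRes_square[of q 1] by simp

text \<open>\<open>A\<close> collects the indices where \<kappa> times the norm is a non-square. A
  permutation matching \<open>A\<close> with the non-squares of \<open>u'\<close> makes the norms
  agree up to \<kappa> and squares.\<close>

lemma automorphism_of_nonsq_cards:
  assumes \<kappa>: "\<not> [\<kappa> = 0] (mod q)" and fr: "orth_frame q r u" and fr': "orth_frame q r u'"
    and card: "card (nonsq q r u') = (if QuadRes q \<kappa> then card (nonsq q r u) else r - card (nonsq q r u))"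
  obtains f where "f \<in> auto G" "dec_act (frame_dec u) f = frame_dec u'"
    "\<And>s t w. f (E 0 0 0 s t w) = E 0 0 0 (\<kappa> * s) (\<kappa> * t) (\<kappa> * w)"
proof -
  define A where "A = (if QuadRes q \<kappa> then nonsq q r u else {1..r} - nonsq q r u)"
  have "A \<subseteq> {1..r}" using nonsq_bound by (auto simp: A_def)
  moreover have "card A = card (nonsq q r u')"
    using card nonsq_bound(1)[of u] by (simp add: A_def card_Diff_subset finite_subset[OF nonsq_bound(1)])
  ultimately obtain \<sigma> where \<sigma>: "bij_betw \<sigma> {1..r} {1..r}"
    "\<And>i. i \<in> {1..r} \<Longrightarrow> i \<in> A \<longleftrightarrow> \<sigma> i \<in> nonsq q r u'"
    using bij_betw_matching[of "{1..r}" A "nonsq q r u'"] nonsq_bound(1) by blast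
  have "\<exists>t. [t\<^sup>2 * dot r (u' (\<sigma> i)) (u' (\<sigma> i)) = \<kappa> * dot r (u i) (u i)] (mod q)" if i: "i \<in> {1..r}" for i
  proof -
    have \<sigma>i: "\<sigma> i \<in> {1..r}" using \<sigma>(1) i bij_betwE by blast
    have c: "\<not> [dot r (u i) (u i) = 0] (mod q)" "\<not> [dot r (u' (\<sigma> i)) (u' (\<sigma> i)) = 0] (mod q)"
      using fr fr' i \<sigma>i unfolding orth_family_def by blast+
    have \<kappa>c: "\<not> [\<kappa> * dot r (u i) (u i) = 0] (mod q)" using \<kappa> c by (simp add: cong_0_mult_iff[OF prime_q])
    have "QuadRes q (\<kappa> * dot r (u i) (u i)) \<longleftrightarrow> i \<notin> A"
      using QuadRes_mult_iff[OF prime_q odd_q \<kappa> c(1)] i by (auto simp: A_def nonsq_def)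
    also have "\<dots> \<longleftrightarrow> QuadRes q (dot r (u' (\<sigma> i)) (u' (\<sigma> i)))"
      using \<sigma>(2)[OF i] \<sigma>i by (auto simp: nonsq_def)
    finally have "QuadRes q (\<kappa> * dot r (u i) (u i)) \<longleftrightarrow> QuadRes q (dot r (u' (\<sigma> i)) (u' (\<sigma> i)))" .
    then obtain t where "[t\<^sup>2 * dot r (u' (\<sigma> i)) (u' (\<sigma> i)) = \<kappa> * dot r (u i) (u i)] (mod q)"
      by (rule QuadRes_quotient[OF prime_q odd_q \<kappa>c c(2)])
    then show ?thesis ..
  qed
  then obtain t where t: "\<And>i. i \<in> {1..r} \<Longrightarrow> [(t i)\<^sup>2 * dot r (u' (\<sigma> i)) (u' (\<sigma> i)) = \<kappa> * dot r (u i) (u i)] (mod q)"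
    by metis
  show ?thesis
    by (rule automorphism_of_square_classes[OF fr fr' \<sigma>(1) \<kappa> t]) (assumption | rule that)+
qed

text \<open>A square \<kappa> preserves the square class of every norm, a non-square one reverses
  it; in both cases the permutation \<sigma> transports the count.\<close>

lemma automorphism_nonsq:
  assumes f: "f \<in> auto G" and fr: "orth_frame q r u" and fr': "orth_frame q r u'"
    and dec: "dec_act (frame_dec u) f = frame_dec u'"
  shows "card (nonsq q r u') = card (nonsq q r u) \<or> card (nonsq q r u') = r - card (nonsq q r u)"
    "(\<And>g. g \<in> derived G (carrier G) \<Longrightarrow> f g = g) \<Longrightarrow> card (nonsq q r u') = card (nonsq q r u)"
proof -
  obtain \<sigma> \<kappa> t where \<sigma>: "bij_betw \<sigma> {1..r} {1..r}" "\<not> [\<kappa> = 0] (mod q)"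
    "\<And>i. i \<in> {1..r} \<Longrightarrow> [(t i)\<^sup>2 * dot r (u' (\<sigma> i)) (u' (\<sigma> i)) = \<kappa> * dot r (u i) (u i)] (mod q)"
    "(\<forall>g\<in>derived G (carrier G). f g = g) \<longrightarrow> [\<kappa> = 1] (mod q)"
    by (rule automorphism_square_classes[OF f fr fr' dec]) (assumption | rule that)+
  have sqclass: "QuadRes q (dot r (u' (\<sigma> i)) (u' (\<sigma> i))) \<longleftrightarrow> (QuadRes q \<kappa> \<longleftrightarrow> QuadRes q (dot r (u i) (u i)))"
    if i: "i \<in> {1..r}" for i
  proof -
    have \<sigma>i: "\<sigma> i \<in> {1..r}" using \<sigma>(1) i bij_betwE by blast
    have c: "\<not> [dot r (u i) (u i) = 0] (mod q)" "\<not> [dot r (u' (\<sigma> i)) (u' (\<sigma> i)) = 0] (mod q)"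
      using fr fr' i \<sigma>i unfolding orth_family_def by blast+
    have "\<not> [(t i)\<^sup>2 = 0] (mod q)"
    proof
      assume 0: "[(t i)\<^sup>2 = 0] (mod q)"
      have "[(t i)\<^sup>2 * dot r (u' (\<sigma> i)) (u' (\<sigma> i)) = 0 * dot r (u' (\<sigma> i)) (u' (\<sigma> i))] (mod q)"
        by (intro cong_mult[OF 0] cong_refl)
      then have "[\<kappa> * dot r (u i) (u i) = 0] (mod q)" using \<sigma>(3)[OF i] cong_sym cong_trans by (metis mult_zero_left)
      then show False using \<sigma>(2) c(1) by (simp add: cong_0_mult_iff[OF prime_q])
    qed
    then have "QuadRes q ((t i)\<^sup>2 * dot r (u' (\<sigma> i)) (u' (\<sigma> i))) \<longleftrightarrow> QuadRes q (dot r (u' (\<sigma> i)) (u' (\<sigma> i)))"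
      using QuadRes_mult_iff[OF prime_q odd_q _ c(2)] QuadRes_square by blast
    then show ?thesis
      unfolding QuadRes_cong[OF \<sigma>(3)[OF i]] QuadRes_mult_iff[OF prime_q odd_q \<sigma>(2) c(1)] by (rule sym)
  qed
  have image: "\<sigma> ` {i \<in> {1..r}. \<sigma> i \<in> nonsq q r u'} = nonsq q r u'"
  proof
    show "nonsq q r u' \<subseteq> \<sigma> ` {i \<in> {1..r}. \<sigma> i \<in> nonsq q r u'}"
    proof
      fix j assume j: "j \<in> nonsq q r u'"
      then have "j \<in> \<sigma> ` {1..r}" using nonsq_bound(1)[of u'] \<sigma>(1) unfolding bij_betw_def by blast
      then show "j \<in> \<sigma> ` {i \<in> {1..r}. \<sigma> i \<in> nonsq q r u'}" using j by blast
    qed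
  qed blast
  have inj: "inj_on \<sigma> {i \<in> {1..r}. \<sigma> i \<in> nonsq q r u'}"
    using \<sigma>(1) unfolding bij_betw_def inj_on_def by blast
  have "card (nonsq q r u') = card {i \<in> {1..r}. \<sigma> i \<in> nonsq q r u'}"
    using card_image[OF inj] image by simp
  also have "{i \<in> {1..r}. \<sigma> i \<in> nonsq q r u'} = (if QuadRes q \<kappa> then nonsq q r u else {1..r} - nonsq q r u)"
    using sqclass bij_betwE[OF \<sigma>(1)] by (auto simp: nonsq_def)
  finally have card: "card (nonsq q r u') = card (if QuadRes q \<kappa> then nonsq q r u else {1..r} - nonsq q r u)" .
  then show "card (nonsq q r u') = card (nonsq q r u) \<or> card (nonsq q r u') = r - card (nonsq q r u)"
    using nonsq_bound(1)[of u] by (auto simp: card_Diff_subset finite_subset[OF nonsq_bound(1)])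
  assume "\<And>g. g \<in> derived G (carrier G) \<Longrightarrow> f g = g"
  then have "QuadRes q \<kappa>" using \<sigma>(4) QuadRes_1 QuadRes_cong by blast
  then show "card (nonsq q r u') = card (nonsq q r u)" using card by simp
qed

lemma centralizing_orbit_iff:
  assumes "orth_frame q r u" "orth_frame q r u'"
  shows "(\<exists>f\<in>aut_centralizing_derived G. dec_act (frame_dec u) f = frame_dec u') \<longleftrightarrow>
    card (nonsq q r u') = card (nonsq q r u)"
proof
  assume "\<exists>f\<in>aut_centralizing_derived G. dec_act (frame_dec u) f = frame_dec u'"
  then show "card (nonsq q r u') = card (nonsq q r u)"
    using automorphism_nonsq(2)[OF _ assms] unfolding aut_centralizing_derived_def by blast
next
  assume "card (nonsq q r u') = card (nonsq q r u)"
  then have card: "card (nonsq q r u') = (if QuadRes q 1 then card (nonsq q r u) else r - card (nonsq q r u))"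
    using QuadRes_1 by simp
  obtain f where f: "f \<in> auto G" "dec_act (frame_dec u) f = frame_dec u'"
    "\<And>s t w. f (E 0 0 0 s t w) = E 0 0 0 (1 * s) (1 * t) (1 * w)"
    by (rule automorphism_of_nonsq_cards[OF not_cong_1_0 assms card]) (assumption | rule that)+
  then have "f \<in> aut_centralizing_derived G"
    using derived_subset by (auto simp: aut_centralizing_derived_def)
  then show "\<exists>f\<in>aut_centralizing_derived G. dec_act (frame_dec u) f = frame_dec u'" using f(2) by blast
qed

lemma automorphism_orbit_iff:
  assumes \<omega>: "\<not> QuadRes q \<omega>" and fr: "orth_frame q r u" "orth_frame q r u'"
  shows "(\<exists>f\<in>auto G. dec_act (frame_dec u) f = frame_dec u') \<longleftrightarrow>
    card (nonsq q r u') = card (nonsq q r u) \<or> card (nonsq q r u') = r - card (nonsq q r u)"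
proof
  assume "\<exists>f\<in>auto G. dec_act (frame_dec u) f = frame_dec u'"
  then show "card (nonsq q r u') = card (nonsq q r u) \<or> card (nonsq q r u') = r - card (nonsq q r u)"
    using automorphism_nonsq(1)[OF _ fr] by blast
next
  \<comment> \<open>Zero counts as a square for \<open>QuadRes\<close>, so a non-square is a
    unit.\<close>
  have \<omega>0: "\<not> [\<omega> = 0] (mod q)"
    using \<omega> QuadRes_cong[of \<omega> 0 q] QuadRes_square[of q 0] by auto
  assume "card (nonsq q r u') = card (nonsq q r u) \<or> card (nonsq q r u') = r - card (nonsq q r u)"
  then show "\<exists>f\<in>auto G. dec_act (frame_dec u) f = frame_dec u'"
  proof
    assume "card (nonsq q r u') = card (nonsq q r u)"
    then show ?thesis using centralizing_orbit_iff[OF fr] by (auto simp: aut_centralizing_derived_def)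
  next
    assume "card (nonsq q r u') = r - card (nonsq q r u)"
    \<comment> \<open>Here \<open>\<omega>\<close> itself is the factor of the similitude.\<close>
    then have card: "card (nonsq q r u') = (if QuadRes q \<omega> then card (nonsq q r u) else r - card (nonsq q r u))"
      using \<omega> by simp
    show ?thesis
      by (rule automorphism_of_nonsq_cards[OF \<omega>0 fr card]) blast
  qed
qed

end

section \<open>The free group of class 2\<close>

text \<open>The universal property of the free group only speaks about groups on \<open>nat\<close>, so rank-one
  coordinates are encoded there.\<close>

definition enc :: "int \<Rightarrow> int \<Rightarrow> int \<Rightarrow> int \<Rightarrow> int \<Rightarrow> int \<Rightarrow> int \<Rightarrow> nat" where
  "enc q a b c s t w = to_nat (a mod q, b mod q, c mod q, s mod q, t mod q, w mod q)"

definition enc_mult :: "int \<Rightarrow> int \<times> int \<times> int \<times> int \<times> int \<times> int \<Rightarrow> int \<times> int \<times> int \<times> int \<times> int \<times> int \<Rightarrow> nat" where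
  "enc_mult q = (\<lambda>(a, b, c, s, t, w) (a', b', c', s', t', w').
     enc q (a + a') (b + b') (c + c') (s + s' + (b * c' - c * b')) (t + t' + (c * a' - a * c'))
       (w + w' + (a * b' - b * a')))"

definition test_group :: "int \<Rightarrow> nat monoid" where
  "test_group q = \<lparr>carrier = {enc q a b c s t w | a b c s t w. True},
     monoid.mult = (\<lambda>m n. enc_mult q (from_nat m) (from_nat n)), one = enc q 0 0 0 0 0 0\<rparr>"

lemma enc_eq_iff: "enc q a b c s t w = enc q a' b' c' s' t' w' \<longleftrightarrow>
    [a = a'] (mod q) \<and> [b = b'] (mod q) \<and> [c = c'] (mod q) \<and>
    [s = s'] (mod q) \<and> [t = t'] (mod q) \<and> [w = w'] (mod q)"
  by (simp add: enc_def cong_def)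

lemma test_group_mult: "enc q a b c s t w \<otimes>\<^bsub>test_group q\<^esub> enc q a' b' c' s' t' w' =
    enc q (a + a') (b + b') (c + c') (s + s' + (b * c' - c * b')) (t + t' + (c * a' - a * c'))
       (w + w' + (a * b' - b * a'))"
proof -
  have mod: "[x mod q = x] (mod q)" for x by simp
  show ?thesis
    unfolding test_group_def enc_def[of q a] enc_def[of q a'] enc_mult_def
    by (simp only: monoid.simps from_nat_to_nat prod.case enc_eq_iff)
      (intro conjI cong_add cong_diff cong_mult mod)
qed

lemma test_group_carrier: "carrier (test_group q) = {enc q a b c s t w | a b c s t w. True}"
  by (simp add: test_group_def)

lemma group_test_group: "group (test_group q)"
proof (rule groupI)
  fix g assume "g \<in> carrier (test_group q)"
  then obtain a b c s t w where g: "g = enc q a b c s t w" unfolding test_group_carrier by blast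
  have one: "\<one>\<^bsub>test_group q\<^esub> = enc q 0 0 0 0 0 0" by (simp add: test_group_def)
  show "\<one>\<^bsub>test_group q\<^esub> \<otimes>\<^bsub>test_group q\<^esub> g = g"
    unfolding one g test_group_mult by simp
  have "enc q (-a) (-b) (-c) (-s) (-t) (-w) \<otimes>\<^bsub>test_group q\<^esub> g = \<one>\<^bsub>test_group q\<^esub>"
    unfolding one g test_group_mult by (simp add: algebra_simps)
  then show "\<exists>h\<in>carrier (test_group q). h \<otimes>\<^bsub>test_group q\<^esub> g = \<one>\<^bsub>test_group q\<^esub>"
    unfolding test_group_carrier by blast
next
  fix g h k assume "g \<in> carrier (test_group q)" "h \<in> carrier (test_group q)" "k \<in> carrier (test_group q)"
  then obtain a b c s t w a' b' c' s' t' w' a'' b'' c'' s'' t'' w'' where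
    g: "g = enc q a b c s t w" "h = enc q a' b' c' s' t' w'" "k = enc q a'' b'' c'' s'' t'' w''"
    unfolding test_group_carrier mem_Collect_eq by metis
  show "g \<otimes>\<^bsub>test_group q\<^esub> h \<otimes>\<^bsub>test_group q\<^esub> k = g \<otimes>\<^bsub>test_group q\<^esub> (h \<otimes>\<^bsub>test_group q\<^esub> k)"
    unfolding g test_group_mult by (simp add: algebra_simps)
next
  fix g h assume "g \<in> carrier (test_group q)" "h \<in> carrier (test_group q)"
  then obtain a b c s t w a' b' c' s' t' w' where
    g: "g = enc q a b c s t w" "h = enc q a' b' c' s' t' w'"
    unfolding test_group_carrier mem_Collect_eq by metis
  show "g \<otimes>\<^bsub>test_group q\<^esub> h \<in> carrier (test_group q)"
    unfolding g test_group_mult test_group_carrier by blast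
next
  show "\<one>\<^bsub>test_group q\<^esub> \<in> carrier (test_group q)" unfolding test_group_carrier by (simp add: test_group_def) blast
qed

text \<open>For r = 1 a vector amounts to its value at index 1.\<close>

lemma test_group_coords:
  assumes "Factorial_Ring.prime q" "odd q"
  shows "heisenberg_coords (test_group q) q 1 (\<lambda>a b c. enc q (a 1) (b 1) (c 1))"
proof -
  interpret group "test_group q" by (rule group_test_group)
  show ?thesis
  proof unfold_locales
    fix g assume "g \<in> carrier (test_group q)"
    then obtain a b c s t w where "g = enc q a b c s t w" unfolding test_group_carrier by blast
    then show "\<exists>a b c s t w. g = enc q (a 1) (b 1) (c 1) s t w"
      by (intro exI[of _ "\<lambda>_. a"] exI[of _ "\<lambda>_. b"] exI[of _ "\<lambda>_. c"] exI)
  next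
    show "enc q (a 1) (b 1) (c 1) s t w \<in> carrier (test_group q)" for a b c s t w
      unfolding test_group_carrier by blast
  qed (use assms in \<open>simp_all add: test_group_mult enc_eq_iff veq_def wedge_def dot_def\<close>)
qed

section \<open>Collection of powers in class 2\<close>

context group
begin

text \<open>Conjugation commutes with powers: v u v^-1 = u k gives v u^a v^-1 = u^a k^a, and
  conjugating v by u^-a then brings in the power b.\<close>

lemma int_pow_swap:
  assumes [simp]: "u \<in> carrier G" "v \<in> carrier G" "k \<in> carrier G"
    and vu: "v \<otimes> u = u \<otimes> v \<otimes> k" and k: "\<And>g. g \<in> carrier G \<Longrightarrow> k \<otimes> g = g \<otimes> k"
  shows "v [^] (b::int) \<otimes> u [^] (a::int) = u [^] a \<otimes> v [^] b \<otimes> k [^] (a * b)"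
proof -
  have conj: "g \<otimes> h [^] n \<otimes> inv g = (g \<otimes> h \<otimes> inv g) [^] n" if [simp]: "g \<in> carrier G" "h \<in> carrier G" for g h and n :: int
  proof -
    have "(\<lambda>h. g \<otimes> h \<otimes> inv g) \<in> hom G G"
      by (intro homI) (simp_all add: m_assoc inv_solve_left)
    from hom_int_pow[OF this] show ?thesis by (simp add: is_group)
  qed
  have k': "k [^] n \<otimes> g = g \<otimes> k [^] n" if [simp]: "g \<in> carrier G" for g and n :: int
  proof -
    have "g \<otimes> k \<otimes> inv g = k \<otimes> g \<otimes> inv g" using k[of g] by simp
    then have "g \<otimes> k \<otimes> inv g = k" by (simp add: m_assoc)
    then have "g \<otimes> k [^] n \<otimes> inv g = k [^] n" using conj[of g k n] by simp
    then show ?thesis by (metis \<open>g \<in> carrier G\<close> \<open>k \<in> carrier G\<close> int_pow_closed inv_solve_right' m_closed)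
  qed
  have "v \<otimes> u \<otimes> inv v = u \<otimes> k"
  proof -
    have "v \<otimes> u \<otimes> inv v = u \<otimes> (v \<otimes> k) \<otimes> inv v" by (simp add: vu m_assoc)
    also have "v \<otimes> k = k \<otimes> v" using k by simp
    finally show ?thesis by (simp add: m_assoc)
  qed
  then have "v \<otimes> u [^] a \<otimes> inv v = (u \<otimes> k) [^] a" by (simp add: conj)
  also have "\<dots> = u [^] a \<otimes> k [^] a" using k[of u] by (intro int_pow_mult_distrib) simp_all
  finally have "v \<otimes> u [^] a = u [^] a \<otimes> k [^] a \<otimes> v" by (simp add: inv_solve_right')
  also have "\<dots> = u [^] a \<otimes> (v \<otimes> k [^] a)" using k'[of v a] by (simp add: m_assoc)
  finally have vua: "v \<otimes> u [^] a = u [^] a \<otimes> (v \<otimes> k [^] a)" .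
  have "inv (u [^] a) \<otimes> v \<otimes> inv (inv (u [^] a)) = v \<otimes> k [^] a"
    by (simp add: m_assoc vua) (simp add: m_assoc[symmetric])
  then have "inv (u [^] a) \<otimes> v [^] b \<otimes> u [^] a = (v \<otimes> k [^] a) [^] b"
    using conj[of "inv (u [^] a)" v b] by simp
  also have "\<dots> = v [^] b \<otimes> (k [^] a) [^] b" using k'[of v a] by (intro int_pow_mult_distrib) simp_all
  also have "(k [^] a) [^] b = k [^] (a * b)" by (simp add: int_pow_pow)
  finally have "inv (u [^] a) \<otimes> (v [^] b \<otimes> u [^] a) = v [^] b \<otimes> k [^] (a * b)" by (simp add: m_assoc)
  then have "v [^] b \<otimes> u [^] a = u [^] a \<otimes> (v [^] b \<otimes> k [^] (a * b))"
    by (metis assms(1,2) int_pow_closed inv_closed inv_solve_left m_closed assms(3) inv_inv)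
  then show ?thesis by (simp add: m_assoc)
qed

lemma int_pow_cong:
  assumes [simp]: "x \<in> carrier G" and "x [^] (p::nat) = \<one>" and "[a = b] (mod int p)"
  shows "x [^] a = x [^] b"
proof -
  obtain k where "a - b = int p * k" using assms(3) by (auto simp: cong_iff_dvd_diff)
  then have "a = b + int p * k" by simp
  then have "x [^] a = x [^] b \<otimes> (x [^] int p) [^] k" by (simp add: int_pow_mult int_pow_pow)
  then show ?thesis using assms(2) by (simp add: int_pow_int)
qed

text \<open>Nested to the right, so that \<open>m_assoc\<close> leaves it unchanged.\<close>

definition normal_word where
  "normal_word x y z c1 c2 c3 a b c i j k =
     x [^] (a::int) \<otimes> (y [^] (b::int) \<otimes> (z [^] (c::int) \<otimes> (c1 [^] (i::int) \<otimes> (c2 [^] (j::int) \<otimes> c3 [^] (k::int)))))"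

text \<open>Collection, with $c_1 = [y,z]$, $c_2 = [z,x]$ and $c_3 = [x,y]$.\<close>

lemma normal_word_mult:
  assumes G [simp]: "x \<in> carrier G" "y \<in> carrier G" "z \<in> carrier G" "c1 \<in> carrier G" "c2 \<in> carrier G" "c3 \<in> carrier G"
    and yx: "x \<otimes> y = y \<otimes> x \<otimes> c3" and zx: "z \<otimes> x = x \<otimes> z \<otimes> c2" and zy: "y \<otimes> z = z \<otimes> y \<otimes> c1"
    and central: "\<And>g. g \<in> carrier G \<Longrightarrow> c1 \<otimes> g = g \<otimes> c1" "\<And>g. g \<in> carrier G \<Longrightarrow> c2 \<otimes> g = g \<otimes> c2"
      "\<And>g. g \<in> carrier G \<Longrightarrow> c3 \<otimes> g = g \<otimes> c3"
  shows "normal_word x y z c1 c2 c3 a b c i j k \<otimes> normal_word x y z c1 c2 c3 a' b' c' i' j' k' =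
    normal_word x y z c1 c2 c3 (a + a') (b + b') (c + c') (i + i' - c * b') (j + j' + c * a') (k + k' - b * a')"
proof -
  \<comment> \<open>The hypotheses on x y and y z move letters the wrong way for collection.
    Reversing them puts an inverse commutator on the right, which is where the minus signs in the
    exponents of c1 and c3 come from.\<close>
  have inv_swap: "v \<otimes> u = u \<otimes> v \<otimes> inv K" if [simp]: "u \<in> carrier G" "v \<in> carrier G" "K \<in> carrier G"
    and "u \<otimes> v = v \<otimes> u \<otimes> K" for u v K using that(4) by (simp add: m_assoc inv_solve_right inv_solve_right')
  have inv_central: "inv K \<otimes> g = g \<otimes> inv K" if [simp]: "K \<in> carrier G" "g \<in> carrier G" and "K \<otimes> g = g \<otimes> K" for K g
  proof -
    have "inv K \<otimes> g = inv K \<otimes> (g \<otimes> K) \<otimes> inv K" by (simp add: m_assoc)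
    also have "g \<otimes> K = K \<otimes> g" using that(3) by simp
    also have "inv K \<otimes> (K \<otimes> g) \<otimes> inv K = g \<otimes> inv K" by (simp add: m_assoc[symmetric])
    finally show ?thesis .
  qed
  have comm: "K [^] m \<otimes> g [^] l = g [^] l \<otimes> K [^] m" if "K \<in> {c1, c2, c3}" "g \<in> carrier G" for K g and l m :: int
  proof -
    have "K \<in> carrier G" "K \<otimes> g = g \<otimes> K" using that central by auto
    then show ?thesis using int_pow_swap[of g K \<one> m l] that(2) by simp
  qed
  have lcomm: "K [^] m \<otimes> (g [^] l \<otimes> h) = g [^] l \<otimes> (K [^] m \<otimes> h)"
    if "K \<in> {c1, c2, c3}" "g \<in> carrier G" "h \<in> carrier G" for K g h and l m :: int
  proof -
    have "K \<in> carrier G" using that by auto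
    then show ?thesis using that comm[OF that(1,2), of m l] by (simp add: m_assoc[symmetric])
  qed
  have yx': "y [^] m \<otimes> x [^] l = x [^] l \<otimes> (y [^] m \<otimes> c3 [^] (- (l * m)))" for l m :: int
    using int_pow_swap[OF _ _ _ inv_swap[OF _ _ _ yx] inv_central[OF _ _ central(3)], of m l]
    by (simp add: m_assoc int_pow_inv int_pow_neg)
  have zx': "z [^] m \<otimes> x [^] l = x [^] l \<otimes> (z [^] m \<otimes> c2 [^] (l * m))" for l m :: int
    using int_pow_swap[OF _ _ _ zx central(2), of m l] by (simp add: m_assoc)
  have zy': "z [^] m \<otimes> y [^] l = y [^] l \<otimes> (z [^] m \<otimes> c1 [^] (- (l * m)))" for l m :: int
    using int_pow_swap[OF _ _ _ inv_swap[OF _ _ _ zy] inv_central[OF _ _ central(1)], of m l]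
    by (simp add: m_assoc int_pow_inv int_pow_neg)
  have l: "y [^] m \<otimes> (x [^] l \<otimes> h) = x [^] l \<otimes> (y [^] m \<otimes> (c3 [^] (- (l * m)) \<otimes> h))"
    "z [^] m \<otimes> (x [^] l \<otimes> h) = x [^] l \<otimes> (z [^] m \<otimes> (c2 [^] (l * m) \<otimes> h))"
    "z [^] m \<otimes> (y [^] l \<otimes> h) = y [^] l \<otimes> (z [^] m \<otimes> (c1 [^] (- (l * m)) \<otimes> h))"
    if [simp]: "h \<in> carrier G" for h and l m :: int
    using arg_cong[OF yx'[of m l], of "\<lambda>g. g \<otimes> h"] arg_cong[OF zx'[of m l], of "\<lambda>g. g \<otimes> h"]
      arg_cong[OF zy'[of m l], of "\<lambda>g. g \<otimes> h"] by (simp_all add: m_assoc)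
  have merge: "g [^] m \<otimes> g [^] l = g [^] (m + l)" "h \<in> carrier G \<Longrightarrow> g [^] m \<otimes> (g [^] l \<otimes> h) = g [^] (m + l) \<otimes> h"
    if [simp]: "g \<in> carrier G" for g h and l m :: int
    by (simp_all add: int_pow_mult m_assoc)
  \<comment> \<open>The exchanges of central letters that sort a word into the order x, y, z, c1,
    c2, c3.\<close>
  note rules = comm[of c1 x] comm[of c1 y] comm[of c1 z] comm[of c2 x] comm[of c2 y] comm[of c2 z]
    comm[of c3 x] comm[of c3 y] comm[of c3 z] comm[of c2 c1] comm[of c3 c1] comm[of c3 c2]
    lcomm[of c1 x] lcomm[of c1 y] lcomm[of c1 z] lcomm[of c2 x] lcomm[of c2 y] lcomm[of c2 z]
    lcomm[of c3 x] lcomm[of c3 y] lcomm[of c3 z] lcomm[of c2 c1] lcomm[of c3 c1] lcomm[of c3 c2]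
  have "normal_word x y z c1 c2 c3 a b c i j k \<otimes> normal_word x y z c1 c2 c3 a' b' c' i' j' k'
    = x [^] (a + a') \<otimes> (y [^] (b + b') \<otimes> (z [^] (c + c') \<otimes> (c1 [^] (- (b' * c) + (i + i')) \<otimes>
        (c2 [^] (a' * c + (j + j')) \<otimes> c3 [^] (- (a' * b) + (k + k'))))))"
    unfolding normal_word_def by (simp add: m_assoc rules yx' zx' zy' l merge add.assoc)
  then show ?thesis unfolding normal_word_def by (simp add: algebra_simps)
qed

end

section \<open>Coordinates on the free group\<close>

lemma heisenberg_coords_transport:
  assumes "heisenberg_coords G q r E" and K: "group K" and f: "f \<in> hom K G"
    and bij: "bij_betw f (carrier K) (carrier G)"
  shows "heisenberg_coords K q r (\<lambda>a b c s t w. inv_into (carrier K) f (E a b c s t w))"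
proof -
  interpret G: heisenberg_coords G q r E by (rule assms(1))
  interpret K: group K by (rule K)
  let ?g = "inv_into (carrier K) f"
  have g: "?g h \<in> carrier K" "f (?g h) = h" if "h \<in> carrier G" for h
    using that bij_betw_inv_into_right[OF bij] bij_betw_inv_into[OF bij] bij_betwE by metis+
  have g_eq: "?g h = k \<longleftrightarrow> h = f k" if "h \<in> carrier G" "k \<in> carrier K" for h k
    using g(2)[OF that(1)] bij_betw_inv_into_left[OF bij that(2)] by metis
  have g_inj: "?g h = ?g h' \<longleftrightarrow> h = h'" if "h \<in> carrier G" "h' \<in> carrier G" for h h'
    using g(2)[OF that(1)] g(2)[OF that(2)] by metis
  have f_closed: "f k \<in> carrier G" if "k \<in> carrier K" for k using hom_in_carrier[OF f that] .
  show ?thesis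
  proof unfold_locales
    fix k assume k: "k \<in> carrier K"
    then obtain a b c s t w where "f k = E a b c s t w" using G.E_surj[OF f_closed[OF k]] by blast
    then have "?g (E a b c s t w) = k" by (rule iffD2[OF g_eq[OF G.E_closed k], OF sym])
    then show "\<exists>a b c s t w. k = ?g (E a b c s t w)" by metis
  next
    fix a b c s t w a' b' c' s' t' w'
    show "?g (E a b c s t w) = ?g (E a' b' c' s' t' w') \<longleftrightarrow>
      veq q r a a' \<and> veq q r b b' \<and> veq q r c c' \<and> [s = s'] (mod q) \<and> [t = t'] (mod q) \<and> [w = w'] (mod q)"
      unfolding G.E_eq_iff[symmetric] by (rule g_inj[OF G.E_closed G.E_closed])
    have "f (?g (E a b c s t w) \<otimes>\<^bsub>K\<^esub> ?g (E a' b' c' s' t' w')) = E a b c s t w \<otimes>\<^bsub>G\<^esub> E a' b' c' s' t' w'"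
      using hom_mult[OF f g(1)[OF G.E_closed] g(1)[OF G.E_closed]] by (simp add: g(2))
    then have "E (a + a') (b + b') (c + c') (s + s' + wedge r b c b' c') (t + t' + wedge r c a c' a')
        (w + w' + wedge r a b a' b') = f (?g (E a b c s t w) \<otimes>\<^bsub>K\<^esub> ?g (E a' b' c' s' t' w'))"
      unfolding G.E_mult by (rule sym)
    then have "?g (E (a + a') (b + b') (c + c') (s + s' + wedge r b c b' c') (t + t' + wedge r c a c' a')
        (w + w' + wedge r a b a' b')) = ?g (E a b c s t w) \<otimes>\<^bsub>K\<^esub> ?g (E a' b' c' s' t' w')"
      by (rule iffD2[OF g_eq[OF G.E_closed K.m_closed[OF g(1)[OF G.E_closed] g(1)[OF G.E_closed]]]])
    then show "?g (E a b c s t w) \<otimes>\<^bsub>K\<^esub> ?g (E a' b' c' s' t' w') = ?g (E (a + a') (b + b') (c + c')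
       (s + s' + wedge r b c b' c') (t + t' + wedge r c a c' a') (w + w' + wedge r a b a' b'))"
      by (rule sym)
  next
    show "?g (E a b c s t w) \<in> carrier K" for a b c s t w by (rule g(1)[OF G.E_closed])
  qed (fact G.prime_q G.odd_q G.r_pos)+
qed

lemma enc_int_pow:
  assumes "Factorial_Ring.prime q" "odd q"
  shows "enc q a b c s t w [^]\<^bsub>test_group q\<^esub> (k::int) = enc q (k * a) (k * b) (k * c) (k * s) (k * t) (k * w)"
proof -
  interpret M: heisenberg_coords "test_group q" q 1 "\<lambda>a b c. enc q (a 1) (b 1) (c 1)"
    by (rule test_group_coords[OF assms])
  show ?thesis using M.E_int_pow[of "\<lambda>_. a" "\<lambda>_. b" "\<lambda>_. c" s t w k] by (simp add: scl_apply)
qed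

text \<open>The universal property gives a map \<open>f\<close> from H to the test group, and
  collection writes each element of H as a normal word. Computing \<open>f\<close> on normal words
  shows that it separates them up to exponents modulo q and reaches everything, so \<open>f\<close>
  is an isomorphism and coordinates pull back to H.\<close>

lemma free_cls2_expp_coords:
  assumes p: "Factorial_Ring.prime p" "odd p" and free: "free_cls2_expp H p x y z"
  obtains E where "heisenberg_coords H (int p) 1 E" "E (unitv 1) 0 0 0 0 0 = x"
    "E 0 (unitv 1) 0 0 0 0 = y" "E 0 0 (unitv 1) 0 0 0 = z"
proof -
  define q where "q = int p"
  have q: "Factorial_Ring.prime q" "odd q" using p by (auto simp: q_def)
  interpret M: heisenberg_coords "test_group q" q 1 "\<lambda>a b c. enc q (a 1) (b 1) (c 1)"
    by (rule test_group_coords[OF q])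
  let ?M = "test_group q"
  from free interpret H: group H by (simp add: free_cls2_expp_def)
  have xyz [simp]: "x \<in> carrier H" "y \<in> carrier H" "z \<in> carrier H"
    and H: "class_le2 H" "exponent_p H p" "generate H {x, y, z} = carrier H"
    using free by (auto simp: free_cls2_expp_def)
  have Mcomm: "grp_comm ?M (enc q a b c s t w) (enc q a' b' c' s' t' w') =
      enc q 0 0 0 (2 * (b * c' - c * b')) (2 * (c * a' - a * c')) (2 * (a * b' - b * a'))"
    for a b c s t w a' b' c' s' t' w'
    using M.E_comm(1)[of "\<lambda>_. a" "\<lambda>_. b" "\<lambda>_. c" s t w "\<lambda>_. a'" "\<lambda>_. b'" "\<lambda>_. c'" s' t' w']
    by (simp add: grp_comm_def wedge_def dot_def)
  have "class_le2 ?M"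
    unfolding class_le2_def
  proof (intro ballI)
    fix g h assume "g \<in> carrier ?M" "h \<in> carrier ?M"
    then obtain s t w where gh: "grp_comm ?M g h = enc q 0 0 0 s t w"
      unfolding test_group_carrier using Mcomm by blast
    have "enc q 0 0 0 s t w \<otimes>\<^bsub>?M\<^esub> k = k \<otimes>\<^bsub>?M\<^esub> enc q 0 0 0 s t w" if k: "k \<in> carrier ?M" for k
    proof -
      obtain a b c s' t' w' where "k = enc q a b c s' t' w'" using k unfolding test_group_carrier by blast
      then show ?thesis by (simp add: test_group_mult add.commute)
    qed
    then show "grp_comm ?M g h \<in> grp_center ?M"
      unfolding gh grp_center_def test_group_carrier by blast
  qed
  moreover have "exponent_p ?M p"
    unfolding exponent_p_def test_group_carrier
  proof
    fix g assume "g \<in> {enc q a b c s t w | a b c s t w. True}"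
    then obtain a b c s t w where g: "g = enc q a b c s t w" by blast
    have "g [^]\<^bsub>?M\<^esub> int p = enc q 0 0 0 0 0 0"
      unfolding g enc_int_pow[OF q] enc_eq_iff by (simp add: q_def cong_0_iff)
    then show "g [^]\<^bsub>?M\<^esub> p = \<one>\<^bsub>?M\<^esub>" by (simp add: int_pow_int test_group_def)
  qed
  moreover have "enc q a b c s t w \<in> carrier ?M" for a b c s t w
    unfolding test_group_carrier by blast
  ultimately obtain f where f: "f \<in> hom H ?M" and f_gen: "f x = enc q 1 0 0 0 0 0" "f y = enc q 0 1 0 0 0 0" "f z = enc q 0 0 1 0 0 0"
    using free group_test_group[of q] unfolding free_cls2_expp_def by metis
  interpret f: group_hom H ?M f
    using f by (simp add: group_hom_def group_hom_axioms_def H.is_group group_test_group)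
  define c1 where "c1 = grp_comm H y z"
  define c2 where "c2 = grp_comm H z x"
  define c3 where "c3 = grp_comm H x y"
  note c_def = c1_def c2_def c3_def
  have c [simp]: "c1 \<in> carrier H" "c2 \<in> carrier H" "c3 \<in> carrier H"
    by (simp_all add: c_def grp_comm_def)
  have comm: "g \<otimes>\<^bsub>H\<^esub> h = h \<otimes>\<^bsub>H\<^esub> g \<otimes>\<^bsub>H\<^esub> grp_comm H g h" if [simp]: "g \<in> carrier H" "h \<in> carrier H" for g h
  proof -
    have "u \<otimes>\<^bsub>H\<^esub> (inv\<^bsub>H\<^esub> u \<otimes>\<^bsub>H\<^esub> v) = v" if "u \<in> carrier H" "v \<in> carrier H" for u v
      using that by (simp add: H.m_assoc[symmetric])
    then show ?thesis unfolding grp_comm_def by (simp add: H.m_assoc)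
  qed
  have central: "grp_comm H g h \<otimes>\<^bsub>H\<^esub> k = k \<otimes>\<^bsub>H\<^esub> grp_comm H g h"
    if "g \<in> carrier H" "h \<in> carrier H" "k \<in> carrier H" for g h k
    using H(1) that unfolding class_le2_def grp_center_def by blast
  define W where "W = H.normal_word x y z c1 c2 c3"
  have W_mult: "W a b c i j k \<otimes>\<^bsub>H\<^esub> W a' b' c' i' j' k' =
    W (a + a') (b + b') (c + c') (i + i' - c * b') (j + j' + c * a') (k + k' - b * a')"
    for a b c i j k a' b' c' i' j' k'
    unfolding W_def
    by (rule H.normal_word_mult[OF xyz c comm[OF xyz(1,2), folded c3_def] comm[OF xyz(3,1), folded c2_def]
        comm[OF xyz(2,3), folded c1_def] central[OF xyz(2,3), folded c1_def]
        central[OF xyz(3,1), folded c2_def] central[OF xyz(1,2), folded c3_def]])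
  have W_closed [simp]: "W a b c i j k \<in> carrier H" for a b c i j k
    by (simp add: W_def H.normal_word_def)
  have W_one: "W 0 0 0 0 0 0 = \<one>\<^bsub>H\<^esub>" by (simp add: W_def H.normal_word_def)
  have W_sub: "subgroup {W a b c i j k | a b c i j k. True} H"
  proof (rule H.subgroupI)
    fix g assume "g \<in> {W a b c i j k | a b c i j k. True}"
    then obtain a b c i j k where g: "g = W a b c i j k" by blast
    \<comment> \<open>The correction terms c b, c a and b a undo the collection terms of
      \<open>W_mult\<close>.\<close>
    have "W (-a) (-b) (-c) (-i - c * b) (-j + c * a) (-k - b * a) \<otimes>\<^bsub>H\<^esub> g = \<one>\<^bsub>H\<^esub>"
      unfolding g W_mult W_one[symmetric] by (simp add: algebra_simps)
    then have "inv\<^bsub>H\<^esub> g = W (-a) (-b) (-c) (-i - c * b) (-j + c * a) (-k - b * a)"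
      by (intro H.inv_equality) (simp_all add: g)
    then show "inv\<^bsub>H\<^esub> g \<in> {W a b c i j k | a b c i j k. True}" by blast
  next
    fix g h assume "g \<in> {W a b c i j k | a b c i j k. True}" "h \<in> {W a b c i j k | a b c i j k. True}"
    then obtain a b c i j k a' b' c' i' j' k' where "g = W a b c i j k" "h = W a' b' c' i' j' k'" by blast
    then show "g \<otimes>\<^bsub>H\<^esub> h \<in> {W a b c i j k | a b c i j k. True}" using W_mult by blast
  next
    show "{W a b c i j k | a b c i j k. True} \<subseteq> carrier H" using W_closed by blast
    show "{W a b c i j k | a b c i j k. True} \<noteq> {}" by blast
  qed
  have "x = W 1 0 0 0 0 0" "y = W 0 1 0 0 0 0" "z = W 0 0 1 0 0 0"
    by (simp_all add: W_def H.normal_word_def)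
  then have "{x, y, z} \<subseteq> {W a b c i j k | a b c i j k. True}" by blast
  then have carr: "carrier H \<subseteq> {W a b c i j k | a b c i j k. True}"
    unfolding H(3)[symmetric] by (rule H.generate_subgroup_incl[OF _ W_sub])
  have W_surj: "\<exists>a b c i j k. g = W a b c i j k" if "g \<in> carrier H" for g
    using subsetD[OF carr that] by (simp only: mem_Collect_eq simp_thms)
  have fcomm: "f (grp_comm H g h) = grp_comm ?M (f g) (f h)" if "g \<in> carrier H" "h \<in> carrier H" for g h
    using that by (simp add: grp_comm_def)
  have fc: "f c1 = enc q 0 0 0 2 0 0" "f c2 = enc q 0 0 0 0 2 0" "f c3 = enc q 0 0 0 0 0 2"
    by (simp_all add: c_def fcomm f_gen Mcomm)
  \<comment> \<open>The commutators map to doubled central generators; the terms b c, a c and a b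
    are the twists in the product of the first three powers.\<close>
  have fW: "f (W a b c i j k) = enc q a b c (2 * i + b * c) (2 * j - a * c) (2 * k + a * b)" for a b c i j k
    unfolding W_def H.normal_word_def
    by (simp add: f.hom_int_pow f_gen fc enc_int_pow[OF q] test_group_mult) (simp add: enc_eq_iff algebra_simps)
  have pow: "u [^]\<^bsub>H\<^esub> a = u [^]\<^bsub>H\<^esub> b" if "u \<in> carrier H" "[a = b] (mod q)" for u and a b :: int
    using H.int_pow_cong[OF that(1) _ that(2)[unfolded q_def]] H(2) that(1) by (simp add: exponent_p_def)
  have "inj_on f (carrier H)"
  proof (rule inj_onI)
    fix g h assume gh: "g \<in> carrier H" "h \<in> carrier H" "f g = f h"
    obtain a b c i j k where g: "g = W a b c i j k" using W_surj gh by blast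
    obtain a' b' c' i' j' k' where h: "h = W a' b' c' i' j' k'" using W_surj gh by blast
    have abc: "[a = a'] (mod q)" "[b = b'] (mod q)" "[c = c'] (mod q)"
      and *: "[2 * i + b * c = 2 * i' + b' * c'] (mod q)" "[2 * j - a * c = 2 * j' - a' * c'] (mod q)"
        "[2 * k + a * b = 2 * k' + a' * b'] (mod q)"
      using gh(3) unfolding g h fW enc_eq_iff by blast+
    \<comment> \<open>The mixed terms agree modulo q by \<open>abc\<close>; removing them leaves
      doubles, and 2 is a unit.\<close>
    have "[2 * i = 2 * i'] (mod q)" "[2 * j = 2 * j'] (mod q)" "[2 * k = 2 * k'] (mod q)"
      using cong_diff[OF *(1) cong_mult[OF abc(2,3)]] cong_add[OF *(2) cong_mult[OF abc(1,3)]]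
        cong_diff[OF *(3) cong_mult[OF abc(1,2)]] by simp_all
    then have ijk: "[i = i'] (mod q)" "[j = j'] (mod q)" "[k = k'] (mod q)" unfolding M.cong_double by auto
    show "g = h" unfolding g h W_def H.normal_word_def
      using pow[OF _ abc(1), of x] pow[OF _ abc(2), of y] pow[OF _ abc(3), of z]
        pow[OF _ ijk(1), of c1] pow[OF _ ijk(2), of c2] pow[OF _ ijk(3), of c3] by simp
  qed
  moreover have "f ` carrier H = carrier ?M"
  proof
    show "carrier ?M \<subseteq> f ` carrier H"
    proof
      fix g assume "g \<in> carrier ?M"
      then obtain a b c s t w where g: "g = enc q a b c s t w" unfolding test_group_carrier by blast
      \<comment> \<open>The inverse of 2 modulo q, used to solve the equations of \<open>fW\<close>
        for the exponents of the commutators.\<close>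
      define m where "m = (q + 1) div 2"
      have m: "2 * m = q + 1" unfolding m_def using q(2) by presburger
      have half: "[u = 2 * (m * u)] (mod q)" for u
      proof -
        have "2 * (m * u) = (2 * m) * u" by (rule mult.assoc[symmetric])
        also have "\<dots> = q * u + u" unfolding m by (simp add: distrib_right)
        finally show ?thesis by (simp add: cong_iff_dvd_diff)
      qed
      have "g = f (W a b c (m * (s - b * c)) (m * (t + a * c)) (m * (w - a * b)))"
        unfolding g fW enc_eq_iff
        using cong_add[OF half[of "s - b * c"] cong_refl[of "b * c"]]
          cong_diff[OF half[of "t + a * c"] cong_refl[of "a * c"]]
          cong_add[OF half[of "w - a * b"] cong_refl[of "a * b"]] by simp
      then show "g \<in> f ` carrier H" using W_closed by blast
    qed
    show "f ` carrier H \<subseteq> carrier ?M" using f.hom_closed by blast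
  qed
  ultimately have bij: "bij_betw f (carrier H) (carrier ?M)" by (simp add: bij_betw_def)
  show ?thesis
  proof (rule that)
    show "heisenberg_coords H (int p) 1 (\<lambda>a b c s t w. inv_into (carrier H) f (enc q (a 1) (b 1) (c 1) s t w))"
      using heisenberg_coords_transport[OF M.heisenberg_coords_axioms H.is_group f bij] by (simp add: q_def)
    show "inv_into (carrier H) f (enc q (unitv 1 1) (0 1) (0 1) 0 0 0) = x"
      using bij_betw_inv_into_left[OF bij xyz(1)] by (simp add: f_gen unitv_def)
    show "inv_into (carrier H) f (enc q (0 1) (unitv 1 1) (0 1) 0 0 0) = y"
      using bij_betw_inv_into_left[OF bij xyz(2)] by (simp add: f_gen unitv_def)
    show "inv_into (carrier H) f (enc q (0 1) (0 1) (unitv 1 1) 0 0 0) = z"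
      using bij_betw_inv_into_left[OF bij xyz(3)] by (simp add: f_gen unitv_def)
  qed
qed

section \<open>Central products\<close>

context heisenberg_coords
begin

text \<open>Constant functions stand in for rank-one vectors, of which the value at index 1
  counts.\<close>

definition e_coord :: "int \<Rightarrow> int \<Rightarrow> int \<Rightarrow> int \<Rightarrow> int \<Rightarrow> int \<Rightarrow> 'a" where
  "e_coord a b c = E (\<lambda>_. a) (\<lambda>_. b) (\<lambda>_. c)"

text \<open>Coordinates on the direct product: the index of a vector becomes the index of the
  factor.\<close>

definition tup :: "nat \<Rightarrow> (nat \<Rightarrow> int) \<Rightarrow> (nat \<Rightarrow> int) \<Rightarrow> (nat \<Rightarrow> int) \<Rightarrow>
    (nat \<Rightarrow> int) \<Rightarrow> (nat \<Rightarrow> int) \<Rightarrow> (nat \<Rightarrow> int) \<Rightarrow> nat \<Rightarrow> 'a" where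
  "tup R a b c s t w = (\<lambda>i\<in>{1..R}. e_coord (a i) (b i) (c i) (s i) (t i) (w i))"

definition tot :: "nat \<Rightarrow> (nat \<Rightarrow> int) \<Rightarrow> int" where
  "tot R s = (\<Sum>i\<in>{1..R}. s i)"

text \<open>Modulo \<open>cp_N\<close> only the total of the central coordinates matters; it is placed in the first factor.\<close>

definition cp_coord :: "nat \<Rightarrow> (nat \<Rightarrow> int) \<Rightarrow> (nat \<Rightarrow> int) \<Rightarrow> (nat \<Rightarrow> int) \<Rightarrow>
    int \<Rightarrow> int \<Rightarrow> int \<Rightarrow> (nat \<Rightarrow> 'a) set" where
  "cp_coord R a b c s t w = cp_N G R #>\<^bsub>cp_base G R\<^esub>
     tup R a b c (scl s (unitv 1)) (scl t (unitv 1)) (scl w (unitv 1))"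

lemma tot_simps: "tot R 0 = 0" "tot R (s + t) = tot R s + tot R t" "tot R (s - t) = tot R s - tot R t"
  "tot R (- s) = - tot R s"
  by (simp_all add: tot_def sum.distrib sum_subtractf sum_negf)

lemma tot_unitv: "i \<in> {1..R} \<Longrightarrow> tot R (scl k (unitv i)) = k"
  by (simp add: tot_def scl_apply unitv_def if_distrib sum.delta cong: if_cong)

lemma group_cp_base: "group (cp_base G R)"
  by (simp add: cp_base_def is_group)

section \<open>The direct product of rank-one groups and its central quotient\<close>

context
  assumes rank_1: "r = 1"
begin

lemma e_coord_closed [simp]: "e_coord a b c s t w \<in> carrier G"
  by (simp add: e_coord_def)

lemma e_coord_mult: "e_coord a b c s t w \<otimes> e_coord a' b' c' s' t' w' =
  e_coord (a + a') (b + b') (c + c') (s + s' + (b * c' - c * b')) (t + t' + (c * a' - a * c')) (w + w' + (a * b' - b * a'))"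
  unfolding e_coord_def E_mult by (simp add: plus_fun_def wedge_def dot_def rank_1)

lemma e_coord_eq_iff: "e_coord a b c s t w = e_coord a' b' c' s' t' w' \<longleftrightarrow>
  [a = a'] (mod q) \<and> [b = b'] (mod q) \<and> [c = c'] (mod q) \<and> [s = s'] (mod q) \<and> [t = t'] (mod q) \<and> [w = w'] (mod q)"
  unfolding e_coord_def E_eq_iff by (simp add: veq_def rank_1)

lemma E_eq_e_coord: "E a b c s t w = e_coord (a 1) (b 1) (c 1) s t w"
  unfolding e_coord_def E_eq_iff by (simp add: veq_def rank_1)

lemma e_coord_surj:
  assumes "g \<in> carrier G"
  shows "\<exists>a b c s t w. g = e_coord a b c s t w"
proof -
  obtain a b c s t w where "g = E a b c s t w" using E_surj[OF assms] by blast
  then have "g = e_coord (a 1) (b 1) (c 1) s t w" by (rule trans[OF _ E_eq_e_coord])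
  then show ?thesis by blast
qed

lemma e_coord_one: "e_coord 0 0 0 0 0 0 = \<one>"
  using E_one E_eq_e_coord[of 0 0 0 0 0 0] by simp

lemma e_coord_inv: "inv (e_coord a b c s t w) = e_coord (- a) (- b) (- c) (- s) (- t) (- w)"
  by (rule inv_equality) (simp_all add: e_coord_mult e_coord_one)

lemma tup_closed [simp]: "tup R a b c s t w \<in> carrier (cp_base G R)"
  by (simp add: tup_def cp_base_def)

lemma tup_mult: "tup R a b c s t w \<otimes>\<^bsub>cp_base G R\<^esub> tup R a' b' c' s' t' w' =
  tup R (a + a') (b + b') (c + c') (s + s' + (b * c' - c * b')) (t + t' + (c * a' - a * c')) (w + w' + (a * b' - b * a'))"
  by (rule ext) (simp add: tup_def cp_base_def e_coord_mult)

lemma tup_eq_iff: "tup R a b c s t w = tup R a' b' c' s' t' w' \<longleftrightarrow>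
  veq q R a a' \<and> veq q R b b' \<and> veq q R c c' \<and> veq q R s s' \<and> veq q R t t' \<and> veq q R w w'"
proof
  assume eq: "tup R a b c s t w = tup R a' b' c' s' t' w'"
  have "e_coord (a i) (b i) (c i) (s i) (t i) (w i) = e_coord (a' i) (b' i) (c' i) (s' i) (t' i) (w' i)"
    if "i \<in> {1..R}" for i using fun_cong[OF eq, of i] that by (simp add: tup_def)
  then show "veq q R a a' \<and> veq q R b b' \<and> veq q R c c' \<and> veq q R s s' \<and> veq q R t t' \<and> veq q R w w'"
    unfolding e_coord_eq_iff veq_def by blast
next
  assume eq: "veq q R a a' \<and> veq q R b b' \<and> veq q R c c' \<and> veq q R s s' \<and> veq q R t t' \<and> veq q R w w'"
  show "tup R a b c s t w = tup R a' b' c' s' t' w'"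
    unfolding tup_def
  proof (rule restrict_ext)
    fix i assume "i \<in> {1..R}"
    then show "e_coord (a i) (b i) (c i) (s i) (t i) (w i) = e_coord (a' i) (b' i) (c' i) (s' i) (t' i) (w' i)"
      using eq unfolding e_coord_eq_iff veq_def by blast
  qed
qed

lemma tup_surj:
  assumes "g \<in> carrier (cp_base G R)"
  shows "\<exists>a b c s t w. g = tup R a b c s t w"
proof -
  have "\<forall>i\<in>{1..R}. \<exists>a b c s t w. g i = e_coord a b c s t w"
  proof
    fix i assume "i \<in> {1..R}"
    then have "g i \<in> carrier G" using assms by (simp add: cp_base_def PiE_iff)
    then show "\<exists>a b c s t w. g i = e_coord a b c s t w" by (rule e_coord_surj)
  qed
  then obtain a b c s t w where "\<forall>i\<in>{1..R}. g i = e_coord (a i) (b i) (c i) (s i) (t i) (w i)"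
    unfolding bchoice_iff by blast
  then have "g = tup R a b c s t w"
    using assms by (intro extensionalityI[of g "{1..R}"]) (auto simp: cp_base_def tup_def PiE_iff)
  then show ?thesis by blast
qed

lemma tup_one: "tup R 0 0 0 0 0 0 = \<one>\<^bsub>cp_base G R\<^esub>"
  by (simp add: tup_def cp_base_def e_coord_one)

lemma grp_center_eq: "grp_center G = {e_coord 0 0 0 s t w | s t w. True}"
proof
  show "grp_center G \<subseteq> {e_coord 0 0 0 s t w | s t w. True}"
  proof
    fix g assume g: "g \<in> grp_center G"
    then obtain a b c s t w where E: "g = E a b c s t w" using E_surj unfolding grp_center_def by blast
    have "E a b c s t w \<otimes> h = h \<otimes> E a b c s t w" if "h \<in> carrier G" for h
      using g that unfolding E grp_center_def by blast
    from E_central[OF this] have "g = E 0 0 0 s t w" unfolding E E_eq_iff by simp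
    then have "g = e_coord 0 0 0 s t w" using E_eq_e_coord[of 0 0 0 s t w] by simp
    then show "g \<in> {e_coord 0 0 0 s t w | s t w. True}" by blast
  qed
  show "{e_coord 0 0 0 s t w | s t w. True} \<subseteq> grp_center G"
  proof
    fix g assume "g \<in> {e_coord 0 0 0 s t w | s t w. True}"
    then obtain s t w where g: "g = e_coord 0 0 0 s t w" by blast
    have "g \<otimes> h = h \<otimes> g" if "h \<in> carrier G" for h
    proof -
      obtain a b c s' t' w' where "h = e_coord a b c s' t' w'" using e_coord_surj \<open>h \<in> carrier G\<close> by blast
      then show ?thesis unfolding g by (simp add: e_coord_mult add.commute)
    qed
    then show "g \<in> grp_center G" unfolding grp_center_def using g e_coord_closed by blast
  qed
qed

lemma subgroup_balanced:
  "subgroup {tup R 0 0 0 s t w | s t w. [tot R s = 0] (mod q) \<and> [tot R t = 0] (mod q) \<and> [tot R w = 0] (mod q)}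
    (cp_base G R)" (is "subgroup ?S _")
proof (rule group.subgroupI[OF group_cp_base])
  have "tup R 0 0 0 0 0 0 \<in> ?S" using tot_simps(1) by fastforce
  then show "?S \<noteq> {}" by blast
next
  fix g assume "g \<in> ?S"
  then obtain s t w where g: "g = tup R 0 0 0 s t w" "[tot R s = 0] (mod q)" "[tot R t = 0] (mod q)" "[tot R w = 0] (mod q)"
    by blast
  have "inv\<^bsub>cp_base G R\<^esub> g = tup R 0 0 0 (-s) (-t) (-w)"
    by (rule group.inv_equality[OF group_cp_base]) (simp_all add: g tup_mult tup_one)
  moreover have "[tot R (-s) = 0] (mod q) \<and> [tot R (-t) = 0] (mod q) \<and> [tot R (-w) = 0] (mod q)"
    using g by (simp add: tot_simps cong_0_iff)
  ultimately show "inv\<^bsub>cp_base G R\<^esub> g \<in> ?S" by blast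
next
  fix g h assume "g \<in> ?S" "h \<in> ?S"
  then obtain s t w s' t' w' where g: "g = tup R 0 0 0 s t w" "[tot R s = 0] (mod q)" "[tot R t = 0] (mod q)" "[tot R w = 0] (mod q)"
    "h = tup R 0 0 0 s' t' w'" "[tot R s' = 0] (mod q)" "[tot R t' = 0] (mod q)" "[tot R w' = 0] (mod q)"
    by blast
  have "g \<otimes>\<^bsub>cp_base G R\<^esub> h = tup R 0 0 0 (s + s') (t + t') (w + w')" by (simp add: g tup_mult)
  moreover have "[tot R (s + s') = 0] (mod q) \<and> [tot R (t + t') = 0] (mod q) \<and> [tot R (w + w') = 0] (mod q)"
    using g by (simp add: tot_simps cong_0_iff)
  ultimately show "g \<otimes>\<^bsub>cp_base G R\<^esub> h \<in> ?S" by blast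
next
  show "?S \<subseteq> carrier (cp_base G R)" using tup_closed by blast
qed

definition cp_gens :: "nat \<Rightarrow> (nat \<Rightarrow> 'a) set" where
  "cp_gens R = {(\<lambda>k\<in>{1..R}. if k = i then c else if k = j then inv c else \<one>) | i j c.
        1 \<le> i \<and> i < j \<and> j \<le> R \<and> c \<in> grp_center G}"

lemma cp_N_gens: "cp_N G R = generate (cp_base G R) (cp_gens R)"
  by (simp add: cp_N_def cp_gens_def)

lemma cp_gens_eq: "cp_gens R = {tup R 0 0 0 (scl s (unitv i - unitv j)) (scl t (unitv i - unitv j)) (scl w (unitv i - unitv j)) | i j s t w.
    1 \<le> i \<and> i < j \<and> j \<le> R}"
proof -
  have eq: "(\<lambda>k\<in>{1..R}. if k = i then e_coord 0 0 0 s t w else if k = j then inv e_coord 0 0 0 s t w else \<one>) =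
    tup R 0 0 0 (scl s (unitv i - unitv j)) (scl t (unitv i - unitv j)) (scl w (unitv i - unitv j))"
    if "i < j" for i j s t w
    using that unfolding tup_def by (intro restrict_ext) (simp add: e_coord_inv scl_apply unitv_def e_coord_one)
  show ?thesis
  proof (intro subset_antisym subsetI)
    fix g assume "g \<in> cp_gens R"
    then obtain i j s t w where g: "g = (\<lambda>k\<in>{1..R}. if k = i then e_coord 0 0 0 s t w else
        if k = j then inv e_coord 0 0 0 s t w else \<one>)" and ij: "1 \<le> i" "i < j" "j \<le> R"
      unfolding cp_gens_def grp_center_eq by blast
    show "g \<in> {tup R 0 0 0 (scl s (unitv i - unitv j)) (scl t (unitv i - unitv j)) (scl w (unitv i - unitv j)) | i j s t w.
      1 \<le> i \<and> i < j \<and> j \<le> R}"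
      unfolding g eq[OF ij(2)] using ij by blast
  next
    fix g assume "g \<in> {tup R 0 0 0 (scl s (unitv i - unitv j)) (scl t (unitv i - unitv j)) (scl w (unitv i - unitv j)) | i j s t w.
      1 \<le> i \<and> i < j \<and> j \<le> R}"
    then obtain i j s t w where g: "g = tup R 0 0 0 (scl s (unitv i - unitv j)) (scl t (unitv i - unitv j)) (scl w (unitv i - unitv j))"
      and ij: "1 \<le> i" "i < j" "j \<le> R" by blast
    show "g \<in> cp_gens R"
      unfolding g eq[OF ij(2), symmetric] cp_gens_def grp_center_eq using ij by blast
  qed
qed

text \<open>A generator shifts a central element from one factor to another, so totals are preserved
  and every balanced tuple is reached.\<close>

lemma cp_N_eq: "cp_N G R =
  {tup R 0 0 0 s t w | s t w. [tot R s = 0] (mod q) \<and> [tot R t = 0] (mod q) \<and> [tot R w = 0] (mod q)}" (is "_ = ?S")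
proof
  show "cp_N G R \<subseteq> ?S"
    unfolding cp_N_gens
  proof (rule group.generate_subgroup_incl[OF group_cp_base _ subgroup_balanced], rule subsetI)
    fix g assume "g \<in> cp_gens R"
    then obtain i j s t w where g: "g = tup R 0 0 0 (scl s (unitv i - unitv j)) (scl t (unitv i - unitv j)) (scl w (unitv i - unitv j))"
      and ij: "1 \<le> i" "i < j" "j \<le> R" unfolding cp_gens_eq by blast
    have "tot R (scl k (unitv i - unitv j)) = 0" for k
      using ij by (simp add: scl_simps tot_simps tot_unitv)
    then show "g \<in> ?S" unfolding g by fastforce
  qed
  show "?S \<subseteq> cp_N G R"
  proof
    fix g assume "g \<in> ?S"
    then obtain s t w where g: "g = tup R 0 0 0 s t w" "[tot R s = 0] (mod q)" "[tot R t = 0] (mod q)" "[tot R w = 0] (mod q)"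
      by blast
    \<comment> \<open>For J inside 2..R, \<open>part J s\<close> agrees with s on J and balances it
      in factor 1. Adding j to J multiplies by the generator for the factors 1 and j with exponent
      -(s j); at J = 2..R a balanced s is recovered modulo q.\<close>
    define part where "part J s = (\<lambda>k. if k \<in> J then s k else if k = 1 then - (\<Sum>j\<in>J. s j) else 0)"
      for J and s :: "nat \<Rightarrow> int"
    interpret N: subgroup "cp_N G R" "cp_base G R"
      unfolding cp_N_gens
      by (rule group.generate_is_subgroup[OF group_cp_base]) (auto simp: cp_gens_eq)
    have partial: "tup R 0 0 0 (part J s) (part J t) (part J w) \<in> cp_N G R" if "finite J" "J \<subseteq> {2..R}" for J
      using that
    proof (induction J rule: finite_induct)
      case empty
      have part_empty: "part {} s = 0" for s by (simp add: part_def fun_eq_iff)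
      have "tup R 0 0 0 (part {} s) (part {} t) (part {} w) \<in> cp_N G R"
        unfolding part_empty tup_one by (rule N.one_closed)
      then show ?case .
    next
      case (insert j J)
      have eq: "part (insert j J) s = scl (- s j) (unitv 1 - unitv j) + part J s" for s
        using insert by (auto simp: part_def fun_eq_iff scl_apply unitv_def)
      have "tup R 0 0 0 (scl (- s j) (unitv 1 - unitv j)) (scl (- t j) (unitv 1 - unitv j)) (scl (- w j) (unitv 1 - unitv j)) \<in> cp_N G R"
        unfolding cp_N_gens using insert.prems by (intro generate.incl) (force simp: cp_gens_eq)
      moreover have "tup R 0 0 0 (part J s) (part J t) (part J w) \<in> cp_N G R"
        by (rule insert.IH) (use insert.prems in blast)
      ultimately have "tup R 0 0 0 (scl (- s j) (unitv 1 - unitv j)) (scl (- t j) (unitv 1 - unitv j)) (scl (- w j) (unitv 1 - unitv j))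
         \<otimes>\<^bsub>cp_base G R\<^esub> tup R 0 0 0 (part J s) (part J t) (part J w) \<in> cp_N G R"
        by (rule N.m_closed)
      then have "tup R 0 0 0 (part (insert j J) s) (part (insert j J) t) (part (insert j J) w) \<in> cp_N G R"
        unfolding eq by (simp add: tup_mult)
      then show ?case .
    qed
    have full: "veq q R s (part {2..R} s)" if "[tot R s = 0] (mod q)" for s
    proof (cases "R = 0")
      case False
      then have "{1..R} = insert 1 {2..R}" by auto
      then have "tot R s = s 1 + (\<Sum>j\<in>{2..R}. s j)" by (simp add: tot_def)
      then have 1: "[s 1 = - (\<Sum>j\<in>{2..R}. s j)] (mod q)" using that by (simp add: cong_iff_dvd_diff)
      show ?thesis
        unfolding veq_def
      proof
        fix i assume "i \<in> {1..R}"
        then consider "i = 1" | "i \<in> {2..R}" by force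
        then show "[s i = part {2..R} s i] (mod q)" using 1 by cases (simp_all add: part_def)
      qed
    qed (simp add: veq_def)
    have "g = tup R 0 0 0 (part {2..R} s) (part {2..R} t) (part {2..R} w)"
      unfolding g(1) tup_eq_iff using full g(2-4) by simp
    then show "g \<in> cp_N G R" using partial[of "{2..R}"] by simp
  qed
qed

lemma cp_N_normal: "cp_N G R \<lhd> cp_base G R"
proof (rule group.normalI[OF group_cp_base])
  show "subgroup (cp_N G R) (cp_base G R)" unfolding cp_N_eq by (rule subgroup_balanced)
  show "\<forall>x\<in>carrier (cp_base G R). cp_N G R #>\<^bsub>cp_base G R\<^esub> x = x <#\<^bsub>cp_base G R\<^esub> cp_N G R"
  proof
    fix x assume "x \<in> carrier (cp_base G R)"
    then obtain a b c s t w where x: "x = tup R a b c s t w" using tup_surj by blast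
    have "n \<otimes>\<^bsub>cp_base G R\<^esub> x = x \<otimes>\<^bsub>cp_base G R\<^esub> n" if n: "n \<in> cp_N G R" for n
    proof -
      obtain s' t' w' where "n = tup R 0 0 0 s' t' w'" using n unfolding cp_N_eq by blast
      then show ?thesis unfolding x by (simp add: tup_mult add.commute)
    qed
    then show "cp_N G R #>\<^bsub>cp_base G R\<^esub> x = x <#\<^bsub>cp_base G R\<^esub> cp_N G R"
      unfolding r_coset_def l_coset_def by blast
  qed
qed

lemma tup_coset_eq_iff:
  "cp_N G R #>\<^bsub>cp_base G R\<^esub> tup R a b c s t w = cp_N G R #>\<^bsub>cp_base G R\<^esub> tup R a' b' c' s' t' w' \<longleftrightarrow>
    veq q R a a' \<and> veq q R b b' \<and> veq q R c c' \<and>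
    [tot R s = tot R s'] (mod q) \<and> [tot R t = tot R t'] (mod q) \<and> [tot R w = tot R w'] (mod q)" (is "?L = ?R")
proof -
  interpret B: group "cp_base G R" by (rule group_cp_base)
  have N: "subgroup (cp_N G R) (cp_base G R)" unfolding cp_N_eq by (rule subgroup_balanced)
  have mem: "g \<in> cp_N G R #>\<^bsub>cp_base G R\<^esub> tup R a' b' c' s' t' w' \<longleftrightarrow>
     (\<exists>s t w. [tot R s = 0] (mod q) \<and> [tot R t = 0] (mod q) \<and> [tot R w = 0] (mod q) \<and>
       g = tup R a' b' c' (s + s') (t + t') (w + w'))" for g
  proof -
    have "tup R 0 0 0 s t w \<otimes>\<^bsub>cp_base G R\<^esub> tup R a' b' c' s' t' w' = tup R a' b' c' (s + s') (t + t') (w + w')"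
      for s t w by (simp add: tup_mult)
    then have "(\<exists>s t w. [tot R s = 0] (mod q) \<and> [tot R t = 0] (mod q) \<and> [tot R w = 0] (mod q) \<and>
       g = tup R a' b' c' (s + s') (t + t') (w + w')) \<longleftrightarrow>
      (\<exists>s t w. [tot R s = 0] (mod q) \<and> [tot R t = 0] (mod q) \<and> [tot R w = 0] (mod q) \<and>
       g = tup R 0 0 0 s t w \<otimes>\<^bsub>cp_base G R\<^esub> tup R a' b' c' s' t' w')" by presburger
    then show ?thesis unfolding r_coset_def cp_N_eq by blast
  qed
  have tot_cong: "[tot R s = tot R s'] (mod q)" if "veq q R s s'" for s s'
    using that unfolding tot_def veq_def by (intro cong_sum) auto
  have "?L \<longleftrightarrow> tup R a b c s t w \<in> cp_N G R #>\<^bsub>cp_base G R\<^esub> tup R a' b' c' s' t' w'"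
  proof
    assume ?L
    then show "tup R a b c s t w \<in> cp_N G R #>\<^bsub>cp_base G R\<^esub> tup R a' b' c' s' t' w'"
      using B.rcos_self[OF tup_closed N] by blast
  next
    assume "tup R a b c s t w \<in> cp_N G R #>\<^bsub>cp_base G R\<^esub> tup R a' b' c' s' t' w'"
    from B.repr_independence[OF this tup_closed N] show ?L by (rule sym)
  qed
  also have "\<dots> \<longleftrightarrow> ?R"
  proof
    assume "tup R a b c s t w \<in> cp_N G R #>\<^bsub>cp_base G R\<^esub> tup R a' b' c' s' t' w'"
    then obtain s1 t1 w1 where *: "[tot R s1 = 0] (mod q)" "[tot R t1 = 0] (mod q)" "[tot R w1 = 0] (mod q)"
      "veq q R a a'" "veq q R b b'" "veq q R c c'" "veq q R s (s1 + s')" "veq q R t (t1 + t')" "veq q R w (w1 + w')"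
      unfolding mem tup_eq_iff by blast
    have "[tot R s1 + tot R s' = 0 + tot R s'] (mod q)" "[tot R t1 + tot R t' = 0 + tot R t'] (mod q)"
      "[tot R w1 + tot R w' = 0 + tot R w'] (mod q)" by (intro cong_add * cong_refl)+
    then show ?R using * tot_cong[OF *(7)] tot_cong[OF *(8)] tot_cong[OF *(9)] cong_trans
      unfolding tot_simps by auto
  next
    assume R: ?R
    then show "tup R a b c s t w \<in> cp_N G R #>\<^bsub>cp_base G R\<^esub> tup R a' b' c' s' t' w'"
      unfolding mem tup_eq_iff
      by (intro exI[of _ "s - s'"] exI[of _ "t - t'"] exI[of _ "w - w'"]) (simp add: tot_simps cong_diff_iff_cong_0)
  qed
  finally show ?thesis .
qed

text \<open>In the quotient the twists of the factors add up, and the total of a pointwise product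
  is a dot product: this is how the dot product on W arises.\<close>

lemma cprod_coords:
  assumes "R \<ge> 1"
  shows "heisenberg_coords (cprod G R) q R (cp_coord R)"
proof -
  interpret N: normal "cp_N G R" "cp_base G R" by (rule cp_N_normal)
  interpret P: group "cprod G R" unfolding cprod_def by (rule N.factorgroup_is_group)
  have one: "1 \<in> {1..R}" using assms by simp
  note tot_1 = tot_unitv[OF one]
  have tot_dot: "tot R (a * b) = dot R a b" for a b by (simp add: tot_def dot_def)
  have norm: "cp_N G R #>\<^bsub>cp_base G R\<^esub> tup R a b c s t w = cp_coord R a b c (tot R s) (tot R t) (tot R w)" for a b c s t w
    unfolding cp_coord_def tup_coset_eq_iff tot_1 by (intro conjI veq_refl cong_refl)
  show ?thesis
  proof unfold_locales
    show "cp_coord R a b c s t w \<in> carrier (cprod G R)" for a b c s t w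
      unfolding cp_coord_def cprod_def FactGroup_def RCOSETS_def using tup_closed by auto
  next
    fix g assume "g \<in> carrier (cprod G R)"
    then obtain x where "x \<in> carrier (cp_base G R)" "g = cp_N G R #>\<^bsub>cp_base G R\<^esub> x"
      unfolding cprod_def FactGroup_def RCOSETS_def by auto
    then obtain a b c s t w where "g = cp_N G R #>\<^bsub>cp_base G R\<^esub> tup R a b c s t w" using tup_surj by blast
    then have "g = cp_coord R a b c (tot R s) (tot R t) (tot R w)" unfolding norm .
    then show "\<exists>a b c s t w. g = cp_coord R a b c s t w" by blast
  next
    show "cp_coord R a b c s t w = cp_coord R a' b' c' s' t' w' \<longleftrightarrow> veq q R a a' \<and> veq q R b b' \<and> veq q R c c' \<and>
      [s = s'] (mod q) \<and> [t = t'] (mod q) \<and> [w = w'] (mod q)" for a b c s t w a' b' c' s' t' w'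
      unfolding cp_coord_def tup_coset_eq_iff tot_1 by (rule refl)
    show "cp_coord R a b c s t w \<otimes>\<^bsub>cprod G R\<^esub> cp_coord R a' b' c' s' t' w' = cp_coord R (a + a') (b + b') (c + c')
       (s + s' + wedge R b c b' c') (t + t' + wedge R c a c' a') (w + w' + wedge R a b a' b')"
      for a b c s t w a' b' c' s' t' w'
    proof -
      have "cp_coord R a b c s t w \<otimes>\<^bsub>cprod G R\<^esub> cp_coord R a' b' c' s' t' w' =
        cp_N G R #>\<^bsub>cp_base G R\<^esub> (tup R a b c (scl s (unitv 1)) (scl t (unitv 1)) (scl w (unitv 1)) \<otimes>\<^bsub>cp_base G R\<^esub>
          tup R a' b' c' (scl s' (unitv 1)) (scl t' (unitv 1)) (scl w' (unitv 1)))"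
        unfolding cp_coord_def cprod_def FactGroup_def by (simp add: N.rcos_sum)
      then show ?thesis unfolding tup_mult norm tot_simps tot_1 tot_dot wedge_def .
    qed
  qed (fact prime_q odd_q assms)+
qed

text \<open>The image of g from factor i is g \<otimes> \<open>unitv i\<close>; its central
  coordinates may be moved to the first factor because the totals agree.\<close>

lemma cp_elt_coord:
  assumes "i \<in> {1..R}"
  shows "cp_elt G R i (E a b c s t w) = cp_coord R (scl (a 1) (unitv i)) (scl (b 1) (unitv i)) (scl (c 1) (unitv i)) s t w"
proof -
  have "cp_embed G R i (E a b c s t w) = tup R (scl (a 1) (unitv i)) (scl (b 1) (unitv i)) (scl (c 1) (unitv i))
      (scl s (unitv i)) (scl t (unitv i)) (scl w (unitv i))"
    unfolding cp_embed_def tup_def E_eq_e_coord[of a b c s t w]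
    by (intro restrict_ext) (simp add: scl_apply unitv_def e_coord_one)
  moreover have "1 \<in> {1..R}" using assms by auto
  ultimately show ?thesis
    using assms unfolding cp_elt_def cp_coord_def by (simp only: tup_coset_eq_iff) (simp add: tot_unitv)
qed

end

text \<open>The three elements supply V_0 \<otimes> <u>, and their commutators supply the central
  coordinates because \<open>u\<close> is anisotropic.\<close>

lemma generate_eq_line:
  assumes "\<not> [dot r u u = 0] (mod q)"
  shows "generate G {E u 0 0 0 0 0, E 0 u 0 0 0 0, E 0 0 u 0 0 0} = line u" (is "generate G ?X = _")
proof
  have gens: "E u 0 0 0 0 0 \<in> line u" "E 0 u 0 0 0 0 \<in> line u" "E 0 0 u 0 0 0 \<in> line u"
    using E_in_line[of 1 u 0 0 0 0 0] E_in_line[of 0 u 1 0 0 0 0] E_in_line[of 0 u 0 1 0 0 0]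
    by (simp_all add: scl_simps)
  then show "generate G ?X \<subseteq> line u"
    by (intro generate_subgroup_incl[OF _ subgroup_line]) blast
  have Q: "subgroup (generate G ?X) G"
    using gens line_in_carrier by (intro generate_is_subgroup) blast
  have "E u 0 0 0 0 0 \<in> generate G ?X" "E 0 u 0 0 0 0 \<in> generate G ?X" "E 0 0 u 0 0 0 \<in> generate G ?X"
    by (intro generate.incl; simp)+
  then have c: "coords_in (generate G ?X) u 0 0" "coords_in (generate G ?X) 0 u 0" "coords_in (generate G ?X) 0 0 u"
    unfolding coords_in_def by blast+
  show "line u \<subseteq> generate G ?X"
  proof
    fix g assume "g \<in> line u"
    then obtain i j k s t w where g: "g = E (scl i u) (scl j u) (scl k u) s t w" unfolding line_def by blast
    have "coords_in (generate G ?X) (scl i u) (scl j u) (scl k u)"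
      using coords_in_add[OF Q coords_in_add[OF Q coords_in_scl[OF Q c(1), of i] coords_in_scl[OF Q c(2), of j]]
        coords_in_scl[OF Q c(3), of k]] by (simp add: scl_simps)
    then show "g \<in> generate G ?X"
      unfolding g using mem_if_center_subset[OF Q center_subset[OF Q c assms]] by blast
  qed
qed

text \<open>\<open>line_coords\<close> has already absorbed the norm of \<open>u\<close> into the
  central coordinates, so the identity similitude is enough.\<close>

lemma line_iso_rank_1:
  assumes u: "\<not> [dot r u u = 0] (mod q)" and H: "heisenberg_coords H q 1 F"
  shows "G\<lparr>carrier := line u\<rparr> \<cong> H"
proof (rule similitude_iso[OF line_coords[OF u] H, where S = "\<lambda>v. v" and \<kappa> = 1])
  show "G\<lparr>carrier := line u\<rparr> \<cong> H" if "f \<in> iso (G\<lparr>carrier := line u\<rparr>) H" for f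
    using that unfolding is_iso_def by blast
  show "\<exists>v. veq q 1 v' v" for v' using veq_refl by blast
qed (simp_all add: not_cong_1_0)

end

text \<open>The frame of $\mathcal{H}_m$: the image of \<open>g\<close> in \<open>K\<^sub>2\<^sub>j\<^sub>-\<^sub>1\<close>, \<open>K\<^sub>2\<^sub>j\<close>, \<open>H\<^sub>i\<close> is \<open>g \<otimes> u\<close> with \<open>u\<close> as follows.\<close>

definition std_frame :: "int \<Rightarrow> int \<Rightarrow> nat \<Rightarrow> nat \<Rightarrow> nat \<Rightarrow> int" where
  "std_frame \<alpha> \<beta> m i = (if i \<le> 2 * m then
      (if odd i then scl \<alpha> (unitv i) + scl \<beta> (unitv (i + 1)) else scl \<beta> (unitv (i - 1)) + scl (- \<alpha>) (unitv i))
    else unitv i)"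

lemma unitv_apply: "unitv i j = (if j = i then 1 else 0)"
  by (simp add: unitv_def)

lemma std_frame_dot_self:
  assumes "m \<le> n" "i \<in> {1..2 * n}"
  shows "dot (2 * n) (std_frame \<alpha> \<beta> m i) (std_frame \<alpha> \<beta> m i) = (if i \<le> 2 * m then \<alpha>\<^sup>2 + \<beta>\<^sup>2 else 1)"
proof (cases "i \<le> 2 * m")
  case True
  show ?thesis
  proof (cases "odd i")
    case odd: True
    then have "i + 1 \<le> 2 * n" using True assms(1) by presburger
    then have "i + 1 \<in> {1..2 * n}" by simp
    then show ?thesis
      using True odd assms by (simp add: std_frame_def unitv_apply power2_eq_square)
  next
    case even: False
    moreover have "1 \<le> i" "i \<le> 2 * n" using assms by auto
    ultimately have "1 \<le> i - 1" "i - 1 \<le> 2 * n" "i - 1 \<noteq> i" by presburger+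
    then have "i - 1 \<in> {1..2 * n}" "i - 1 \<noteq> i" "i \<noteq> i - 1" by auto
    then show ?thesis
      using True even assms by (simp add: std_frame_def unitv_apply power2_eq_square)
  qed
qed (use assms in \<open>simp add: std_frame_def unitv_apply\<close>)

text \<open>Within a pair 2j - 1, 2j the dot product is \<alpha> \<beta> - \<beta> \<alpha>; any
  other two vectors have disjoint supports.\<close>

lemma std_frame_orth:
  assumes "m \<le> n" "i \<in> {1..2 * n}" "j \<in> {1..2 * n}" "i < j"
  shows "dot (2 * n) (std_frame \<alpha> \<beta> m i) (std_frame \<alpha> \<beta> m j) = 0"
proof -
  consider (both) "j \<le> 2 * m" | (first) "i \<le> 2 * m" "\<not> j \<le> 2 * m" | (none) "\<not> i \<le> 2 * m" "\<not> j \<le> 2 * m" by linarith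
  then show ?thesis
  proof cases
    case both
    then have i: "i \<le> 2 * m" using assms by linarith
    have le: "1 \<le> i" "j \<le> 2 * n" using assms by auto
    have i1: "odd i \<Longrightarrow> i + 1 \<in> {1..2 * n}" "even i \<Longrightarrow> i - 1 \<in> {1..2 * n}"
      unfolding atLeastAtMost_iff using le \<open>i < j\<close> by presburger+
    \<comment> \<open>Parity separates the supports, which are i, i + 1 for odd i and i - 1, i for
      even i.\<close>
    have ij: "odd i \<Longrightarrow> odd j \<Longrightarrow> i + 1 < j" "even i \<Longrightarrow> odd j \<Longrightarrow> i < j"
        "even i \<Longrightarrow> even j \<Longrightarrow> i < j - 1" "odd i \<Longrightarrow> even j \<Longrightarrow> i + 1 \<noteq> j \<Longrightarrow> i + 1 < j - 1"
      using le \<open>i < j\<close> by presburger+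
    have lt: "i - 1 < j" "j - 1 \<noteq> i - 1" "j \<noteq> i - 1" using le \<open>i < j\<close> by linarith+
    consider "odd i" "odd j" | "even i" "odd j" | "even i" "even j" | "odd i" "j = i + 1" | "odd i" "even j" "i + 1 \<noteq> j"
      by auto
    then show ?thesis
    proof cases
      case 1
      then show ?thesis using i both i1 ij assms by (simp add: std_frame_def unitv_apply)
    next
      case 2
      then show ?thesis using lt i both i1 ij assms by (simp add: std_frame_def unitv_apply)
    next
      case 3
      then show ?thesis using lt i both i1 ij assms by (simp add: std_frame_def unitv_apply)
    next
      case 4
      then show ?thesis using i both i1 assms by (simp add: std_frame_def unitv_apply)
    next
      case 5
      then show ?thesis using i both i1 ij assms by (simp add: std_frame_def unitv_apply)
    qed
  next
    case first
    have le: "1 \<le> i" "j \<le> 2 * n" using assms by auto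
    have i1: "odd i \<Longrightarrow> i + 1 \<in> {1..2 * n}" "odd i \<Longrightarrow> i + 1 \<noteq> j" "even i \<Longrightarrow> i - 1 \<in> {1..2 * n}" "i - 1 \<noteq> j"
      unfolding atLeastAtMost_iff using le \<open>i < j\<close> first by presburger+
    then show ?thesis using first assms by (auto simp: std_frame_def unitv_apply scl_apply)
  next
    case none
    then show ?thesis using assms by (simp add: std_frame_def unitv_apply)
  qed
qed

lemma std_frame:
  assumes q: "Factorial_Ring.prime q" and "m \<le> n" and \<omega>: "\<not> QuadRes q (\<alpha>\<^sup>2 + \<beta>\<^sup>2)"
  shows "orth_frame q (2 * n) (std_frame \<alpha> \<beta> m)" "nonsq q (2 * n) (std_frame \<alpha> \<beta> m) = {1..2 * m}"
proof -
  have 1: "\<not> [1 = 0] (mod q)" using not_prime_unit[of q] q by (auto simp: cong_0_iff)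
  have \<omega>0: "\<not> [\<alpha>\<^sup>2 + \<beta>\<^sup>2 = 0] (mod q)"
    using \<omega> QuadRes_cong[of "\<alpha>\<^sup>2 + \<beta>\<^sup>2" 0 q] QuadRes_square[of q 0] by auto
  show "orth_frame q (2 * n) (std_frame \<alpha> \<beta> m)"
    unfolding orth_family_def
  proof (intro conjI ballI impI)
    fix i j assume ij: "i \<in> {1..2 * n}" "j \<in> {1..2 * n}" "i \<noteq> j"
    show "[dot (2 * n) (std_frame \<alpha> \<beta> m i) (std_frame \<alpha> \<beta> m j) = 0] (mod q)"
    proof (cases "i < j")
      case True
      then show ?thesis using std_frame_orth[OF \<open>m \<le> n\<close> ij(1,2)] by simp
    next
      case False
      then show ?thesis using std_frame_orth[OF \<open>m \<le> n\<close> ij(2,1)] ij(3) by (simp add: dot_commute)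
    qed
  next
    fix i assume "i \<in> {1..2 * n}"
    then show "\<not> [dot (2 * n) (std_frame \<alpha> \<beta> m i) (std_frame \<alpha> \<beta> m i) = 0] (mod q)"
      using std_frame_dot_self[OF \<open>m \<le> n\<close>] \<omega>0 1 by simp
  qed
  have "QuadRes q 1" using QuadRes_square[of q 1] by simp
  then have "i \<in> nonsq q (2 * n) (std_frame \<alpha> \<beta> m) \<longleftrightarrow> i \<in> {1..2 * m}" for i
    using std_frame_dot_self[OF \<open>m \<le> n\<close>, of i \<alpha> \<beta>] \<omega> \<open>m \<le> n\<close>
    unfolding nonsq_def by (auto split: if_splits)
  then show "nonsq q (2 * n) (std_frame \<alpha> \<beta> m) = {1..2 * m}" by blast
qed

section \<open>Orbits\<close>

lemma dec_act_compose:
  assumes "\<Union>\<K> \<subseteq> S"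
  shows "dec_act (dec_act \<K> f) g = dec_act \<K> (compose S g f)"
proof -
  have *: "g ` f ` K = compose S g f ` K" if "K \<in> \<K>" for K
  proof -
    have "K \<subseteq> S" using assms that by blast
    then show ?thesis by (force simp: compose_def image_image intro!: image_cong)
  qed
  have "(\<lambda>K. g ` f ` K) ` \<K> = dec_act \<K> (compose S g f)"
    unfolding dec_act_def by (rule image_cong[OF refl *])
  moreover have "dec_act (dec_act \<K> f) g = (\<lambda>K. g ` f ` K) ` \<K>"
    unfolding dec_act_def by (rule image_image)
  ultimately show ?thesis by (rule trans[rotated])
qed

lemma dec_act_restrict_id:
  assumes "\<Union>\<K> \<subseteq> S"
  shows "dec_act \<K> (\<lambda>x\<in>S. x) = \<K>"
proof -
  have "(\<lambda>x\<in>S. x) ` K = K" if "K \<in> \<K>" for K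
  proof -
    have "K \<subseteq> S" using assms that by blast
    then show ?thesis by (force intro!: image_eqI)
  qed
  then show ?thesis unfolding dec_act_def by simp
qed

text \<open>Closure under composition and inverses makes the orbits of related points equal.
  \<open>compose\<close> and \<open>restrict\<close> appear because the elements of
  \<open>auto\<close> are extensional.\<close>

lemma dec_orbits_eq:
  fixes G :: "('a, 'b) monoid_scheme" and A :: "('a \<Rightarrow> 'a) set"
  assumes A: "A \<subseteq> extensional (carrier G)" "\<And>f. f \<in> A \<Longrightarrow> bij_betw f (carrier G) (carrier G)"
    and comp: "\<And>f g. f \<in> A \<Longrightarrow> g \<in> A \<Longrightarrow> compose (carrier G) g f \<in> A"
    and inv: "\<And>f. f \<in> A \<Longrightarrow> restrict (inv_into (carrier G) f) (carrier G) \<in> A"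
    and sub: "\<And>\<K>. \<K> \<in> S \<Longrightarrow> \<Union>\<K> \<subseteq> carrier G"
    and \<K>: "\<K> \<in> S" and f: "f \<in> A" "dec_act \<K> f = \<L>"
  shows "(\<lambda>g. dec_act \<K> g) ` A = (\<lambda>g. dec_act \<L> g) ` A"
proof -
  have KC: "\<Union>\<K> \<subseteq> carrier G" using sub \<K> by blast
  have "f ` carrier G = carrier G" using A(2)[OF f(1)] by (simp add: bij_betw_def)
  then have LC: "\<Union>\<L> \<subseteq> carrier G" using KC unfolding f(2)[symmetric] dec_act_def by blast
  define f' where "f' = restrict (inv_into (carrier G) f) (carrier G)"
  have f': "f' \<in> A" unfolding f'_def by (rule inv[OF f(1)])
  have "compose (carrier G) f' f = (\<lambda>x\<in>carrier G. x)"
    unfolding f'_def using A(2)[OF f(1)] A(1) f(1) by (intro compose_inv_into_id)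
  then have undo: "dec_act \<L> f' = \<K>"
    unfolding f(2)[symmetric] dec_act_compose[OF KC] using dec_act_restrict_id[OF KC] by simp
  show ?thesis
  proof (intro subset_antisym subsetI)
    fix \<M> assume "\<M> \<in> (\<lambda>g. dec_act \<K> g) ` A"
    then obtain g where g: "g \<in> A" "\<M> = dec_act \<K> g" by blast
    have "\<M> = dec_act \<L> (compose (carrier G) g f')"
      unfolding g(2) dec_act_compose[OF LC, symmetric] undo ..
    then show "\<M> \<in> (\<lambda>g. dec_act \<L> g) ` A" using comp[OF f' g(1)] by blast
  next
    fix \<M> assume "\<M> \<in> (\<lambda>g. dec_act \<L> g) ` A"
    then obtain g where g: "g \<in> A" "\<M> = dec_act \<L> g" by blast
    have "\<M> = dec_act \<K> (compose (carrier G) g f)"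
      unfolding g(2) dec_act_compose[OF KC, symmetric] f(2) ..
    then show "\<M> \<in> (\<lambda>g. dec_act \<K> g) ` A" using comp[OF f(1) g(1)] by blast
  qed
qed

lemma compose_auto:
  assumes "group G" "f \<in> auto G" "g \<in> auto G"
  shows "compose (carrier G) g f \<in> auto G"
  using assms compose_Bij[of g "carrier G" f] group.hom_compose[OF assms(1), of f G g G]
  by (auto simp: auto_def)

lemma inv_auto:
  assumes "group G" "f \<in> auto G"
  shows "restrict (inv_into (carrier G) f) (carrier G) \<in> auto G"
  using assms group.restrict_inv_into_hom[OF assms(1)] restrict_inv_into_Bij by (auto simp: auto_def)

lemma compose_aut_centralizing_derived:
  assumes G: "group G" and f: "f \<in> aut_centralizing_derived G" "g \<in> aut_centralizing_derived G"
  shows "compose (carrier G) g f \<in> aut_centralizing_derived G"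
proof -
  have "derived G (carrier G) \<subseteq> carrier G" using group.derived_in_carrier[OF G] by blast
  then show ?thesis
    using f compose_auto[OF G] unfolding aut_centralizing_derived_def by (auto simp: compose_def)
qed

lemma inv_aut_centralizing_derived:
  assumes G: "group G" and f: "f \<in> aut_centralizing_derived G"
  shows "restrict (inv_into (carrier G) f) (carrier G) \<in> aut_centralizing_derived G"
proof -
  have sub: "derived G (carrier G) \<subseteq> carrier G" using group.derived_in_carrier[OF G] by blast
  have auto: "f \<in> auto G" and fix_D: "\<And>g. g \<in> derived G (carrier G) \<Longrightarrow> f g = g"
    using f by (auto simp: aut_centralizing_derived_def)
  have inj: "inj_on f (carrier G)" using auto by (auto simp: auto_def Bij_def bij_betw_def)
  have "inv_into (carrier G) f g = g" if "g \<in> derived G (carrier G)" for g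
    using inv_into_f_f[OF inj, of g] fix_D[OF that] sub that by auto
  then show ?thesis using inv_auto[OF G auto] sub by (auto simp: aut_centralizing_derived_def)
qed

text \<open>The values up to \<open>n div 2\<close> represent each pair m, n - m once; for even n
  the middle value is its own partner.\<close>

lemma card_orbits_involution:
  assumes "\<And>m m'. m \<le> n \<Longrightarrow> m' \<le> n \<Longrightarrow> F m = F m' \<longleftrightarrow> m' = m \<or> m' = n - m"
  shows "card (F ` {..n}) = 1 + n div 2"
proof -
  have "F ` {..n} = F ` {..n div 2}"
  proof (intro subset_antisym subsetI)
    fix k assume "k \<in> F ` {..n}"
    then obtain m where m: "m \<le> n" "k = F m" by blast
    show "k \<in> F ` {..n div 2}"
    proof (cases "m \<le> n div 2")
      case False
      then have "n - m \<le> n div 2" by linarith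
      moreover have "F m = F (n - m)" using assms[of m "n - m"] m by simp
      ultimately show ?thesis using m by blast
    qed (use m in blast)
  qed auto
  moreover have "inj_on F {..n div 2}"
  proof (rule inj_onI)
    fix m m' assume mm: "m \<in> {..n div 2}" "m' \<in> {..n div 2}" "F m = F m'"
    then have "m \<le> n" "m' \<le> n" by auto
    then have "m' = m \<or> m' = n - m" using assms mm(3) by blast
    then show "m = m'" using mm(1,2) by auto
  qed
  ultimately show ?thesis by (simp add: card_image)
qed

lemma ex1_unique: "\<exists>!x. Q x \<Longrightarrow> Q a \<Longrightarrow> Q b \<Longrightarrow> a = b"
  by blast

theorem theorem7p10:
  fixes H :: "('a, 'b) monoid_scheme" and p n :: nat and x y z :: 'a and \<alpha> \<beta> :: int
  assumes "Factorial_Ring.prime p" and "odd p" and "n \<ge> 1"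
    and "free_cls2_expp H p x y z"
    and "\<not> (\<exists>t::int. t^2 mod int p = (\<alpha>^2 + \<beta>^2) mod int p)"
  shows
    "(\<forall>m\<le>n. \<forall>K\<in>Hdec H n x y z \<alpha> \<beta> m. (cprod H (2*n))\<lparr>carrier := K\<rparr> \<cong> H)
     \<and> (\<forall>m\<le>n. fully_refined (cprod H (2*n)) (Hdec H n x y z \<alpha> \<beta> m))
     \<and> (\<forall>\<K>. fully_refined (cprod H (2*n)) \<K> \<longrightarrow>
           (\<exists>!m. m \<le> n \<and> (\<exists>f\<in>aut_centralizing_derived (cprod H (2*n)).
                               dec_act \<K> f = Hdec H n x y z \<alpha> \<beta> m)))
     \<and> card (dec_orbits (aut_centralizing_derived (cprod H (2*n)))
                        {\<K>. fully_refined (cprod H (2*n)) \<K>}) = 1 + n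
     \<and> (\<forall>m m'. m \<le> n \<longrightarrow> m' \<le> n \<longrightarrow>
           ((\<exists>f\<in>auto (cprod H (2*n)). dec_act (Hdec H n x y z \<alpha> \<beta> m) f = Hdec H n x y z \<alpha> \<beta> m')
            \<longleftrightarrow> m' = m \<or> m' = n - m))
     \<and> card (dec_orbits (auto (cprod H (2*n))) {\<K>. fully_refined (cprod H (2*n)) \<K>})
         = 1 + n div 2"
proof -
  define q where "q = int p"
  define P where "P = cprod H (2 * n)"
  define D where "D = Hdec H n x y z \<alpha> \<beta>"
  have q: "Factorial_Ring.prime q" "odd q" using assms(1,2) by (auto simp: q_def)
  have \<omega>: "\<not> QuadRes q (\<alpha>\<^sup>2 + \<beta>\<^sup>2)" using assms(5) by (simp add: QuadRes_def cong_def q_def)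
  obtain F where F: "heisenberg_coords H q 1 F" and gens: "F (unitv 1) 0 0 0 0 0 = x"
    "F 0 (unitv 1) 0 0 0 0 = y" "F 0 0 (unitv 1) 0 0 0 = z"
    unfolding q_def by (rule free_cls2_expp_coords[OF assms(1,2,4)])
  interpret H: heisenberg_coords H q 1 F by (rule F)
  define E where "E = H.cp_coord (2 * n)"
  interpret P: heisenberg_coords P q "2 * n" E
    unfolding P_def E_def using assms(3) by (intro H.cprod_coords) simp_all
  have elt: "cp_elt H (2 * n) i x = E (unitv i) 0 0 0 0 0" "cp_elt H (2 * n) i y = E 0 (unitv i) 0 0 0 0"
    "cp_elt H (2 * n) i z = E 0 0 (unitv i) 0 0 0" if i: "i \<in> {1..2 * n}" for i
  proof -
    have one: "scl (unitv 1 1) (unitv i) = unitv i" "scl (0 (1::nat)) (unitv i) = 0"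
      by (simp_all add: unitv_apply scl_simps)
    show "cp_elt H (2 * n) i x = E (unitv i) 0 0 0 0 0" "cp_elt H (2 * n) i y = E 0 (unitv i) 0 0 0 0"
      "cp_elt H (2 * n) i z = E 0 0 (unitv i) 0 0 0"
      unfolding gens[symmetric] H.cp_elt_coord[OF refl i] one E_def by (rule refl)+
  qed
  define fr where "fr = std_frame \<alpha> \<beta>"
  have frame: "orth_frame q (2 * n) (fr m)" and nonsq: "nonsq q (2 * n) (fr m) = {1..2 * m}" if "m \<le> n" for m
    unfolding fr_def using std_frame[OF q(1) that \<omega>] by auto
  \<comment> \<open>Each generator has a single nonzero V_0 coordinate, so the factors of a
    generator of \<open>Ksub\<close> produce no twist and their product is exactly g \<otimes>
    \<open>fr m i\<close>.\<close>
  have line: "P.line (fr m i) = (if i \<le> 2 * m then Ksub H n x y z \<alpha> \<beta> i else Hsub H n x y z i)"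
    if m: "m \<le> n" and i: "i \<in> {1..2 * n}" for m i
  proof -
    have gen: "P.line (fr m i) = generate P {E (fr m i) 0 0 0 0 0, E 0 (fr m i) 0 0 0 0, E 0 0 (fr m i) 0 0 0}"
      using P.generate_eq_line frame[OF m] i unfolding orth_family_def by blast
    have collect: "{h g | g. g \<in> {x, y, z}} = {h x, h y, h z}" for h :: "'a \<Rightarrow> (nat \<Rightarrow> 'a) set" by blast
    show ?thesis
    proof (cases "i \<le> 2 * m")
      case False
      then have "fr m i = unitv i" by (simp add: fr_def std_frame_def)
      then have "P.line (fr m i) = Hsub H n x y z i"
        unfolding gen Hsub_def collect elt[OF i] P_def[symmetric] by simp
      then show ?thesis using False by simp
    next
      case True
      show ?thesis
      proof (cases "odd i")
        case odd: True
        then have "i + 1 \<le> 2 * n" using True m by presburger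
        then have i1: "i + 1 \<in> {1..2 * n}" by simp
        have fr_i: "fr m i = scl \<alpha> (unitv i) + scl \<beta> (unitv (i + 1))"
          using True odd by (simp add: fr_def std_frame_def)
        show ?thesis
          using True odd unfolding gen unfolding fr_i Ksub_def Let_def collect elt[OF i] elt[OF i1] P_def[symmetric]
          by (simp add: P.E_int_pow P.E_mult scl_simps wedge_def)
      next
        case even: False
        then have "1 \<le> i - 1" "i - 1 \<le> 2 * n" using True m i by (simp_all, presburger+)
        then have i1: "i - 1 \<in> {1..2 * n}" by simp
        have fr_i: "fr m i = scl \<beta> (unitv (i - 1)) + scl (- \<alpha>) (unitv i)"
          using True even by (simp add: fr_def std_frame_def)
        show ?thesis
          using True even unfolding gen unfolding fr_i Ksub_def Let_def collect elt[OF i] elt[OF i1] P_def[symmetric]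
          by (simp add: P.E_int_pow P.E_mult scl_simps wedge_def)
      qed
    qed
  qed
  have D: "D m = P.frame_dec (fr m)" if "m \<le> n" for m
    unfolding D_def Hdec_def P.frame_dec_def using line[OF that] by (intro image_cong) auto
  have card_nonsq: "card (nonsq q (2 * n) (fr m)) = 2 * m" if "m \<le> n" for m
    using nonsq[OF that] by simp
  have refined: "fully_refined P (D m)" if "m \<le> n" for m
    unfolding D[OF that] by (rule P.fully_refined_frame[OF frame[OF that]])
  have iso: "P\<lparr>carrier := K\<rparr> \<cong> H" if m: "m \<le> n" and K: "K \<in> D m" for m K
  proof -
    obtain i where "i \<in> {1..2 * n}" "K = P.line (fr m i)" using K unfolding D[OF m] P.frame_dec_def by blast
    then show ?thesis using P.line_iso_rank_1[OF _ F] frame[OF m] unfolding orth_family_def by blast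
  qed
  let ?C = "aut_centralizing_derived P"
  have unique: "\<exists>!m. m \<le> n \<and> (\<exists>f\<in>?C. dec_act \<K> f = D m)" if ref: "fully_refined P \<K>" for \<K>
  proof -
    obtain u where u: "orth_frame q (2 * n) u" "\<K> = P.frame_dec u"
      by (rule P.fully_refined_imp_frame[OF ref])
    have iff: "(\<exists>f\<in>?C. dec_act \<K> f = D m) \<longleftrightarrow> 2 * m = card (nonsq q (2 * n) u)" if "m \<le> n" for m
      using P.centralizing_orbit_iff[OF u(1) frame[OF that]] card_nonsq[OF that] unfolding u(2) D[OF that] by simp
    \<comment> \<open>Evenness guarantees that some standard frame has the same count.\<close>
    have "even (card (nonsq q (2 * n) u))" by (rule even_card_nonsq[OF q u(1)])
    then obtain m where m: "card (nonsq q (2 * n) u) = 2 * m" by (rule evenE)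
    have "m \<le> n" using P.nonsq_bound(2)[of u] m by simp
    then show ?thesis using iff m by (intro ex1I[of _ m]) auto
  qed
  \<comment> \<open>The counts are 2m and 2m', and the complementary count is 2n - 2m = 2(n -
    m).\<close>
  have conj: "(\<exists>f\<in>auto P. dec_act (D m) f = D m') \<longleftrightarrow> m' = m \<or> m' = n - m" if "m \<le> n" "m' \<le> n" for m m'
    unfolding D[OF that(1)] D[OF that(2)] P.automorphism_orbit_iff[OF \<omega> frame[OF that(1)] frame[OF that(2)]]
      card_nonsq[OF that(1)] card_nonsq[OF that(2)] using that by presburger
  let ?S = "{\<K>. fully_refined P \<K>}"
  have sub: "\<Union>\<K> \<subseteq> carrier P" if "\<K> \<in> ?S" for \<K>
  proof (rule Union_least)
    fix K assume K: "K \<in> \<K>"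
    have "central_decomp P \<K>" using that by (simp add: fully_refined_def)
    then have "\<forall>K\<in>\<K>. subgroup K P" unfolding central_decomp_def by (rule conjunct1)
    then show "K \<subseteq> carrier P" using K by (intro subgroup.subset) (rule bspec)
  qed
  define orb where "orb A m = (\<lambda>f. dec_act (D m) f) ` A" for A :: "((nat \<Rightarrow> 'a) set \<Rightarrow> (nat \<Rightarrow> 'a) set) set" and m
  have auto_props: "auto P \<subseteq> extensional (carrier P)" "\<And>f. f \<in> auto P \<Longrightarrow> bij_betw f (carrier P) (carrier P)"
    by (auto simp: auto_def Bij_def)
  have C_sub: "?C \<subseteq> auto P" by (auto simp: aut_centralizing_derived_def)
  have orbit_auto: "(\<lambda>f. dec_act \<K> f) ` auto P = (\<lambda>f. dec_act \<L> f) ` auto P"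
    if "\<K> \<in> ?S" "f \<in> auto P" "dec_act \<K> f = \<L>" for \<K> \<L> f
    by (rule dec_orbits_eq[OF auto_props compose_auto[OF P.is_group] inv_auto[OF P.is_group] sub that])
  have orbit_C: "(\<lambda>f. dec_act \<K> f) ` ?C = (\<lambda>f. dec_act \<L> f) ` ?C"
    if "\<K> \<in> ?S" "f \<in> ?C" "dec_act \<K> f = \<L>" for \<K> \<L> f
    by (rule dec_orbits_eq[OF order_trans[OF C_sub auto_props(1)] auto_props(2)[OF subsetD[OF C_sub]]
        compose_aut_centralizing_derived[OF P.is_group] inv_aut_centralizing_derived[OF P.is_group] sub that])
  have id_C: "(\<lambda>x\<in>carrier P. x) \<in> ?C"
  proof -
    have "derived P (carrier P) \<subseteq> carrier P" by (rule P.derived_in_carrier) simp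
    then show ?thesis using P.id_in_auto by (auto simp: aut_centralizing_derived_def)
  qed
  have id_act: "dec_act (D m) (\<lambda>x\<in>carrier P. x) = D m" if "m \<le> n" for m
    using sub refined[OF that] by (intro dec_act_restrict_id) simp
  have orbits_C: "dec_orbits ?C ?S = orb ?C ` {..n}"
    unfolding dec_orbits_def
  proof (intro subset_antisym subsetI)
    fix \<M> assume "\<M> \<in> (\<lambda>\<K>. (\<lambda>f. dec_act \<K> f) ` ?C) ` ?S"
    then obtain \<K> where \<K>: "\<K> \<in> ?S" "\<M> = (\<lambda>f. dec_act \<K> f) ` ?C" by blast
    then obtain m f where m: "m \<le> n" "f \<in> ?C" "dec_act \<K> f = D m" using unique by blast
    then have "\<M> = orb ?C m" unfolding \<K>(2) orb_def by (intro orbit_C \<K>(1))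
    then show "\<M> \<in> orb ?C ` {..n}" using m by blast
  next
    fix \<M> assume "\<M> \<in> orb ?C ` {..n}"
    then show "\<M> \<in> (\<lambda>\<K>. (\<lambda>f. dec_act \<K> f) ` ?C) ` ?S" unfolding orb_def using refined by blast
  qed
  have orbits_auto: "dec_orbits (auto P) ?S = orb (auto P) ` {..n}"
    unfolding dec_orbits_def
  proof (intro subset_antisym subsetI)
    fix \<M> assume "\<M> \<in> (\<lambda>\<K>. (\<lambda>f. dec_act \<K> f) ` auto P) ` ?S"
    then obtain \<K> where \<K>: "\<K> \<in> ?S" "\<M> = (\<lambda>f. dec_act \<K> f) ` auto P" by blast
    then obtain m f where m: "m \<le> n" "f \<in> ?C" "dec_act \<K> f = D m" using unique by blast
    then have "f \<in> auto P" using C_sub by blast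
    then have "\<M> = orb (auto P) m" unfolding \<K>(2) orb_def using m(3) by (rule orbit_auto[OF \<K>(1)])
    then show "\<M> \<in> orb (auto P) ` {..n}" using m by blast
  next
    fix \<M> assume "\<M> \<in> orb (auto P) ` {..n}"
    then show "\<M> \<in> (\<lambda>\<K>. (\<lambda>f. dec_act \<K> f) ` auto P) ` ?S" unfolding orb_def using refined by blast
  qed
  have "inj_on (orb ?C) {..n}"
  proof (rule inj_onI)
    fix m m' assume mm: "m \<in> {..n}" "m' \<in> {..n}" "orb ?C m = orb ?C m'"
    then have le: "m \<le> n" "m' \<le> n" by auto
    have "D m' \<in> orb ?C m'" unfolding orb_def by (rule image_eqI, rule id_act[OF le(2), symmetric], rule id_C)
    then have "D m' \<in> orb ?C m" unfolding mm(3) .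
    then have "D m' \<in> (\<lambda>f. dec_act (D m) f) ` ?C" unfolding orb_def .
    then obtain f where f: "D m' = dec_act (D m) f" "f \<in> ?C" by (rule imageE)
    have m': "m' \<le> n \<and> (\<exists>f\<in>?C. dec_act (D m) f = D m')"
      by (rule conjI, rule le(2), rule bexI, rule f(1)[symmetric], rule f(2))
    have m: "m \<le> n \<and> (\<exists>f\<in>?C. dec_act (D m) f = D m)"
      by (rule conjI, rule le(1), rule bexI, rule id_act[OF le(1)], rule id_C)
    \<comment> \<open>Both indices fit the decomposition \<open>D m\<close>, so
      \<open>unique\<close> applies to it.\<close>
    show "m = m'" by (rule ex1_unique[OF unique[OF refined[OF le(1)]] m m'])
  qed
  then have card_C: "card (dec_orbits ?C ?S) = 1 + n" unfolding orbits_C by (simp add: card_image)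
  have "orb (auto P) m = orb (auto P) m' \<longleftrightarrow> m' = m \<or> m' = n - m" if le: "m \<le> n" "m' \<le> n" for m m'
  proof
    assume eq: "orb (auto P) m = orb (auto P) m'"
    have "D m' \<in> orb (auto P) m'" unfolding orb_def by (rule image_eqI, rule id_act[OF le(2), symmetric], rule P.id_in_auto)
    then have "D m' \<in> orb (auto P) m" unfolding eq .
    then have "D m' \<in> (\<lambda>f. dec_act (D m) f) ` auto P" unfolding orb_def .
    then obtain f where f: "D m' = dec_act (D m) f" "f \<in> auto P" by (rule imageE)
    have "\<exists>f\<in>auto P. dec_act (D m) f = D m'" by (rule bexI, rule f(1)[symmetric], rule f(2))
    then show "m' = m \<or> m' = n - m" using conj[OF le] by blast
  next
    assume "m' = m \<or> m' = n - m"
    then obtain f where f: "f \<in> auto P" "dec_act (D m) f = D m'" using conj[OF le] by blast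
    show "orb (auto P) m = orb (auto P) m'"
      unfolding orb_def by (rule orbit_auto[OF _ f]) (simp add: refined[OF le(1)])
  qed
  then have card_auto: "card (dec_orbits (auto P) ?S) = 1 + n div 2"
    unfolding orbits_auto by (rule card_orbits_involution)
  show ?thesis
    unfolding P_def[symmetric] D_def[symmetric]
  proof (intro conjI allI impI ballI)
    show "P\<lparr>carrier := K\<rparr> \<cong> H" if "m \<le> n" "K \<in> D m" for m K by (rule iso[OF that])
    show "fully_refined P (D m)" if "m \<le> n" for m by (rule refined[OF that])
    show "\<exists>!m. m \<le> n \<and> (\<exists>f\<in>?C. dec_act \<K> f = D m)" if "fully_refined P \<K>" for \<K>
      by (rule unique[OF that])
    show "(\<exists>f\<in>auto P. dec_act (D m) f = D m') \<longleftrightarrow> m' = m \<or> m' = n - m" if "m \<le> n" "m' \<le> n" for m m'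
      by (rule conj[OF that])
  qed (fact card_C card_auto)+
qed

end
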